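(* Let $R$ be a ring and let $M$ be a left $R$-module which is projective in $\sigma[M]$ and semiprime. Suppose that $M$ satisfies ACC on left annihilators and that $P_1,\dots,P_n$ are the minimal prime in $M$ submodules. Then: (1) $\widehat{M}\cong E^{[M]}(M/P_1)\oplus E^{[M]}(M/P_2)\oplus\cdots\oplus E^{[M]}(M/P_n)$. (2) If in addition $M$ is a Goldie module, then $M/P_i$ has finite uniform dimension for all $1\le i\le n$.
   Context: Rings are associative with unit and modules are left unital modules. $\sigma[M]$ is the full subcategory of $R$-Mod of $M$-subgenerated modules (submodules of quotients of direct sums of copies of $M$). "Projective in $\sigma[M]$" means that $\mathrm{Hom}_R(M,-)$ is exact on short exact sequences in $\sigma[M]$. For $K\in\sigma[X]$, $E^{[X]}(K)$ denotes the $X$-injective hull of $K$ (its injective hull in the category $\sigma[X]$), and $\widehat{X}=E^{[X]}(X)$. A submodule $N\le M$ is fully invariant, $N\leq_{FI}M$, if $f(N)\le N$ for all $f\in \mathrm{End}_R(M)$. For $N,K\le M$, the product is $N_MK=\sum\{f(N)\mid f\in \mathrm{Hom}_R(M,K)\}$. A proper submodule $P\leq_{FI}M$ is prime in $M$ if whenever $N,K\leq_{FI}M$ and $N_MK\le P$, then $N\le P$ or $K\le P$; the minimal prime in $M$ submodules are the minimal elements (under inclusion) of the set of prime in $M$ submodules. $M$ is semiprime if whenever $K\leq_{FI}M$ and $K_MK=0$, then $K=0$. A left annihilator in $M$ is a submodule of the form $\bigcap_{f\in X}\mathrm{Ker}(f)$ for some $X\subseteq \mathrm{End}_R(M)$.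 $M$ is a Goldie module if it satisfies ACC on left annihilators and has finite uniform dimension. *)

theory Defs
  imports "HOL-Algebra.Module" "HOL-Algebra.AbelCoset"
begin

section \<open>Left modules over a possibly noncommutative ring\<close>

text \<open>
  The locale \<^locale>\<open>module\<close> asks for a commutative ring of scalars; the following is the same
  list of axioms over an arbitrary unital ring. Only the fields \<open>carrier\<close>, \<open>add\<close>, \<open>zero\<close> and
  \<open>smult\<close> of the record are used; \<open>mult\<close> and \<open>one\<close> are never looked at.
  Submodules are those of the library (\<^const>\<open>submodule\<close>), which does not need commutativity,
  and a submodule \<open>N\<close> of \<open>M\<close> becomes a module as \<open>M\<lparr>carrier := N\<rparr>\<close>.
\<close>

locale left_module = R?: ring R + M?: abelian_group M
  for R (structure) and M (structure) +
  assumes smult_closed [simp, intro]: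
      "\<lbrakk>a \<in> carrier R; x \<in> carrier M\<rbrakk> \<Longrightarrow> a \<odot>\<^bsub>M\<^esub> x \<in> carrier M"
    and smult_l_distr:
      "\<lbrakk>a \<in> carrier R; b \<in> carrier R; x \<in> carrier M\<rbrakk> \<Longrightarrow>
        (a \<oplus>\<^bsub>R\<^esub> b) \<odot>\<^bsub>M\<^esub> x = a \<odot>\<^bsub>M\<^esub> x \<oplus>\<^bsub>M\<^esub> b \<odot>\<^bsub>M\<^esub> x"
    and smult_r_distr:
      "\<lbrakk>a \<in> carrier R; x \<in> carrier M; y \<in> carrier M\<rbrakk> \<Longrightarrow>
        a \<odot>\<^bsub>M\<^esub> (x \<oplus>\<^bsub>M\<^esub> y) = a \<odot>\<^bsub>M\<^esub> x \<oplus>\<^bsub>M\<^esub> a \<odot>\<^bsub>M\<^esub> y"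
    and smult_assoc1:
      "\<lbrakk>a \<in> carrier R; b \<in> carrier R; x \<in> carrier M\<rbrakk> \<Longrightarrow>
        (a \<otimes>\<^bsub>R\<^esub> b) \<odot>\<^bsub>M\<^esub> x = a \<odot>\<^bsub>M\<^esub> (b \<odot>\<^bsub>M\<^esub> x)"
    and smult_one [simp]:
      "x \<in> carrier M \<Longrightarrow> \<one>\<^bsub>R\<^esub> \<odot>\<^bsub>M\<^esub> x = x"

text \<open>Homomorphisms are extensional, so that equal homomorphisms are equal as HOL functions.\<close>

definition mhom :: "('r, 'x) ring_scheme \<Rightarrow> ('r, 'a) module \<Rightarrow> ('r, 'b) module \<Rightarrow> ('a \<Rightarrow> 'b) set"
  where "mhom R M N =
    {f \<in> carrier M \<rightarrow>\<^sub>E carrier N.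
      (\<forall>x\<in>carrier M. \<forall>y\<in>carrier M. f (x \<oplus>\<^bsub>M\<^esub> y) = f x \<oplus>\<^bsub>N\<^esub> f y) \<and>
      (\<forall>r\<in>carrier R. \<forall>x\<in>carrier M. f (r \<odot>\<^bsub>M\<^esub> x) = r \<odot>\<^bsub>N\<^esub> f x)}"

definition mker :: "('r, 'a) module \<Rightarrow> ('r, 'b) module \<Rightarrow> ('a \<Rightarrow> 'b) \<Rightarrow> 'a set"
  where "mker M N f = {x \<in> carrier M. f x = \<zero>\<^bsub>N\<^esub>}"

definition miso :: "('r, 'x) ring_scheme \<Rightarrow> ('r, 'a) module \<Rightarrow> ('r, 'b) module \<Rightarrow> bool"
  where "miso R M N \<longleftrightarrow> (\<exists>f\<in>mhom R M N. bij_betw f (carrier M) (carrier N))"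

definition quot_module :: "('r, 'a) module \<Rightarrow> 'a set \<Rightarrow> ('r, 'a set) module"
  where "quot_module M N =
    \<lparr>carrier = a_rcosets\<^bsub>M\<^esub> N, mult = undefined, one = undefined, zero = N,
     add = set_add M,
     smult = (\<lambda>r X. \<Union>x\<in>X. N +>\<^bsub>M\<^esub> (r \<odot>\<^bsub>M\<^esub> x))\<rparr>"

definition direct_sum :: "'i set \<Rightarrow> ('i \<Rightarrow> ('r, 'a) module) \<Rightarrow> ('r, 'i \<Rightarrow> 'a) module"
  where "direct_sum I A =
    \<lparr>carrier = {x \<in> (\<Pi>\<^sub>E i\<in>I. carrier (A i)). finite {i \<in> I. x i \<noteq> \<zero>\<^bsub>A i\<^esub>}},
     mult = undefined, one = undefined, zero = (\<lambda>i\<in>I. \<zero>\<^bsub>A i\<^esub>),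
     add = (\<lambda>x y. \<lambda>i\<in>I. x i \<oplus>\<^bsub>A i\<^esub> y i),
     smult = (\<lambda>r x. \<lambda>i\<in>I. r \<odot>\<^bsub>A i\<^esub> x i)\<rparr>"

text \<open>The sum of a family of submodules (or of subsets) is the submodule generated by its union.\<close>

definition submodule_sum :: "('r, 'x) ring_scheme \<Rightarrow> ('r, 'a) module \<Rightarrow> 'a set set \<Rightarrow> 'a set"
  where "submodule_sum R M \<N> = \<Inter>{N. submodule N R M \<and> \<Union>\<N> \<subseteq> N}"


section \<open>The category \<open>\<sigma>[M]\<close>\<close>

text \<open>
  \<open>N\<close> is an object of \<open>\<sigma>[M]\<close> iff it embeds in a quotient of a direct sum of copies of \<open>M\<close>.
  The index sets range over subsets of \<^typ>\<open>'b \<times> nat\<close>, where \<^typ>\<open>'b\<close> is the type of the elements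
  of \<open>N\<close>. This is no restriction: given an embedding of \<open>N\<close> in a quotient of \<open>M\<^sup>(\<^sup>I\<^sup>)\<close> with \<open>I\<close>
  arbitrary, choose a representative for each element of \<open>N\<close>; the finite supports of these
  representatives lie in a set \<open>J\<close> that injects into \<^typ>\<open>'b \<times> nat\<close>, and \<open>N\<close> already embeds in
  a quotient of \<open>M\<^sup>(\<^sup>J\<^sup>)\<close>.
\<close>

definition subgenerated ::
    "('r, 'x) ring_scheme \<Rightarrow> ('r, 'a) module \<Rightarrow> ('r, 'b) module \<Rightarrow> bool"
  where "subgenerated R M N \<longleftrightarrow> left_module R N \<and>
    (\<exists>(I :: ('b \<times> nat) set) K j.
      submodule K R (direct_sum I (\<lambda>_. M)) \<and>
      j \<in> mhom R N (quot_module (direct_sum I (\<lambda>_. M)) K) \<and> inj_on j (carrier N))"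

definition short_exact ::
    "('r, 'x) ring_scheme \<Rightarrow> ('r, 'a) module \<Rightarrow> ('r, 'b) module \<Rightarrow> ('r, 'c) module \<Rightarrow>
      ('a \<Rightarrow> 'b) \<Rightarrow> ('b \<Rightarrow> 'c) \<Rightarrow> bool"
  where "short_exact R A B C f g \<longleftrightarrow>
    f \<in> mhom R A B \<and> g \<in> mhom R B C \<and>
    inj_on f (carrier A) \<and> f ` carrier A = mker B C g \<and> g ` carrier B = carrier C"

text \<open>
  \<open>M\<close> is projective in \<open>\<sigma>[M]\<close>: the functor \<open>Hom(M, -)\<close> maps each short exact sequence
  \<open>0 \<rightarrow> A \<rightarrow> B \<rightarrow> C \<rightarrow> 0\<close> in \<open>\<sigma>[M]\<close> to a short exact sequence of abelian groups. HOL cannot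
  quantify over all types, so \<open>A\<close>, \<open>B\<close>, \<open>C\<close> have elements in the type \<^typ>\<open>('r \<times> 'a) list\<close>.
  This is no restriction. The first two conditions hold for every short exact sequence. For the
  third, to lift \<open>h : M \<rightarrow> C\<close> along \<open>g : B \<rightarrow> C\<close> choose \<open>b x \<in> B\<close> with \<open>g (b x) = h x\<close> for
  \<open>x \<in> M\<close>; one can replace \<open>C\<close> by \<open>h(M)\<close>, \<open>B\<close> by the submodule of the finite sums
  \<open>\<Sum> r\<^sub>k b(x\<^sub>k)\<close>, and \<open>A\<close> by a kernel in it. The finite sums are named by lists of pairs
  \<open>(r\<^sub>k, x\<^sub>k)\<close>, so all three have isomorphic copies in this type.
\<close>

definition projective_in_sigma :: "('r, 'x) ring_scheme \<Rightarrow> ('r, 'a) module \<Rightarrow> bool"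
  where "projective_in_sigma R M \<longleftrightarrow>
    (\<forall>(A :: ('r, ('r \<times> 'a) list) module) (B :: ('r, ('r \<times> 'a) list) module)
      (C :: ('r, ('r \<times> 'a) list) module) f g.
      subgenerated R M A \<and> subgenerated R M B \<and> subgenerated R M C \<and> short_exact R A B C f g \<longrightarrow>
        inj_on (compose (carrier M) f) (mhom R M A) \<and>
        compose (carrier M) f ` mhom R M A =
          {h \<in> mhom R M B. compose (carrier M) g h = (\<lambda>x\<in>carrier M. \<zero>\<^bsub>C\<^esub>)} \<and>
        compose (carrier M) g ` mhom R M B = mhom R M C)"


section \<open>Injective hulls in \<open>\<sigma>[X]\<close>\<close>

definition essential :: "('r, 'x) ring_scheme \<Rightarrow> ('r, 'a) module \<Rightarrow> 'a set \<Rightarrow> bool"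
  where "essential R M N \<longleftrightarrow> submodule N R M \<and>
    (\<forall>L. submodule L R M \<and> N \<inter> L = {\<zero>\<^bsub>M\<^esub>} \<longrightarrow> L = {\<zero>\<^bsub>M\<^esub>})"

definition rel_injective ::
    "('r, 'x) ring_scheme \<Rightarrow> ('r, 'a) module \<Rightarrow> ('r, 'b) module \<Rightarrow> bool"
  where "rel_injective R X E \<longleftrightarrow>
    (\<forall>N f. submodule N R X \<and> f \<in> mhom R (X\<lparr>carrier := N\<rparr>) E \<longrightarrow>
      (\<exists>g\<in>mhom R X E. \<forall>x\<in>N. g x = f x))"

text \<open>
  \<open>E\<close> is an \<open>X\<close>-injective hull of \<open>K\<close>, i.e. a representative of \<open>E\<^sup>[\<^sup>X\<^sup>](K)\<close>, which is determined
  up to isomorphism: an \<open>X\<close>-injective module in \<open>\<sigma>[X]\<close> with an essential embedding of \<open>K\<close>.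
\<close>

definition injective_hull ::
    "('r, 'x) ring_scheme \<Rightarrow> ('r, 'a) module \<Rightarrow> ('r, 'b) module \<Rightarrow> ('r, 'c) module \<Rightarrow> bool"
  where "injective_hull R X K E \<longleftrightarrow>
    subgenerated R X E \<and> rel_injective R X E \<and>
    (\<exists>j\<in>mhom R K E. inj_on j (carrier K) \<and> essential R E (j ` carrier K))"


section \<open>Products, prime submodules, semiprime modules\<close>

definition fully_invariant :: "('r, 'x) ring_scheme \<Rightarrow> ('r, 'a) module \<Rightarrow> 'a set \<Rightarrow> bool"
  where "fully_invariant R M N \<longleftrightarrow> submodule N R M \<and> (\<forall>f\<in>mhom R M M. f ` N \<subseteq> N)"

definition submodule_prod ::
    "('r, 'x) ring_scheme \<Rightarrow> ('r, 'a) module \<Rightarrow> 'a set \<Rightarrow> 'a set \<Rightarrow> 'a set"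
  where "submodule_prod R M N K =
    submodule_sum R M {f ` N |f. f \<in> mhom R M (M\<lparr>carrier := K\<rparr>)}"

definition prime_in :: "('r, 'x) ring_scheme \<Rightarrow> ('r, 'a) module \<Rightarrow> 'a set \<Rightarrow> bool"
  where "prime_in R M P \<longleftrightarrow> fully_invariant R M P \<and> P \<noteq> carrier M \<and>
    (\<forall>N K. fully_invariant R M N \<and> fully_invariant R M K \<and> submodule_prod R M N K \<subseteq> P \<longrightarrow>
      N \<subseteq> P \<or> K \<subseteq> P)"

definition minimal_primes :: "('r, 'x) ring_scheme \<Rightarrow> ('r, 'a) module \<Rightarrow> 'a set set"
  where "minimal_primes R M =
    {P. prime_in R M P \<and> (\<forall>Q. prime_in R M Q \<and> Q \<subseteq> P \<longrightarrow> Q = P)}"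

definition semiprime_module :: "('r, 'x) ring_scheme \<Rightarrow> ('r, 'a) module \<Rightarrow> bool"
  where "semiprime_module R M \<longleftrightarrow>
    (\<forall>K. fully_invariant R M K \<and> submodule_prod R M K K = {\<zero>\<^bsub>M\<^esub>} \<longrightarrow> K = {\<zero>\<^bsub>M\<^esub>})"


section \<open>Goldie modules\<close>

text \<open>For the empty set of endomorphisms the annihilator is \<open>M\<close> itself.\<close>

definition left_annihilator :: "('r, 'x) ring_scheme \<Rightarrow> ('r, 'a) module \<Rightarrow> 'a set \<Rightarrow> bool"
  where "left_annihilator R M N \<longleftrightarrow>
    (\<exists>S \<subseteq> mhom R M M. N = carrier M \<inter> (\<Inter>f\<in>S. mker M M f))"

definition acc_left_annihilators :: "('r, 'x) ring_scheme \<Rightarrow> ('r, 'a) module \<Rightarrow> bool"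
  where "acc_left_annihilators R M \<longleftrightarrow>
    (\<forall>A :: nat \<Rightarrow> 'a set. (\<forall>i. left_annihilator R M (A i)) \<and> (\<forall>i. A i \<subseteq> A (Suc i)) \<longrightarrow>
      (\<exists>k. \<forall>i\<ge>k. A i = A k))"

definition uniform_module :: "('r, 'x) ring_scheme \<Rightarrow> ('r, 'a) module \<Rightarrow> bool"
  where "uniform_module R U \<longleftrightarrow> carrier U \<noteq> {\<zero>\<^bsub>U\<^esub>} \<and>
    (\<forall>N. submodule N R U \<and> N \<noteq> {\<zero>\<^bsub>U\<^esub>} \<longrightarrow> essential R U N)"

text \<open>\<open>M\<close> has uniform dimension \<open>k\<close>: some direct sum of \<open>k\<close> uniform submodules is essential in \<open>M\<close>.\<close>

definition has_uniform_dim :: "('r, 'x) ring_scheme \<Rightarrow> ('r, 'a) module \<Rightarrow> nat \<Rightarrow> bool"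
  where "has_uniform_dim R M k \<longleftrightarrow>
    (\<exists>U :: nat \<Rightarrow> 'a set.
      (\<forall>i<k. submodule (U i) R M \<and> uniform_module R (M\<lparr>carrier := U i\<rparr>)) \<and>
      (\<forall>i<k. U i \<inter> submodule_sum R M (U ` ({..<k} - {i})) = {\<zero>\<^bsub>M\<^esub>}) \<and>
      essential R M (submodule_sum R M (U ` {..<k})))"

definition finite_uniform_dim :: "('r, 'x) ring_scheme \<Rightarrow> ('r, 'a) module \<Rightarrow> bool"
  where "finite_uniform_dim R M \<longleftrightarrow> (\<exists>k. has_uniform_dim R M k)"

definition goldie_module :: "('r, 'x) ring_scheme \<Rightarrow> ('r, 'a) module \<Rightarrow> bool"
  where "goldie_module R M \<longleftrightarrow> acc_left_annihilators R M \<and> finite_uniform_dim R M"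

end

theory Submission
  imports Defs
begin

text \<open>
  Let \<open>N\<^sub>i\<close> be the intersection of the minimal primes other than \<open>P\<^sub>i\<close>. Lifting
  through direct sums of copies of \<open>L\<close> shows that, if every map from \<open>M\<close> into a
  submodule \<open>L\<close> kills \<open>N\<^sub>i\<close>, then every map into the fully invariant closure of
  \<open>L\<close> does, so that \<open>L\<close> lies in \<open>P\<^sub>i\<close>. Hence every element outside \<open>P\<^sub>i\<close>
  has a nonzero multiple in \<open>N\<^sub>i\<close>, that is, \<open>N\<^sub>i\<close> embeds in \<open>M/P\<^sub>i\<close> as an
  essential submodule. As the minimal primes intersect in zero (an m-sequence argument), \<open>M\<close> embeds in
  \<open>\<Oplus>\<^sub>i M/P\<^sub>i\<close>, with essential image because the image contains the image of each
  \<open>N\<^sub>i\<close>. The sum of the hulls of the \<open>M/P\<^sub>i\<close> is therefore an injective hull of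
  \<open>M\<close>, and hulls are unique. If \<open>M\<close> has finite uniform dimension, so has its submodule
  \<open>N\<^sub>i\<close>, and therefore also the essential extension \<open>M/P\<^sub>i\<close>.
\<close>

section \<open>Modules, submodules and homomorphisms\<close>

text \<open>A map into the fully invariant closure of \<open>L\<close> need not have its image in
  \<open>L\<close>. But the closure is a sum of endomorphic images of \<open>L\<close>, hence a
  quotient of a direct sum of copies of \<open>L\<close>. Projectivity lifts the map to that direct
  sum, and every coordinate of the lift is an endomorphism of \<open>M\<close> with image in
  \<open>L\<close>. If \<open>N\<close> is fully invariant, such a coordinate sends \<open>N\<close>
  into the intersection of \<open>N\<close> and \<open>L\<close>; this is how a trivial intersection
  becomes the vanishing of maps. The same factorisation, applied to a sum of two submodules, makes
  the maximal submodule of the m-sequence argument prime. Two definitions shape the rest.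
  Projectivity is available only for modules of lists, so a lifting problem has to be renamed first.
  Injectivity of a hull extends maps from submodules of \<open>M\<close> alone, whereas comparing
  hulls requires extension inside other objects of \<open>\<sigma>[M]\<close>. Finite uniform
  dimension is never computed: it is transferred as the existence of a finite jointly injective
  family of maps to uniform modules, a property that restricts to submodules.\<close>

lemma left_moduleI:
  assumes "ring R"
    and add: "\<And>x y. x \<in> carrier N \<Longrightarrow> y \<in> carrier N \<Longrightarrow> x \<oplus>\<^bsub>N\<^esub> y \<in> carrier N"
    and zero: "\<zero>\<^bsub>N\<^esub> \<in> carrier N"
    and assoc: "\<And>x y z. x \<in> carrier N \<Longrightarrow> y \<in> carrier N \<Longrightarrow> z \<in> carrier N \<Longrightarrow>
      (x \<oplus>\<^bsub>N\<^esub> y) \<oplus>\<^bsub>N\<^esub> z = x \<oplus>\<^bsub>N\<^esub> (y \<oplus>\<^bsub>N\<^esub> z)"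
    and comm: "\<And>x y. x \<in> carrier N \<Longrightarrow> y \<in> carrier N \<Longrightarrow> x \<oplus>\<^bsub>N\<^esub> y = y \<oplus>\<^bsub>N\<^esub> x"
    and l_zero: "\<And>x. x \<in> carrier N \<Longrightarrow> \<zero>\<^bsub>N\<^esub> \<oplus>\<^bsub>N\<^esub> x = x"
    and smult: "\<And>a x. a \<in> carrier R \<Longrightarrow> x \<in> carrier N \<Longrightarrow> a \<odot>\<^bsub>N\<^esub> x \<in> carrier N"
    and l_distr: "\<And>a b x. a \<in> carrier R \<Longrightarrow> b \<in> carrier R \<Longrightarrow> x \<in> carrier N \<Longrightarrow>
      (a \<oplus>\<^bsub>R\<^esub> b) \<odot>\<^bsub>N\<^esub> x = a \<odot>\<^bsub>N\<^esub> x \<oplus>\<^bsub>N\<^esub> b \<odot>\<^bsub>N\<^esub> x"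
    and r_distr: "\<And>a x y. a \<in> carrier R \<Longrightarrow> x \<in> carrier N \<Longrightarrow> y \<in> carrier N \<Longrightarrow>
      a \<odot>\<^bsub>N\<^esub> (x \<oplus>\<^bsub>N\<^esub> y) = a \<odot>\<^bsub>N\<^esub> x \<oplus>\<^bsub>N\<^esub> a \<odot>\<^bsub>N\<^esub> y"
    and assoc1: "\<And>a b x. a \<in> carrier R \<Longrightarrow> b \<in> carrier R \<Longrightarrow> x \<in> carrier N \<Longrightarrow>
      (a \<otimes>\<^bsub>R\<^esub> b) \<odot>\<^bsub>N\<^esub> x = a \<odot>\<^bsub>N\<^esub> (b \<odot>\<^bsub>N\<^esub> x)"
    and one: "\<And>x. x \<in> carrier N \<Longrightarrow> \<one>\<^bsub>R\<^esub> \<odot>\<^bsub>N\<^esub> x = x"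
    and zero_smult: "\<And>x. x \<in> carrier N \<Longrightarrow> \<zero>\<^bsub>R\<^esub> \<odot>\<^bsub>N\<^esub> x = \<zero>\<^bsub>N\<^esub>"
  shows "left_module R N"
proof -
  interpret R: ring R by fact
  \<comment> \<open>No inverse is among the assumptions: the scalar minus one supplies it.
    Submodules, direct sums, quotients and renamed copies thus become modules without exhibiting
    negatives.\<close>
  have "\<exists>y\<in>carrier N. y \<oplus>\<^bsub>N\<^esub> x = \<zero>\<^bsub>N\<^esub>" if x: "x \<in> carrier N" for x
  proof
    show "(\<ominus>\<^bsub>R\<^esub> \<one>\<^bsub>R\<^esub>) \<odot>\<^bsub>N\<^esub> x \<in> carrier N" using smult x by simp
    have "(\<ominus>\<^bsub>R\<^esub> \<one>\<^bsub>R\<^esub>) \<odot>\<^bsub>N\<^esub> x \<oplus>\<^bsub>N\<^esub> \<one>\<^bsub>R\<^esub> \<odot>\<^bsub>N\<^esub> x = (\<ominus>\<^bsub>R\<^esub> \<one>\<^bsub>R\<^esub> \<oplus>\<^bsub>R\<^esub> \<one>\<^bsub>R\<^esub>) \<odot>\<^bsub>N\<^esub> x"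
      using l_distr x by simp
    then show "(\<ominus>\<^bsub>R\<^esub> \<one>\<^bsub>R\<^esub>) \<odot>\<^bsub>N\<^esub> x \<oplus>\<^bsub>N\<^esub> x = \<zero>\<^bsub>N\<^esub>"
      using one zero_smult x by (simp add: R.l_neg)
  qed
  then have "abelian_group N"
    by (intro abelian_groupI add zero assoc comm l_zero)
  then show ?thesis
    using assms(1) smult l_distr r_distr assoc1 one
    by (simp add: left_module_def left_module_axioms_def)
qed

context left_module
begin

lemma zero_smult [simp]:
  assumes "x \<in> carrier M" shows "\<zero>\<^bsub>R\<^esub> \<odot>\<^bsub>M\<^esub> x = \<zero>\<^bsub>M\<^esub>"
proof -
  have "\<zero>\<^bsub>R\<^esub> \<odot>\<^bsub>M\<^esub> x \<oplus>\<^bsub>M\<^esub> \<zero>\<^bsub>R\<^esub> \<odot>\<^bsub>M\<^esub> x = (\<zero>\<^bsub>R\<^esub> \<oplus>\<^bsub>R\<^esub> \<zero>\<^bsub>R\<^esub>) \<odot>\<^bsub>M\<^esub> x"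
    using assms by (simp only: smult_l_distr R.zero_closed)
  also have "\<dots> = \<zero>\<^bsub>R\<^esub> \<odot>\<^bsub>M\<^esub> x" by simp
  finally show ?thesis using assms
    by (metis M.add.r_cancel_one R.zero_closed smult_closed)
qed

lemma smult_zero [simp]:
  assumes "a \<in> carrier R" shows "a \<odot>\<^bsub>M\<^esub> \<zero>\<^bsub>M\<^esub> = \<zero>\<^bsub>M\<^esub>"
proof -
  have "a \<odot>\<^bsub>M\<^esub> \<zero>\<^bsub>M\<^esub> \<oplus>\<^bsub>M\<^esub> a \<odot>\<^bsub>M\<^esub> \<zero>\<^bsub>M\<^esub> = a \<odot>\<^bsub>M\<^esub> (\<zero>\<^bsub>M\<^esub> \<oplus>\<^bsub>M\<^esub> \<zero>\<^bsub>M\<^esub>)"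
    using assms by (simp only: smult_r_distr M.zero_closed)
  also have "\<dots> = a \<odot>\<^bsub>M\<^esub> \<zero>\<^bsub>M\<^esub>" by simp
  finally show ?thesis using assms
    by (metis M.add.r_cancel_one M.zero_closed smult_closed)
qed

lemma minus_eq_smult:
  assumes "x \<in> carrier M" shows "\<ominus>\<^bsub>M\<^esub> x = (\<ominus>\<^bsub>R\<^esub> \<one>\<^bsub>R\<^esub>) \<odot>\<^bsub>M\<^esub> x"
proof -
  have "(\<ominus>\<^bsub>R\<^esub> \<one>\<^bsub>R\<^esub>) \<odot>\<^bsub>M\<^esub> x \<oplus>\<^bsub>M\<^esub> \<one>\<^bsub>R\<^esub> \<odot>\<^bsub>M\<^esub> x = (\<ominus>\<^bsub>R\<^esub> \<one>\<^bsub>R\<^esub> \<oplus>\<^bsub>R\<^esub> \<one>\<^bsub>R\<^esub>) \<odot>\<^bsub>M\<^esub> x"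
    using assms by (simp only: smult_l_distr R.one_closed R.a_inv_closed)
  also have "\<dots> = \<zero>\<^bsub>M\<^esub>" using assms by (simp add: R.l_neg)
  finally have "(\<ominus>\<^bsub>R\<^esub> \<one>\<^bsub>R\<^esub>) \<odot>\<^bsub>M\<^esub> x \<oplus>\<^bsub>M\<^esub> x = \<zero>\<^bsub>M\<^esub>" using assms by simp
  then show ?thesis using assms by (metis M.minus_equality R.a_inv_closed R.one_closed smult_closed)
qed

lemma smult_commute_minus:
  assumes "a \<in> carrier R" "x \<in> carrier M" shows "a \<odot>\<^bsub>M\<^esub> (\<ominus>\<^bsub>M\<^esub> x) = \<ominus>\<^bsub>M\<^esub> (a \<odot>\<^bsub>M\<^esub> x)"
proof -
  have "a \<odot>\<^bsub>M\<^esub> (\<ominus>\<^bsub>M\<^esub> x) \<oplus>\<^bsub>M\<^esub> a \<odot>\<^bsub>M\<^esub> x = a \<odot>\<^bsub>M\<^esub> (\<ominus>\<^bsub>M\<^esub> x \<oplus>\<^bsub>M\<^esub> x)"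
    using assms by (simp only: smult_r_distr M.a_inv_closed)
  also have "\<dots> = \<zero>\<^bsub>M\<^esub>" using assms by (simp add: M.l_neg)
  finally show ?thesis using assms by (metis M.minus_equality M.a_inv_closed smult_closed)
qed

lemma submodule_intro:
  assumes sub: "H \<subseteq> carrier M" and zero: "\<zero>\<^bsub>M\<^esub> \<in> H"
    and add: "\<And>x y. x \<in> H \<Longrightarrow> y \<in> H \<Longrightarrow> x \<oplus>\<^bsub>M\<^esub> y \<in> H"
    and smult: "\<And>a x. a \<in> carrier R \<Longrightarrow> x \<in> H \<Longrightarrow> a \<odot>\<^bsub>M\<^esub> x \<in> H"
  shows "submodule H R M"
proof -
  have "\<ominus>\<^bsub>M\<^esub> x \<in> H" if "x \<in> H" for x
    using that sub smult[of "\<ominus>\<^bsub>R\<^esub> \<one>\<^bsub>R\<^esub>" x] minus_eq_smult[of x] by auto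
  then have "subgroup H (add_monoid M)"
    using sub zero add by (auto intro!: subgroup.intro simp flip: a_inv_def)
  then show ?thesis using smult by (simp add: submodule_def submodule_axioms_def)
qed

lemma submodule_carrier: "submodule (carrier M) R M"
  by (rule submodule_intro) auto

lemma submodule_zero: "submodule {\<zero>\<^bsub>M\<^esub>} R M"
  by (rule submodule_intro) auto

lemma submodule_minus:
  assumes "submodule H R M" "x \<in> H" shows "\<ominus>\<^bsub>M\<^esub> x \<in> H"
  using subgroup.m_inv_closed[of H "add_monoid M" x] assms
  by (simp add: submodule_def a_inv_def)

lemma submodule_Inter:
  assumes "\<S> \<noteq> {}" "\<And>H. H \<in> \<S> \<Longrightarrow> submodule H R M"
  shows "submodule (\<Inter>\<S>) R M"
proof (rule submodule_intro)
  obtain H where "H \<in> \<S>" using assms by blast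
  then show "\<Inter>\<S> \<subseteq> carrier M"
    using assms(2)[of H] by (auto simp: submodule_def subgroup_def)
qed (use assms in \<open>auto simp: submodule_def submodule_axioms_def subgroup_def\<close>)

lemma submodule_Int:
  assumes "submodule H R M" "submodule K R M" shows "submodule (H \<inter> K) R M"
  using submodule_Inter[of "{H, K}"] assms by auto

lemma submodule_left_module:
  assumes "submodule H R M" shows "left_module R (M\<lparr>carrier := H\<rparr>)"
proof -
  interpret H: submodule H R M by fact
  have sub: "H \<subseteq> carrier M" using H.subset by simp
  show ?thesis
    by (rule left_moduleI)
       (use sub in \<open>auto simp: R.ring_axioms M.a_assoc smult_l_distr smult_r_distr smult_assoc1
          subset_iff intro: M.a_comm H.m_closed[simplified] H.one_closed[simplified]\<close>)
qed

lemma submodule_cyclic: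
  assumes "x \<in> carrier M"
  shows "submodule ((\<lambda>r. r \<odot>\<^bsub>M\<^esub> x) ` carrier R) R M"
proof (rule submodule_intro)
  fix u v assume "u \<in> (\<lambda>r. r \<odot>\<^bsub>M\<^esub> x) ` carrier R" "v \<in> (\<lambda>r. r \<odot>\<^bsub>M\<^esub> x) ` carrier R"
  then show "u \<oplus>\<^bsub>M\<^esub> v \<in> (\<lambda>r. r \<odot>\<^bsub>M\<^esub> x) ` carrier R"
    using assms by (auto simp: image_iff) (metis R.a_closed smult_l_distr)
next
  fix a u assume "a \<in> carrier R" "u \<in> (\<lambda>r. r \<odot>\<^bsub>M\<^esub> x) ` carrier R"
  then show "a \<odot>\<^bsub>M\<^esub> u \<in> (\<lambda>r. r \<odot>\<^bsub>M\<^esub> x) ` carrier R"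
    using assms by (auto simp: image_iff) (metis R.m_closed smult_assoc1)
qed (use assms in \<open>auto simp: image_iff intro!: bexI[of _ "\<zero>\<^bsub>R\<^esub>"]\<close>)

end

lemma submoduleD:
  assumes "submodule H R M"
  shows "H \<subseteq> carrier M" and "x \<in> H \<Longrightarrow> x \<in> carrier M" and "\<zero>\<^bsub>M\<^esub> \<in> H"
    and "x \<in> H \<Longrightarrow> y \<in> H \<Longrightarrow> x \<oplus>\<^bsub>M\<^esub> y \<in> H"
    and "a \<in> carrier R \<Longrightarrow> x \<in> H \<Longrightarrow> a \<odot>\<^bsub>M\<^esub> x \<in> H"
  using assms by (auto simp: submodule_def submodule_axioms_def subgroup_def)

lemma submodule_restrict_iff:
  assumes M: "left_module R M" and H: "submodule H R M"
  shows "submodule K R (M\<lparr>carrier := H\<rparr>) \<longleftrightarrow> submodule K R M \<and> K \<subseteq> H"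
proof -
  interpret M: left_module R M by fact
  interpret H: left_module R "M\<lparr>carrier := H\<rparr>" using M.submodule_left_module[OF H] .
  show ?thesis
  proof
    assume K: "submodule K R (M\<lparr>carrier := H\<rparr>)"
    then show "submodule K R M \<and> K \<subseteq> H"
      using submoduleD[OF K] submoduleD(1)[OF H] by (auto intro!: M.submodule_intro)
  next
    assume "submodule K R M \<and> K \<subseteq> H"
    then show "submodule K R (M\<lparr>carrier := H\<rparr>)"
      using submoduleD[of K R M] by (auto intro!: H.submodule_intro)
  qed
qed

lemma mhomD:
  assumes "f \<in> mhom R M N"
  shows "x \<in> carrier M \<Longrightarrow> f x \<in> carrier N"
    and "x \<in> carrier M \<Longrightarrow> y \<in> carrier M \<Longrightarrow> f (x \<oplus>\<^bsub>M\<^esub> y) = f x \<oplus>\<^bsub>N\<^esub> f y"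
    and "r \<in> carrier R \<Longrightarrow> x \<in> carrier M \<Longrightarrow> f (r \<odot>\<^bsub>M\<^esub> x) = r \<odot>\<^bsub>N\<^esub> f x"
    and "x \<notin> carrier M \<Longrightarrow> f x = undefined"
  using assms by (auto simp: mhom_def)

lemma mhom_restrictI:
  assumes "left_module R M"
    and "\<And>x. x \<in> carrier M \<Longrightarrow> f x \<in> carrier N"
    and "\<And>x y. x \<in> carrier M \<Longrightarrow> y \<in> carrier M \<Longrightarrow> f (x \<oplus>\<^bsub>M\<^esub> y) = f x \<oplus>\<^bsub>N\<^esub> f y"
    and "\<And>r x. r \<in> carrier R \<Longrightarrow> x \<in> carrier M \<Longrightarrow> f (r \<odot>\<^bsub>M\<^esub> x) = r \<odot>\<^bsub>N\<^esub> f x"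
  shows "restrict f (carrier M) \<in> mhom R M N"
proof -
  interpret left_module R M by fact
  show ?thesis using assms(2-) by (auto simp: mhom_def)
qed

lemma mhom_zero:
  assumes "left_module R M" "left_module R N" "f \<in> mhom R M N"
  shows "f \<zero>\<^bsub>M\<^esub> = \<zero>\<^bsub>N\<^esub>"
proof -
  interpret M: left_module R M by fact
  interpret N: left_module R N by fact
  have "f \<zero>\<^bsub>M\<^esub> = f (\<zero>\<^bsub>R\<^esub> \<odot>\<^bsub>M\<^esub> \<zero>\<^bsub>M\<^esub>)" by simp
  also have "\<dots> = \<zero>\<^bsub>R\<^esub> \<odot>\<^bsub>N\<^esub> f \<zero>\<^bsub>M\<^esub>"
    using mhomD(3)[OF assms(3)] M.R.zero_closed M.M.zero_closed by blast
  also have "\<dots> = \<zero>\<^bsub>N\<^esub>" using mhomD(1)[OF assms(3) M.M.zero_closed] by (rule N.zero_smult)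
  finally show ?thesis .
qed

lemma mhom_minus:
  assumes "left_module R M" "left_module R N" "f \<in> mhom R M N" "x \<in> carrier M"
  shows "f (\<ominus>\<^bsub>M\<^esub> x) = \<ominus>\<^bsub>N\<^esub> (f x)"
proof -
  interpret M: left_module R M by fact
  interpret N: left_module R N by fact
  show ?thesis using mhomD[OF assms(3)] assms(4) by (simp add: M.minus_eq_smult N.minus_eq_smult)
qed

lemma mhom_compose:
  assumes "left_module R A" "f \<in> mhom R A B" "g \<in> mhom R B C"
  shows "compose (carrier A) g f \<in> mhom R A C"
  using mhom_restrictI[OF assms(1), of "g \<circ> f" C] mhomD[OF assms(2)] mhomD[OF assms(3)]
  by (simp add: compose_def comp_def)

lemma mhom_inj_iff:
  assumes "left_module R M" "left_module R N" "f \<in> mhom R M N"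
  shows "inj_on f (carrier M) \<longleftrightarrow> (\<forall>x\<in>carrier M. f x = \<zero>\<^bsub>N\<^esub> \<longrightarrow> x = \<zero>\<^bsub>M\<^esub>)"
proof
  interpret M: left_module R M by fact
  interpret N: left_module R N by fact
  note f = mhomD[OF assms(3)] mhom_zero[OF assms]
  show "\<forall>x\<in>carrier M. f x = \<zero>\<^bsub>N\<^esub> \<longrightarrow> x = \<zero>\<^bsub>M\<^esub>" if "inj_on f (carrier M)"
    using that f(5) by (metis M.zero_closed inj_onD)
  show "inj_on f (carrier M)" if *: "\<forall>x\<in>carrier M. f x = \<zero>\<^bsub>N\<^esub> \<longrightarrow> x = \<zero>\<^bsub>M\<^esub>"
  proof (rule inj_onI)
    fix x y assume xy: "x \<in> carrier M" "y \<in> carrier M" "f x = f y"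
    then have "f (x \<oplus>\<^bsub>M\<^esub> \<ominus>\<^bsub>M\<^esub> y) = \<zero>\<^bsub>N\<^esub>" using f mhom_minus[OF assms] by (simp add: N.r_neg)
    then have "x \<oplus>\<^bsub>M\<^esub> \<ominus>\<^bsub>M\<^esub> y = \<zero>\<^bsub>M\<^esub>" using * xy by simp
    then show "x = y" using xy by (metis M.minus_equality M.minus_minus M.a_inv_closed)
  qed
qed

lemma submodule_image:
  assumes "left_module R M" "left_module R N" "f \<in> mhom R M N" "submodule H R M"
  shows "submodule (f ` H) R N"
proof -
  interpret N: left_module R N by fact
  note f = mhomD[OF assms(3)] mhom_zero[OF assms(1-3)]
  note H = submoduleD[OF assms(4)]
  show ?thesis
  proof (rule N.submodule_intro)
    show "f ` H \<subseteq> carrier N" using f H by auto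
    show "\<zero>\<^bsub>N\<^esub> \<in> f ` H" using f H by (metis imageI)
    show "u \<oplus>\<^bsub>N\<^esub> v \<in> f ` H" if "u \<in> f ` H" "v \<in> f ` H" for u v
      using that f(2) H(2,4) by (auto simp: image_iff) metis
    show "a \<odot>\<^bsub>N\<^esub> v \<in> f ` H" if "a \<in> carrier R" "v \<in> f ` H" for a v
      using that f(3) H(2,5) by (auto simp: image_iff) metis
  qed
qed

lemma submodule_vimage:
  assumes "left_module R M" "left_module R N" "f \<in> mhom R M N" "submodule H R N"
  shows "submodule {x \<in> carrier M. f x \<in> H} R M"
proof -
  interpret M: left_module R M by fact
  show ?thesis
    using mhomD[OF assms(3)] mhom_zero[OF assms(1-3)] submoduleD[OF assms(4)]
    by (intro M.submodule_intro) auto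
qed

text \<open>The constants of the statement take plain module records, whereas \<^locale>\<open>left_module\<close> also
  admits extended ones.\<close>

locale plain_module = left_module R M
  for R :: "('r, 'x) ring_scheme" (structure) and M :: "('r, 'm) module" (structure)

lemma plain_moduleI: "left_module R M \<Longrightarrow> plain_module R M"
  by (simp add: plain_module_def)

section \<open>Sums of submodules, and essentiality tested on elements\<close>

context plain_module
begin

lemma submodule_sum_upper: "H \<in> \<S> \<Longrightarrow> H \<subseteq> submodule_sum R M \<S>"
  by (auto simp: submodule_sum_def)

lemma submodule_sum_least:
  "submodule K R M \<Longrightarrow> (\<And>H. H \<in> \<S> \<Longrightarrow> H \<subseteq> K) \<Longrightarrow> submodule_sum R M \<S> \<subseteq> K"
  by (auto simp: submodule_sum_def)

lemma submodule_submodule_sum: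
  assumes "\<Union>\<S> \<subseteq> carrier M" shows "submodule (submodule_sum R M \<S>) R M"
  unfolding submodule_sum_def
  using assms submodule_carrier by (intro submodule_Inter) auto

lemma submodule_set_add:
  assumes "submodule H R M" "submodule K R M"
  shows "submodule {x \<oplus>\<^bsub>M\<^esub> y |x y. x \<in> H \<and> y \<in> K} R M"
proof (rule submodule_intro)
  note H = submoduleD[OF assms(1)] and K = submoduleD[OF assms(2)]
  show "{x \<oplus>\<^bsub>M\<^esub> y |x y. x \<in> H \<and> y \<in> K} \<subseteq> carrier M" using H K by auto
  show "\<zero>\<^bsub>M\<^esub> \<in> {x \<oplus>\<^bsub>M\<^esub> y |x y. x \<in> H \<and> y \<in> K}"
    using H K by (auto intro!: exI[of _ "\<zero>\<^bsub>M\<^esub>"])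
  fix u v assume "u \<in> {x \<oplus>\<^bsub>M\<^esub> y |x y. x \<in> H \<and> y \<in> K}" "v \<in> {x \<oplus>\<^bsub>M\<^esub> y |x y. x \<in> H \<and> y \<in> K}"
  then obtain x y x' y' where *: "u = x \<oplus>\<^bsub>M\<^esub> y" "v = x' \<oplus>\<^bsub>M\<^esub> y'" "x \<in> H" "x' \<in> H" "y \<in> K" "y' \<in> K"
    by auto
  then have "u \<oplus>\<^bsub>M\<^esub> v = (x \<oplus>\<^bsub>M\<^esub> x') \<oplus>\<^bsub>M\<^esub> (y \<oplus>\<^bsub>M\<^esub> y')"
    using H(2) K(2) by (simp add: M.a_ac)
  moreover have "x \<oplus>\<^bsub>M\<^esub> x' \<in> H" "y \<oplus>\<^bsub>M\<^esub> y' \<in> K" using * H(4) K(4) by auto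
  ultimately show "u \<oplus>\<^bsub>M\<^esub> v \<in> {x \<oplus>\<^bsub>M\<^esub> y |x y. x \<in> H \<and> y \<in> K}" by auto
next
  note H = submoduleD[OF assms(1)] and K = submoduleD[OF assms(2)]
  fix a u assume a: "a \<in> carrier R" and "u \<in> {x \<oplus>\<^bsub>M\<^esub> y |x y. x \<in> H \<and> y \<in> K}"
  then obtain x y where *: "u = x \<oplus>\<^bsub>M\<^esub> y" "x \<in> H" "y \<in> K" by auto
  have "a \<odot>\<^bsub>M\<^esub> u = a \<odot>\<^bsub>M\<^esub> x \<oplus>\<^bsub>M\<^esub> a \<odot>\<^bsub>M\<^esub> y" using * a H(2) K(2) by (simp add: smult_r_distr)
  moreover have "a \<odot>\<^bsub>M\<^esub> x \<in> H" "a \<odot>\<^bsub>M\<^esub> y \<in> K" using * a H(5) K(5) by auto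
  ultimately show "a \<odot>\<^bsub>M\<^esub> u \<in> {x \<oplus>\<^bsub>M\<^esub> y |x y. x \<in> H \<and> y \<in> K}" by auto
qed

text \<open>Cyclic submodules suffice as tests: a nonzero \<open>L\<close> contains a nonzero
  element, and the multiples of that element stay in \<open>L\<close>. In this form successive
  scalars can simply be multiplied.\<close>

lemma essential_iff:
  "essential R M N \<longleftrightarrow> submodule N R M \<and>
    (\<forall>x\<in>carrier M. x \<noteq> \<zero>\<^bsub>M\<^esub> \<longrightarrow> (\<exists>r\<in>carrier R. r \<odot>\<^bsub>M\<^esub> x \<in> N \<and> r \<odot>\<^bsub>M\<^esub> x \<noteq> \<zero>\<^bsub>M\<^esub>))"
proof safe
  show "submodule N R M" if "essential R M N" using that by (simp add: essential_def)
next
  fix x assume N: "essential R M N" and x: "x \<in> carrier M" "x \<noteq> \<zero>\<^bsub>M\<^esub>"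
  let ?L = "(\<lambda>r. r \<odot>\<^bsub>M\<^esub> x) ` carrier R"
  have L: "submodule ?L R M" using submodule_cyclic x by blast
  have "x \<in> ?L" using x by (metis R.one_closed imageI smult_one)
  then have "N \<inter> ?L \<noteq> {\<zero>\<^bsub>M\<^esub>}" using N L x unfolding essential_def by blast
  moreover have "\<zero>\<^bsub>M\<^esub> \<in> N \<inter> ?L"
    using N submoduleD(3)[OF L] submoduleD(3)[of N R M] by (simp add: essential_def)
  ultimately show "\<exists>r\<in>carrier R. r \<odot>\<^bsub>M\<^esub> x \<in> N \<and> r \<odot>\<^bsub>M\<^esub> x \<noteq> \<zero>\<^bsub>M\<^esub>" by blast
next
  assume N: "submodule N R M"
    and *: "\<forall>x\<in>carrier M. x \<noteq> \<zero>\<^bsub>M\<^esub> \<longrightarrow> (\<exists>r\<in>carrier R. r \<odot>\<^bsub>M\<^esub> x \<in> N \<and> r \<odot>\<^bsub>M\<^esub> x \<noteq> \<zero>\<^bsub>M\<^esub>)"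
  have "L = {\<zero>\<^bsub>M\<^esub>}" if L: "submodule L R M" "N \<inter> L = {\<zero>\<^bsub>M\<^esub>}" for L
  proof (rule ccontr)
    assume "L \<noteq> {\<zero>\<^bsub>M\<^esub>}"
    then obtain x where "x \<in> L" "x \<noteq> \<zero>\<^bsub>M\<^esub>" using submoduleD(3)[OF L(1)] by blast
    then show False using * L submoduleD[OF L(1)] by blast
  qed
  then show "essential R M N" using N by (simp add: essential_def)
qed

end

section \<open>Direct sums and quotients\<close>

lemma direct_sum_simps [simp]:
  "\<zero>\<^bsub>direct_sum I A\<^esub> = (\<lambda>i\<in>I. \<zero>\<^bsub>A i\<^esub>)"
  "x \<oplus>\<^bsub>direct_sum I A\<^esub> y = (\<lambda>i\<in>I. x i \<oplus>\<^bsub>A i\<^esub> y i)"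
  "r \<odot>\<^bsub>direct_sum I A\<^esub> x = (\<lambda>i\<in>I. r \<odot>\<^bsub>A i\<^esub> x i)"
  by (simp_all add: direct_sum_def)

lemma direct_sum_carrier_iff:
  "x \<in> carrier (direct_sum I A) \<longleftrightarrow>
    x \<in> (\<Pi>\<^sub>E i\<in>I. carrier (A i)) \<and> finite {i \<in> I. x i \<noteq> \<zero>\<^bsub>A i\<^esub>}"
  by (simp add: direct_sum_def)

lemma direct_sum_eqI:
  assumes "x \<in> carrier (direct_sum I A)" "y \<in> carrier (direct_sum I B)" "\<And>i. i \<in> I \<Longrightarrow> x i = y i"
  shows "x = y"
  using assms by (auto simp: direct_sum_carrier_iff PiE_def extensional_def) (metis ext)

lemma direct_sum_left_module:
  assumes "ring R" "\<And>i. i \<in> I \<Longrightarrow> left_module R (A i)"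
  shows "left_module R (direct_sum I A)"
proof -
  have mod: "left_module R (A i)" if "i \<in> I" for i using assms that by blast
  have ab: "abelian_group (A i)" if "i \<in> I" for i using mod[OF that] by (simp add: left_module_def)
  have mon: "abelian_monoid (A i)" if "i \<in> I" for i
    using ab[OF that] by (simp add: abelian_group_def)
  show ?thesis
  proof (rule left_moduleI)
    fix x y assume xy: "x \<in> carrier (direct_sum I A)" "y \<in> carrier (direct_sum I A)"
    have "finite {i \<in> I. x i \<oplus>\<^bsub>A i\<^esub> y i \<noteq> \<zero>\<^bsub>A i\<^esub>}"
      by (rule finite_subset[of _ "{i \<in> I. x i \<noteq> \<zero>\<^bsub>A i\<^esub>} \<union> {i \<in> I. y i \<noteq> \<zero>\<^bsub>A i\<^esub>}"])
         (use xy mon in \<open>auto simp: direct_sum_carrier_iff abelian_monoid.l_zero abelian_monoid.zero_closed\<close>)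
    moreover have "(\<lambda>i\<in>I. x i \<oplus>\<^bsub>A i\<^esub> y i) \<in> (\<Pi>\<^sub>E i\<in>I. carrier (A i))"
      using xy mon by (auto simp: direct_sum_carrier_iff PiE_def Pi_def abelian_monoid.a_closed)
    ultimately show "x \<oplus>\<^bsub>direct_sum I A\<^esub> y \<in> carrier (direct_sum I A)"
      by (simp add: direct_sum_carrier_iff cong: conj_cong)
  next
    fix a x assume ax: "a \<in> carrier R" "x \<in> carrier (direct_sum I A)"
    have "finite {i \<in> I. a \<odot>\<^bsub>A i\<^esub> x i \<noteq> \<zero>\<^bsub>A i\<^esub>}"
      by (rule finite_subset[of _ "{i \<in> I. x i \<noteq> \<zero>\<^bsub>A i\<^esub>}"])
         (use ax left_module.smult_zero[OF mod] in \<open>auto simp: direct_sum_carrier_iff\<close>)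
    moreover have "(\<lambda>i\<in>I. a \<odot>\<^bsub>A i\<^esub> x i) \<in> (\<Pi>\<^sub>E i\<in>I. carrier (A i))"
      using ax left_module.smult_closed[OF mod] by (auto simp: direct_sum_carrier_iff PiE_def Pi_def)
    ultimately show "a \<odot>\<^bsub>direct_sum I A\<^esub> x \<in> carrier (direct_sum I A)"
      by (simp add: direct_sum_carrier_iff cong: conj_cong)
  next
    show "\<zero>\<^bsub>direct_sum I A\<^esub> \<in> carrier (direct_sum I A)"
      using mon by (auto simp: direct_sum_carrier_iff abelian_monoid.zero_closed)
  next
    fix a b x assume "a \<in> carrier R" "b \<in> carrier R" "x \<in> carrier (direct_sum I A)"
    then show "(a \<oplus>\<^bsub>R\<^esub> b) \<odot>\<^bsub>direct_sum I A\<^esub> x = a \<odot>\<^bsub>direct_sum I A\<^esub> x \<oplus>\<^bsub>direct_sum I A\<^esub> b \<odot>\<^bsub>direct_sum I A\<^esub> x"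
      "(a \<otimes>\<^bsub>R\<^esub> b) \<odot>\<^bsub>direct_sum I A\<^esub> x = a \<odot>\<^bsub>direct_sum I A\<^esub> (b \<odot>\<^bsub>direct_sum I A\<^esub> x)"
      using left_module.smult_l_distr[OF mod] left_module.smult_assoc1[OF mod]
      by (auto simp: direct_sum_carrier_iff PiE_def Pi_def fun_eq_iff)
  next
    fix a x y assume "a \<in> carrier R" "x \<in> carrier (direct_sum I A)" "y \<in> carrier (direct_sum I A)"
    then show "a \<odot>\<^bsub>direct_sum I A\<^esub> (x \<oplus>\<^bsub>direct_sum I A\<^esub> y) = a \<odot>\<^bsub>direct_sum I A\<^esub> x \<oplus>\<^bsub>direct_sum I A\<^esub> a \<odot>\<^bsub>direct_sum I A\<^esub> y"
      using left_module.smult_r_distr[OF mod]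
      by (auto simp: direct_sum_carrier_iff PiE_def Pi_def fun_eq_iff)
  next
    fix x assume "x \<in> carrier (direct_sum I A)"
    then have *: "\<And>i. i \<in> I \<Longrightarrow> x i \<in> carrier (A i)" "\<And>i. i \<notin> I \<Longrightarrow> x i = undefined"
      by (auto simp: direct_sum_carrier_iff PiE_def Pi_def extensional_def)
    show "\<one>\<^bsub>R\<^esub> \<odot>\<^bsub>direct_sum I A\<^esub> x = x"
      "\<zero>\<^bsub>direct_sum I A\<^esub> \<oplus>\<^bsub>direct_sum I A\<^esub> x = x"
      "\<zero>\<^bsub>R\<^esub> \<odot>\<^bsub>direct_sum I A\<^esub> x = \<zero>\<^bsub>direct_sum I A\<^esub>"
      using * left_module.smult_one[OF mod] left_module.zero_smult[OF mod] mon
      by (auto simp: fun_eq_iff abelian_monoid.l_zero)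
  qed (use assms mon in \<open>auto simp: direct_sum_carrier_iff PiE_def Pi_def fun_eq_iff
      abelian_monoid.a_assoc abelian_monoid.a_comm\<close>)
qed

definition ds_single :: "'i set \<Rightarrow> ('i \<Rightarrow> ('r, 'a) module) \<Rightarrow> 'i \<Rightarrow> 'a \<Rightarrow> 'i \<Rightarrow> 'a"
  where "ds_single I A i x = (\<lambda>k\<in>I. if k = i then x else \<zero>\<^bsub>A k\<^esub>)"

lemma ds_single_mhom:
  assumes "\<And>k. k \<in> I \<Longrightarrow> left_module R (A k)" "i \<in> I"
  shows "restrict (ds_single I A i) (carrier (A i)) \<in> mhom R (A i) (direct_sum I A)"
proof (rule mhom_restrictI)
  have mon: "abelian_monoid (A k)" if "k \<in> I" for k
    using assms(1)[OF that] by (simp add: left_module_def abelian_group_def)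
  show "ds_single I A i x \<in> carrier (direct_sum I A)" if "x \<in> carrier (A i)" for x
  proof -
    have "finite {k \<in> I. ds_single I A i x k \<noteq> \<zero>\<^bsub>A k\<^esub>}"
      by (rule finite_subset[of _ "{i}"]) (auto simp: ds_single_def split: if_splits)
    then show ?thesis using that mon
      by (auto simp: ds_single_def direct_sum_carrier_iff abelian_monoid.zero_closed)
  qed
  show "ds_single I A i (x \<oplus>\<^bsub>A i\<^esub> y) = ds_single I A i x \<oplus>\<^bsub>direct_sum I A\<^esub> ds_single I A i y"
    if "x \<in> carrier (A i)" "y \<in> carrier (A i)" for x y
    using mon by (auto simp: ds_single_def fun_eq_iff abelian_monoid.l_zero abelian_monoid.zero_closed)
  show "ds_single I A i (r \<odot>\<^bsub>A i\<^esub> x) = r \<odot>\<^bsub>direct_sum I A\<^esub> ds_single I A i x"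
    if "r \<in> carrier R" "x \<in> carrier (A i)" for r x
    using that left_module.smult_zero[OF assms(1)] by (auto simp: ds_single_def fun_eq_iff)
qed (use assms in auto)

text \<open>Finite supports permit an induction: an element equals its truncation \<open>tr\<close>
  to its support, and truncations grow by one coordinate at a time.\<close>

lemma direct_sum_generated:
  assumes "ring R" and mod: "\<And>k. k \<in> I \<Longrightarrow> left_module R (A k)"
    and S: "submodule S R (direct_sum I A)"
    and gen: "\<And>k x. k \<in> I \<Longrightarrow> x \<in> carrier (A k) \<Longrightarrow> ds_single I A k x \<in> S"
  shows "carrier (direct_sum I A) \<subseteq> S"
proof
  have mon: "abelian_monoid (A k)" if "k \<in> I" for k
    using mod[OF that] by (simp add: left_module_def abelian_group_def)
  fix y assume y: "y \<in> carrier (direct_sum I A)"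
  define tr where "tr F = (\<lambda>k\<in>I. if k \<in> F then y k else \<zero>\<^bsub>A k\<^esub>)" for F
  have yk: "y k \<in> carrier (A k)" if "k \<in> I" for k using y that by (auto simp: direct_sum_carrier_iff)
  have "tr F \<in> S" if "finite F" "F \<subseteq> I" for F
    using that
  proof (induction F)
    case empty
    have "tr {} = \<zero>\<^bsub>direct_sum I A\<^esub>" by (simp add: tr_def)
    then show ?case using submoduleD(3)[OF S] by (simp only:)
  next
    case (insert k F)
    then have "tr (insert k F) = ds_single I A k (y k) \<oplus>\<^bsub>direct_sum I A\<^esub> tr F"
      using mon yk by (auto simp: tr_def ds_single_def fun_eq_iff abelian_monoid.l_zero
          abelian_monoid.r_zero abelian_monoid.zero_closed)
    then show ?case using insert gen yk submoduleD(4)[OF S] by (metis insert_subset)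
  qed
  moreover have "tr {k \<in> I. y k \<noteq> \<zero>\<^bsub>A k\<^esub>} = y"
    using y by (auto simp: tr_def fun_eq_iff direct_sum_carrier_iff PiE_def extensional_def)
  moreover have "finite {k \<in> I. y k \<noteq> \<zero>\<^bsub>A k\<^esub>}" using y by (simp add: direct_sum_carrier_iff)
  ultimately show "y \<in> S" by (metis (no_types, lifting) mem_Collect_eq subsetI)
qed

lemma quot_module_simps [simp]:
  "carrier (quot_module M N) = a_rcosets\<^bsub>M\<^esub> N"
  "\<zero>\<^bsub>quot_module M N\<^esub> = N"
  "X \<oplus>\<^bsub>quot_module M N\<^esub> Y = X <+>\<^bsub>M\<^esub> Y"
  by (simp_all add: quot_module_def)

section \<open>Quotient modules via representatives of cosets\<close>

context plain_module
begin

lemma submodule_abelian_subgroup: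
  assumes "submodule N R M" shows "abelian_subgroup N M"
  using assms M.abelian_group_axioms
  by (intro abelian_subgroupI3 additive_subgroupI) (auto simp: submodule_def)

lemma quot_carrier:
  assumes "submodule N R M"
  shows "X \<in> carrier (quot_module M N) \<longleftrightarrow> (\<exists>x\<in>carrier M. X = N +>\<^bsub>M\<^esub> x)"
  by (auto simp: A_RCOSETS_def')

lemma coset_eq_iff:
  assumes N: "submodule N R M" and "x \<in> carrier M" "y \<in> carrier M"
  shows "N +>\<^bsub>M\<^esub> x = N +>\<^bsub>M\<^esub> y \<longleftrightarrow> x \<oplus>\<^bsub>M\<^esub> \<ominus>\<^bsub>M\<^esub> y \<in> N"
proof -
  interpret N: abelian_subgroup N M using submodule_abelian_subgroup[OF N] .
  have "N +>\<^bsub>M\<^esub> x = N +>\<^bsub>M\<^esub> y \<longleftrightarrow> x \<in> N +>\<^bsub>M\<^esub> y"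
    using N.a_repr_independence'[of x y] N.a_rcos_self[of x] assms by (metis)
  also have "\<dots> \<longleftrightarrow> x \<oplus>\<^bsub>M\<^esub> \<ominus>\<^bsub>M\<^esub> y \<in> N" using N.a_rcos_module[of y x] assms by auto
  finally show ?thesis .
qed

lemma coset_eq_zero_iff:
  assumes N: "submodule N R M" and "x \<in> carrier M"
  shows "N +>\<^bsub>M\<^esub> x = N \<longleftrightarrow> x \<in> N"
proof -
  have "N +>\<^bsub>M\<^esub> \<zero>\<^bsub>M\<^esub> = N" using submoduleD(1)[OF N] by (rule M.a_coset_add_zero)
  moreover have "x \<oplus>\<^bsub>M\<^esub> \<ominus>\<^bsub>M\<^esub> \<zero>\<^bsub>M\<^esub> = x"
    using assms(2) by (metis M.a_inv_closed M.l_zero M.r_neg M.r_zero M.zero_closed)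
  ultimately show ?thesis using coset_eq_iff[OF N assms(2) M.zero_closed] by metis
qed

lemma coset_add:
  assumes N: "submodule N R M" and "x \<in> carrier M" "y \<in> carrier M"
  shows "(N +>\<^bsub>M\<^esub> x) \<oplus>\<^bsub>quot_module M N\<^esub> (N +>\<^bsub>M\<^esub> y) = N +>\<^bsub>M\<^esub> (x \<oplus>\<^bsub>M\<^esub> y)"
  using abelian_subgroup.a_rcos_sum[OF submodule_abelian_subgroup[OF N]] assms by simp

text \<open>\<open>quot_module\<close> takes the union over all representatives in order to avoid a
  choice. The cosets in this union coincide because \<open>N\<close> is closed under scalars, so the
  union collapses to one of them.\<close>

lemma coset_smult:
  assumes N: "submodule N R M" and "x \<in> carrier M" "r \<in> carrier R"
  shows "r \<odot>\<^bsub>quot_module M N\<^esub> (N +>\<^bsub>M\<^esub> x) = N +>\<^bsub>M\<^esub> (r \<odot>\<^bsub>M\<^esub> x)"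
proof -
  interpret N: abelian_subgroup N M using submodule_abelian_subgroup[OF N] .
  have "N +>\<^bsub>M\<^esub> (r \<odot>\<^bsub>M\<^esub> y) = N +>\<^bsub>M\<^esub> (r \<odot>\<^bsub>M\<^esub> x)" if y: "y \<in> N +>\<^bsub>M\<^esub> x" for y
  proof -
    have yM: "y \<in> carrier M" using y assms N.a_elemrcos_carrier by blast
    have "y \<oplus>\<^bsub>M\<^esub> \<ominus>\<^bsub>M\<^esub> x \<in> N" using y N.a_rcos_module[of x y] assms yM by auto
    then have "r \<odot>\<^bsub>M\<^esub> (y \<oplus>\<^bsub>M\<^esub> \<ominus>\<^bsub>M\<^esub> x) \<in> N" using submoduleD(5)[OF N] assms by blast
    then show ?thesis
      using assms yM by (simp add: coset_eq_iff[OF N] smult_r_distr smult_commute_minus)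
  qed
  then have "(\<Union>y\<in>N +>\<^bsub>M\<^esub> x. N +>\<^bsub>M\<^esub> (r \<odot>\<^bsub>M\<^esub> y)) = (\<Union>y\<in>N +>\<^bsub>M\<^esub> x. N +>\<^bsub>M\<^esub> (r \<odot>\<^bsub>M\<^esub> x))"
    by (rule SUP_cong[OF refl])
  also have "\<dots> = N +>\<^bsub>M\<^esub> (r \<odot>\<^bsub>M\<^esub> x)" using assms N.a_rcos_self[of x] by (intro UN_constant_eq) auto
  finally show ?thesis by (simp add: quot_module_def)
qed

lemma quot_left_module:
  assumes N: "submodule N R M" shows "left_module R (quot_module M N)"
proof -
  have N0: "N = N +>\<^bsub>M\<^esub> \<zero>\<^bsub>M\<^esub>" using coset_eq_zero_iff[OF N, of "\<zero>\<^bsub>M\<^esub>"] submoduleD(3)[OF N] by simp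
  note defs = quot_carrier[OF N] coset_add[OF N] coset_smult[OF N]
  show ?thesis
  proof (rule left_moduleI)
    show "\<zero>\<^bsub>quot_module M N\<^esub> \<in> carrier (quot_module M N)"
      unfolding quot_carrier[OF N] using N0 by (auto intro!: bexI[of _ "\<zero>\<^bsub>M\<^esub>"])
    show "\<zero>\<^bsub>quot_module M N\<^esub> \<oplus>\<^bsub>quot_module M N\<^esub> X = X" if "X \<in> carrier (quot_module M N)" for X
      using that coset_add[OF N M.zero_closed] N0 unfolding quot_carrier[OF N]
      by (auto simp del: quot_module_simps(3))
    show "\<zero>\<^bsub>R\<^esub> \<odot>\<^bsub>quot_module M N\<^esub> X = \<zero>\<^bsub>quot_module M N\<^esub>" if "X \<in> carrier (quot_module M N)" for X
    proof -
      from that obtain x where x: "x \<in> carrier M" "X = N +>\<^bsub>M\<^esub> x" unfolding quot_carrier[OF N] by blast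
      have "\<zero>\<^bsub>R\<^esub> \<odot>\<^bsub>quot_module M N\<^esub> X = N +>\<^bsub>M\<^esub> \<zero>\<^bsub>M\<^esub>"
        using coset_smult[OF N x(1) R.zero_closed] x by simp
      then show ?thesis using N0 by simp
    qed
  qed (unfold quot_carrier[OF N], auto simp: coset_add[OF N] coset_smult[OF N] R.ring_axioms M.a_ac
      smult_l_distr smult_r_distr smult_assoc1
      simp del: quot_module_simps)
qed

lemma quot_map_mhom:
  assumes N: "submodule N R M"
  shows "(\<lambda>x\<in>carrier M. N +>\<^bsub>M\<^esub> x) \<in> mhom R M (quot_module M N)"
  by (rule mhom_restrictI[OF left_module_axioms])
     (auto simp: quot_carrier[OF N] coset_add[OF N] coset_smult[OF N] simp del: quot_module_simps)

end

section \<open>Relative injectivity\<close>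

text \<open>The partial map \<open>f\<close> may be any HOL function that is linear on
  \<open>N\<close>; its extensional restriction is formed inside. Inverses and composites can thus
  be extended directly.\<close>

lemma rel_injectiveE:
  assumes "rel_injective R X E" "left_module R X" "submodule N R X"
    and "\<And>x. x \<in> N \<Longrightarrow> f x \<in> carrier E"
    and "\<And>x y. x \<in> N \<Longrightarrow> y \<in> N \<Longrightarrow> f (x \<oplus>\<^bsub>X\<^esub> y) = f x \<oplus>\<^bsub>E\<^esub> f y"
    and "\<And>r x. r \<in> carrier R \<Longrightarrow> x \<in> N \<Longrightarrow> f (r \<odot>\<^bsub>X\<^esub> x) = r \<odot>\<^bsub>E\<^esub> f x"
  obtains g where "g \<in> mhom R X E" "\<And>x. x \<in> N \<Longrightarrow> g x = f x"
proof -
  have "left_module R (X\<lparr>carrier := N\<rparr>)"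
    using assms(2,3) by (rule left_module.submodule_left_module)
  then have "restrict f (carrier (X\<lparr>carrier := N\<rparr>)) \<in> mhom R (X\<lparr>carrier := N\<rparr>) E"
    using assms(4-) by (intro mhom_restrictI) auto
  then have "\<exists>g\<in>mhom R X E. \<forall>x\<in>N. g x = restrict f (carrier (X\<lparr>carrier := N\<rparr>)) x"
    using assms(1,3) unfolding rel_injective_def by blast
  then show ?thesis using that by auto
qed

lemma rel_injectiveI:
  assumes "\<And>N f. submodule N R X \<Longrightarrow> f \<in> mhom R (X\<lparr>carrier := N\<rparr>) E \<Longrightarrow>
    (\<And>x. x \<in> N \<Longrightarrow> f x \<in> carrier E) \<Longrightarrow>
    (\<And>x y. x \<in> N \<Longrightarrow> y \<in> N \<Longrightarrow> f (x \<oplus>\<^bsub>X\<^esub> y) = f x \<oplus>\<^bsub>E\<^esub> f y) \<Longrightarrow>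
    (\<And>r x. r \<in> carrier R \<Longrightarrow> x \<in> N \<Longrightarrow> f (r \<odot>\<^bsub>X\<^esub> x) = r \<odot>\<^bsub>E\<^esub> f x) \<Longrightarrow>
    \<exists>g\<in>mhom R X E. \<forall>x\<in>N. g x = f x"
  shows "rel_injective R X E"
  unfolding rel_injective_def
proof (intro allI impI, elim conjE)
  fix N f assume N: "submodule N R X" and f: "f \<in> mhom R (X\<lparr>carrier := N\<rparr>) E"
  show "\<exists>g\<in>mhom R X E. \<forall>x\<in>N. g x = f x"
    using mhomD[OF f] by (intro assms[OF N f]) simp_all
qed

text \<open>Inverting an embedding on its image turns maps defined on \<open>H\<close> into linear
  maps defined on a part of \<open>B\<close>, where relative injectivity or essentiality can
  act.\<close>

lemma inv_into_mhom:
  assumes "left_module R A" "f \<in> mhom R A B" "submodule H R A" "inj_on f H"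
  shows "z \<in> f ` H \<Longrightarrow> inv_into H f z \<in> carrier A"
    and "z \<in> f ` H \<Longrightarrow> w \<in> f ` H \<Longrightarrow> inv_into H f (z \<oplus>\<^bsub>B\<^esub> w) = inv_into H f z \<oplus>\<^bsub>A\<^esub> inv_into H f w"
    and "r \<in> carrier R \<Longrightarrow> z \<in> f ` H \<Longrightarrow> inv_into H f (r \<odot>\<^bsub>B\<^esub> z) = r \<odot>\<^bsub>A\<^esub> inv_into H f z"
proof -
  note f = mhomD[OF assms(2)] and H = submoduleD[OF assms(3)]
  show "inv_into H f z \<in> carrier A" if "z \<in> f ` H" using that H(2) by (metis inv_into_into)
  show "inv_into H f (z \<oplus>\<^bsub>B\<^esub> w) = inv_into H f z \<oplus>\<^bsub>A\<^esub> inv_into H f w" if zw: "z \<in> f ` H" "w \<in> f ` H"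
  proof -
    obtain x y where xy: "x \<in> H" "y \<in> H" "z = f x" "w = f y" using zw by blast
    then have "z \<oplus>\<^bsub>B\<^esub> w = f (x \<oplus>\<^bsub>A\<^esub> y)" "x \<oplus>\<^bsub>A\<^esub> y \<in> H" using f H by auto
    then show ?thesis using xy assms(4) by (simp add: inv_into_f_f)
  qed
  show "inv_into H f (r \<odot>\<^bsub>B\<^esub> z) = r \<odot>\<^bsub>A\<^esub> inv_into H f z" if rz: "r \<in> carrier R" "z \<in> f ` H"
  proof -
    obtain x where xy: "x \<in> H" "z = f x" using rz(2) by blast
    then have "r \<odot>\<^bsub>B\<^esub> z = f (r \<odot>\<^bsub>A\<^esub> x)" "r \<odot>\<^bsub>A\<^esub> x \<in> H" using f H rz(1) by auto
    then show ?thesis using xy assms(4) by (simp add: inv_into_f_f)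
  qed
qed

text \<open>Zorn's lemma for the graphs of the partial extensions: a maximal one is defined on
  the image of each \<^term>\<open>X k\<close>, hence everywhere.\<close>

lemma rel_injective_generated:
  fixes X :: "'i \<Rightarrow> ('r, 'a) module" and B :: "('r, 'b) module" and G :: "('r, 'g) module"
  assumes B: "left_module R B" and G: "left_module R G"
    and X: "\<And>k. k \<in> I \<Longrightarrow> left_module R (X k)"
    and inj: "\<And>k. k \<in> I \<Longrightarrow> rel_injective R (X k) G"
    and \<iota>: "\<And>k. k \<in> I \<Longrightarrow> \<iota> k \<in> mhom R (X k) B"
    and gen: "\<And>S. submodule S R B \<Longrightarrow> (\<And>k. k \<in> I \<Longrightarrow> \<iota> k ` carrier (X k) \<subseteq> S) \<Longrightarrow> carrier B \<subseteq> S"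
  shows "rel_injective R B G"
proof (rule rel_injectiveI)
  interpret B: plain_module R B using B by (rule plain_moduleI)
  interpret G: plain_module R G using G by (rule plain_moduleI)
  fix N f assume N: "submodule N R B"
    and f: "\<And>x. x \<in> N \<Longrightarrow> f x \<in> carrier G"
      "\<And>x y. x \<in> N \<Longrightarrow> y \<in> N \<Longrightarrow> f (x \<oplus>\<^bsub>B\<^esub> y) = f x \<oplus>\<^bsub>G\<^esub> f y"
      "\<And>r x. r \<in> carrier R \<Longrightarrow> x \<in> N \<Longrightarrow> f (r \<odot>\<^bsub>B\<^esub> x) = r \<odot>\<^bsub>G\<^esub> f x"
  \<comment> \<open>Graphs are kept as linear relations, so unions of chains need no gluing.
    Single-valuedness is demanded only at zero; subtraction gives it everywhere, which is
    \<open>single\<close> below.\<close>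
  define good where "good H \<longleftrightarrow> H \<subseteq> carrier B \<times> carrier G \<and>
    (\<forall>x y x' y'. (x, y) \<in> H \<longrightarrow> (x', y') \<in> H \<longrightarrow> (x \<oplus>\<^bsub>B\<^esub> x', y \<oplus>\<^bsub>G\<^esub> y') \<in> H) \<and>
    (\<forall>r x y. r \<in> carrier R \<longrightarrow> (x, y) \<in> H \<longrightarrow> (r \<odot>\<^bsub>B\<^esub> x, r \<odot>\<^bsub>G\<^esub> y) \<in> H) \<and>
    (\<forall>y. (\<zero>\<^bsub>B\<^esub>, y) \<in> H \<longrightarrow> y = \<zero>\<^bsub>G\<^esub>)" for H
  define H0 where "H0 = (\<lambda>x. (x, f x)) ` N"
  have f0: "f \<zero>\<^bsub>B\<^esub> = \<zero>\<^bsub>G\<^esub>"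
    using f(3)[of "\<zero>\<^bsub>R\<^esub>" "\<zero>\<^bsub>B\<^esub>"] submoduleD(3)[OF N] f(1) by simp
  have "good H0"
    unfolding good_def H0_def using f f0 submoduleD[OF N] by auto
  moreover have "\<Union>\<C> \<in> {H. good H \<and> H0 \<subseteq> H}"
    if "\<C> \<noteq> {}" and ch: "subset.chain {H. good H \<and> H0 \<subseteq> H} \<C>" for \<C>
  proof -
    have gd: "good H" "H0 \<subseteq> H" if "H \<in> \<C>" for H using that ch by (auto simp: subset_chain_def)
    have "good (\<Union>\<C>)"
      unfolding good_def
    proof (intro conjI allI impI)
      fix x y x' y' assume "(x, y) \<in> \<Union>\<C>" "(x', y') \<in> \<Union>\<C>"
      then obtain H H' where "H \<in> \<C>" "H' \<in> \<C>" "(x, y) \<in> H" "(x', y') \<in> H'" by blast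
      then obtain K where "K \<in> \<C>" "(x, y) \<in> K" "(x', y') \<in> K"
        using ch unfolding subset_chain_def by blast
      then show "(x \<oplus>\<^bsub>B\<^esub> x', y \<oplus>\<^bsub>G\<^esub> y') \<in> \<Union>\<C>" using gd(1) unfolding good_def by blast
    qed (use gd(1) in \<open>unfold good_def, blast+\<close>)
    then show ?thesis using gd(2) \<open>\<C> \<noteq> {}\<close> by auto
  qed
  ultimately have "\<exists>H\<in>{H. good H \<and> H0 \<subseteq> H}. \<forall>K\<in>{H. good H \<and> H0 \<subseteq> H}. H \<subseteq> K \<longrightarrow> K = H"
    by (intro subset_Zorn_nonempty) auto
  then obtain H where "good H" and H0: "H0 \<subseteq> H" and max: "\<And>K. good K \<Longrightarrow> H \<subseteq> K \<Longrightarrow> K = H"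
    by auto
  then have H: "\<And>x y. (x, y) \<in> H \<Longrightarrow> x \<in> carrier B \<and> y \<in> carrier G"
    "\<And>x y x' y'. (x, y) \<in> H \<Longrightarrow> (x', y') \<in> H \<Longrightarrow> (x \<oplus>\<^bsub>B\<^esub> x', y \<oplus>\<^bsub>G\<^esub> y') \<in> H"
    "\<And>r x y. r \<in> carrier R \<Longrightarrow> (x, y) \<in> H \<Longrightarrow> (r \<odot>\<^bsub>B\<^esub> x, r \<odot>\<^bsub>G\<^esub> y) \<in> H"
    "\<And>y. (\<zero>\<^bsub>B\<^esub>, y) \<in> H \<Longrightarrow> y = \<zero>\<^bsub>G\<^esub>"
    unfolding good_def by blast+
  have zero: "(\<zero>\<^bsub>B\<^esub>, \<zero>\<^bsub>G\<^esub>) \<in> H"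
    using H0 submoduleD(3)[OF N] f0 unfolding H0_def by (metis imageI subsetD)
  have neg: "(\<ominus>\<^bsub>B\<^esub> x, \<ominus>\<^bsub>G\<^esub> y) \<in> H" if "(x, y) \<in> H" for x y
    using H(1)[OF that] H(3)[OF _ that] by (simp add: B.minus_eq_smult G.minus_eq_smult)
  have single: "y = y'" if "(x, y) \<in> H" "(x, y') \<in> H" for x y y'
  proof -
    have "(x \<oplus>\<^bsub>B\<^esub> \<ominus>\<^bsub>B\<^esub> x, y \<oplus>\<^bsub>G\<^esub> \<ominus>\<^bsub>G\<^esub> y') \<in> H" using H(2) neg that by blast
    then have "y \<oplus>\<^bsub>G\<^esub> \<ominus>\<^bsub>G\<^esub> y' = \<zero>\<^bsub>G\<^esub>" using H(1)[OF that(1)] H(4) by (simp add: B.r_neg)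
    then show ?thesis using H(1) that by (metis G.minus_equality G.minus_minus G.a_inv_closed)
  qed
  define D where "D = fst ` H"
  have D: "x \<in> D \<longleftrightarrow> (\<exists>y. (x, y) \<in> H)" for x by (force simp: D_def)
  define \<phi> where "\<phi> x = (THE y. (x, y) \<in> H)" for x
  have \<phi>_eq: "\<phi> x = y" if "(x, y) \<in> H" for x y
    unfolding \<phi>_def using that single by blast
  have \<phi>: "(x, \<phi> x) \<in> H" if "x \<in> D" for x using that \<phi>_eq D by auto
  have D_sub: "submodule D R B"
  proof (rule B.submodule_intro)
    show "D \<subseteq> carrier B" using H(1) D by blast
    show "\<zero>\<^bsub>B\<^esub> \<in> D" using zero D by blast
    show "x \<oplus>\<^bsub>B\<^esub> y \<in> D" if "x \<in> D" "y \<in> D" for x y using that H(2) unfolding D by blast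
    show "r \<odot>\<^bsub>B\<^esub> x \<in> D" if "r \<in> carrier R" "x \<in> D" for r x using that H(3) unfolding D by blast
  qed
  have \<phi>_add: "\<phi> (x \<oplus>\<^bsub>B\<^esub> y) = \<phi> x \<oplus>\<^bsub>G\<^esub> \<phi> y" if "x \<in> D" "y \<in> D" for x y
    using that by (intro \<phi>_eq H(2) \<phi>)
  have \<phi>_smult: "\<phi> (r \<odot>\<^bsub>B\<^esub> x) = r \<odot>\<^bsub>G\<^esub> \<phi> x" if "r \<in> carrier R" "x \<in> D" for x r
    using that by (intro \<phi>_eq H(3) \<phi>)
  have "\<iota> k ` carrier (X k) \<subseteq> D" if k: "k \<in> I" for k
  proof -
    interpret X: plain_module R "X k" using X[OF k] by (rule plain_moduleI)
    note \<iota>k = mhomD[OF \<iota>[OF k]] and Xk = X.left_module_axioms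
    \<comment> \<open>\<open>pull\<close> is the part of \<open>X k\<close> on which the extension
      is already decided. Since \<open>G\<close> is injective relative to \<open>X k\<close>, the
      prescribed values extend to \<open>u\<close> on all of \<open>X k\<close>, and
      \<open>H'\<close> adds the pairs of \<open>\<iota> k a\<close> and \<open>u a\<close> to
      \<open>H\<close>.\<close>
    define pull where "pull = {a \<in> carrier (X k). \<iota> k a \<in> D}"
    have pull: "submodule pull R (X k)"
      unfolding pull_def using submodule_vimage[OF Xk B \<iota>[OF k] D_sub] .
    obtain u where u: "u \<in> mhom R (X k) G" "\<And>a. a \<in> pull \<Longrightarrow> u a = \<phi> (\<iota> k a)"
    proof (rule rel_injectiveE[OF inj[OF k] Xk pull, of "\<lambda>a. \<phi> (\<iota> k a)"])
      show "\<phi> (\<iota> k a) \<in> carrier G" if "a \<in> pull" for a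
        using that \<phi> H(1) unfolding pull_def by blast
    qed (use \<iota>k \<phi>_add \<phi>_smult in \<open>auto simp: pull_def\<close>)
    note ud = mhomD[OF u(1)] mhom_zero[OF Xk G u(1)]
    define H' where "H' = {(x \<oplus>\<^bsub>B\<^esub> \<iota> k a, y \<oplus>\<^bsub>G\<^esub> u a) |x y a. (x, y) \<in> H \<and> a \<in> carrier (X k)}"
    have H'I: "(x \<oplus>\<^bsub>B\<^esub> \<iota> k a, y \<oplus>\<^bsub>G\<^esub> u a) \<in> H'" if "(x, y) \<in> H" "a \<in> carrier (X k)" for x y a
      using that unfolding H'_def by blast
    have "good H'"
      unfolding good_def
    proof (intro conjI allI impI)
      show "H' \<subseteq> carrier B \<times> carrier G" unfolding H'_def using H(1) \<iota>k(1) ud(1) by auto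
    next
      fix x y x' y' assume "(x, y) \<in> H'" "(x', y') \<in> H'"
      then obtain a b c d a' b' where *: "x = a \<oplus>\<^bsub>B\<^esub> \<iota> k b" "y = c \<oplus>\<^bsub>G\<^esub> u b" "x' = a' \<oplus>\<^bsub>B\<^esub> \<iota> k b'"
        "y' = d \<oplus>\<^bsub>G\<^esub> u b'" "(a, c) \<in> H" "(a', d) \<in> H" "b \<in> carrier (X k)" "b' \<in> carrier (X k)"
        unfolding H'_def by blast
      have "x \<oplus>\<^bsub>B\<^esub> x' = (a \<oplus>\<^bsub>B\<^esub> a') \<oplus>\<^bsub>B\<^esub> \<iota> k (b \<oplus>\<^bsub>X k\<^esub> b')"
        "y \<oplus>\<^bsub>G\<^esub> y' = (c \<oplus>\<^bsub>G\<^esub> d) \<oplus>\<^bsub>G\<^esub> u (b \<oplus>\<^bsub>X k\<^esub> b')"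
        using * H(1)[OF *(5)] H(1)[OF *(6)] \<iota>k(1,2) ud(1,2) by (simp_all add: B.a_ac G.a_ac)
      then show "(x \<oplus>\<^bsub>B\<^esub> x', y \<oplus>\<^bsub>G\<^esub> y') \<in> H'" using H'I[OF H(2)[OF *(5,6)]] * by simp
    next
      fix r x y assume r: "r \<in> carrier R" and "(x, y) \<in> H'"
      then obtain a b c where *: "x = a \<oplus>\<^bsub>B\<^esub> \<iota> k b" "y = c \<oplus>\<^bsub>G\<^esub> u b" "(a, c) \<in> H" "b \<in> carrier (X k)"
        unfolding H'_def by blast
      have "r \<odot>\<^bsub>B\<^esub> x = r \<odot>\<^bsub>B\<^esub> a \<oplus>\<^bsub>B\<^esub> \<iota> k (r \<odot>\<^bsub>X k\<^esub> b)" "r \<odot>\<^bsub>G\<^esub> y = r \<odot>\<^bsub>G\<^esub> c \<oplus>\<^bsub>G\<^esub> u (r \<odot>\<^bsub>X k\<^esub> b)"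
        using * H(1)[OF *(3)] \<iota>k(1,3) ud(1,3) r by (simp_all add: B.smult_r_distr G.smult_r_distr)
      then show "(r \<odot>\<^bsub>B\<^esub> x, r \<odot>\<^bsub>G\<^esub> y) \<in> H'" using H'I[OF H(3)[OF r *(3)]] * r by simp
    next
      \<comment> \<open>Agreement on the overlap: if \<open>a\<close> and \<open>\<iota> k b\<close>
        cancel, then \<open>b\<close> lies in \<open>pull\<close>, so \<open>u b\<close> is the
        value that \<open>H\<close> already assigns.\<close>
      fix y assume "(\<zero>\<^bsub>B\<^esub>, y) \<in> H'"
      then obtain a b c where *: "\<zero>\<^bsub>B\<^esub> = a \<oplus>\<^bsub>B\<^esub> \<iota> k b" "y = c \<oplus>\<^bsub>G\<^esub> u b" "(a, c) \<in> H" "b \<in> carrier (X k)"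
        unfolding H'_def by blast
      have "\<iota> k b \<oplus>\<^bsub>B\<^esub> a = \<zero>\<^bsub>B\<^esub>" using * \<iota>k(1) H(1) by (metis B.a_comm)
      then have "\<iota> k b = \<ominus>\<^bsub>B\<^esub> a" using * \<iota>k(1) H(1) by (metis B.minus_equality)
      then have "\<iota> k b \<in> D" using neg[OF *(3)] D by metis
      then have "(\<iota> k b, u b) \<in> H" using u(2)[of b] \<phi> *(4) by (simp add: pull_def)
      then have "(a \<oplus>\<^bsub>B\<^esub> \<iota> k b, c \<oplus>\<^bsub>G\<^esub> u b) \<in> H" using H(2) *(3) by blast
      then show "y = \<zero>\<^bsub>G\<^esub>" using * H(4) by simp
    qed
    moreover have "H \<subseteq> H'"
    proof (rule subrelI)
      fix x y assume xy: "(x, y) \<in> H"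
      then show "(x, y) \<in> H'"
        using H'I[OF xy X.zero_closed] H(1)[OF xy] ud(5) mhom_zero[OF Xk B \<iota>[OF k]] by simp
    qed
    ultimately have "H' = H" by (rule max)
    then show ?thesis using H'I[OF zero] \<iota>k(1) D by (metis B.l_zero image_subsetI)
  qed
  then have DB: "carrier B \<subseteq> D" using gen[OF D_sub] by blast
  have "restrict \<phi> (carrier B) \<in> mhom R B G"
  proof (rule mhom_restrictI[OF B])
    show "\<phi> x \<in> carrier G" if "x \<in> carrier B" for x using \<phi>[of x] H(1) DB that by blast
  qed (use \<phi>_add \<phi>_smult subsetD[OF DB] in auto)
  moreover have "\<phi> x = f x" if "x \<in> N" for x
    by (rule \<phi>_eq) (use that H0 in \<open>auto simp: H0_def\<close>)
  ultimately show "\<exists>g\<in>mhom R B G. \<forall>x\<in>N. g x = f x"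
    using submoduleD(2)[OF N] by (intro bexI) auto
qed

text \<open>A submodule of \<open>B\<close> is moved into \<open>C\<close> by \<open>e\<close>; the
  extension found on \<open>C\<close> is then composed with \<open>e\<close>.\<close>

lemma rel_injective_embedding:
  assumes B: "left_module R B" and C: "left_module R C" and inj: "rel_injective R C G"
    and e: "e \<in> mhom R B C" "inj_on e (carrier B)"
  shows "rel_injective R B G"
proof (rule rel_injectiveI)
  fix N f assume N: "submodule N R B"
    and f: "\<And>x. x \<in> N \<Longrightarrow> f x \<in> carrier G"
      "\<And>x y. x \<in> N \<Longrightarrow> y \<in> N \<Longrightarrow> f (x \<oplus>\<^bsub>B\<^esub> y) = f x \<oplus>\<^bsub>G\<^esub> f y"
      "\<And>r x. r \<in> carrier R \<Longrightarrow> x \<in> N \<Longrightarrow> f (r \<odot>\<^bsub>B\<^esub> x) = r \<odot>\<^bsub>G\<^esub> f x"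
  have eN: "inj_on e N" using e(2) submoduleD(1)[OF N] inj_on_subset by blast
  note i = inv_into_mhom[OF B e(1) N eN]
  have iN: "inv_into N e z \<in> N" if "z \<in> e ` N" for z using that by (rule inv_into_into)
  obtain g where g: "g \<in> mhom R C G" "\<And>z. z \<in> e ` N \<Longrightarrow> g z = f (inv_into N e z)"
    by (rule rel_injectiveE[OF inj C submodule_image[OF B C e(1) N], of "\<lambda>z. f (inv_into N e z)"])
       (use f i iN in auto)
  have "compose (carrier B) g e x = f x" if "x \<in> N" for x
    using that g(2) eN submoduleD(2)[OF N] by (simp add: compose_def)
  then show "\<exists>h\<in>mhom R B G. \<forall>x\<in>N. h x = f x" using mhom_compose[OF B e(1) g(1)] by blast
qed

text \<open>Extensions are chosen coordinate by coordinate. Finiteness of \<open>I\<close> ensures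
  that the assembled values have finite support and so lie in the direct sum.\<close>

lemma rel_injective_direct_sum:
  assumes X: "left_module R X" and "finite I"
    and A: "\<And>i. i \<in> I \<Longrightarrow> left_module R (A i)" "\<And>i. i \<in> I \<Longrightarrow> rel_injective R X (A i)"
  shows "rel_injective R X (direct_sum I A)"
proof (rule rel_injectiveI)
  fix N f assume N: "submodule N R X"
    and f: "\<And>x. x \<in> N \<Longrightarrow> f x \<in> carrier (direct_sum I A)"
      "\<And>x y. x \<in> N \<Longrightarrow> y \<in> N \<Longrightarrow> f (x \<oplus>\<^bsub>X\<^esub> y) = f x \<oplus>\<^bsub>direct_sum I A\<^esub> f y"
      "\<And>r x. r \<in> carrier R \<Longrightarrow> x \<in> N \<Longrightarrow> f (r \<odot>\<^bsub>X\<^esub> x) = r \<odot>\<^bsub>direct_sum I A\<^esub> f x"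
  have "\<exists>g. g \<in> mhom R X (A i) \<and> (\<forall>x\<in>N. g x = f x i)" if i: "i \<in> I" for i
  proof -
    obtain g where "g \<in> mhom R X (A i)" "\<And>x. x \<in> N \<Longrightarrow> g x = f x i"
      by (rule rel_injectiveE[OF A(2)[OF i] X N, of "\<lambda>x. f x i"])
         (use f i in \<open>auto simp: direct_sum_carrier_iff\<close>)
    then show ?thesis by blast
  qed
  then obtain g where g: "\<And>i. i \<in> I \<Longrightarrow> g i \<in> mhom R X (A i)" "\<And>i x. i \<in> I \<Longrightarrow> x \<in> N \<Longrightarrow> g i x = f x i"
    by metis
  have "(\<lambda>x\<in>carrier X. \<lambda>i\<in>I. g i x) \<in> mhom R X (direct_sum I A)"
    using \<open>finite I\<close> mhomD[OF g(1)]
    by (intro mhom_restrictI[OF X]) (auto simp: direct_sum_carrier_iff fun_eq_iff)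
  moreover have "(\<lambda>i\<in>I. g i x) = f x" if "x \<in> N" for x
    using f(1)[OF that] g(2) that by (auto simp: direct_sum_carrier_iff fun_eq_iff PiE_def extensional_def)
  ultimately show "\<exists>g\<in>mhom R X (direct_sum I A). \<forall>x\<in>N. g x = f x"
    using submoduleD(2)[OF N] by (intro bexI) auto
qed

text \<open>A quotient of a direct sum of copies of \<open>M\<close> is generated by images of
  \<open>M\<close>, and an object of \<open>\<sigma>[M]\<close> embeds in such a quotient. So
  injectivity relative to \<open>M\<close> reaches the whole category, as the comparison of hulls
  requires.\<close>

lemma rel_injective_subgenerated:
  fixes B :: "('r, 'b) module"
  assumes M: "left_module R M" and G: "left_module R G" and inj: "rel_injective R M G"
    and B: "subgenerated R M B"
  shows "rel_injective R B G"
proof -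
  obtain I :: "('b \<times> nat) set" and K j where K: "submodule K R (direct_sum I (\<lambda>_. M))"
    and j: "j \<in> mhom R B (quot_module (direct_sum I (\<lambda>_. M)) K)" "inj_on j (carrier B)"
    and Bm: "left_module R B"
    using B unfolding subgenerated_def by blast
  interpret M: plain_module R M using M by (rule plain_moduleI)
  define S where "S = direct_sum I (\<lambda>_. M)"
  interpret S: plain_module R S
    unfolding S_def by (intro plain_moduleI direct_sum_left_module M.R.ring_axioms M)
  have KS: "submodule K R S" using K by (simp add: S_def)
  define q where "q = (\<lambda>x\<in>carrier S. K +>\<^bsub>S\<^esub> x)"
  have q: "q \<in> mhom R S (quot_module S K)" unfolding q_def by (rule S.quot_map_mhom[OF KS])
  define s where "s i = restrict (ds_single I (\<lambda>_. M) i) (carrier M)" for i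
  have s: "s i \<in> mhom R M S" if "i \<in> I" for i
    using ds_single_mhom[of I R "\<lambda>_. M" i] M that by (simp add: S_def s_def)
  have Q: "left_module R (quot_module S K)" by (rule S.quot_left_module[OF KS])
  have "rel_injective R (quot_module S K) G"
  proof (rule rel_injective_generated[OF Q G])
    show "compose (carrier M) q (s i) \<in> mhom R M (quot_module S K)" if "i \<in> I" for i
      using mhom_compose[OF M s[OF that] q] .
    fix T assume T: "submodule T R (quot_module S K)"
      "\<And>i. i \<in> I \<Longrightarrow> compose (carrier M) q (s i) ` carrier M \<subseteq> T"
    have sub: "submodule {x \<in> carrier S. q x \<in> T} R S"
      by (rule submodule_vimage[OF S.left_module_axioms Q q T(1)])
    \<comment> \<open>Pulling \<open>T\<close> back to the direct sum reduces generation of the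
      quotient to generation by the coordinate embeddings.\<close>
    have "carrier S \<subseteq> {x \<in> carrier S. q x \<in> T}"
      unfolding S_def
    proof (rule direct_sum_generated[OF M.R.ring_axioms M sub[unfolded S_def]])
      fix i x assume ix: "i \<in> I" "x \<in> carrier M"
      then have "s i x \<in> carrier S" "q (s i x) \<in> T"
        using mhomD(1)[OF s] T(2)[of i] by (auto simp: compose_def)
      then show "ds_single I (\<lambda>_. M) i x \<in> {x \<in> carrier (direct_sum I (\<lambda>_. M)). q x \<in> T}"
        using ix by (simp add: s_def S_def)
    qed
    then show "carrier (quot_module S K) \<subseteq> T"
      using S.quot_carrier[OF KS] by (force simp: q_def)
  qed (use M inj in auto)
  then show ?thesis
    using rel_injective_embedding[OF Bm Q _ j[folded S_def]] by blast
qed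

text \<open>Extend \<open>h\<close> along \<open>j\<close> to \<open>e\<close>, and the inverse of
  \<open>e\<close> on its image to \<open>p\<close>. Both are injective because they are so on an
  essential image of \<open>K\<close>. As \<open>p\<close> undoes \<open>e\<close> and is itself
  injective, \<open>e\<close> is onto.\<close>

lemma injective_hull_unique:
  assumes mod: "left_module R K" "left_module R E" "left_module R G"
    and inj: "rel_injective R E G" "rel_injective R G E"
    and j: "j \<in> mhom R K E" "inj_on j (carrier K)" "essential R E (j ` carrier K)"
    and h: "h \<in> mhom R K G" "inj_on h (carrier K)" "essential R G (h ` carrier K)"
  shows "miso R E G"
proof -
  interpret K: plain_module R K using mod(1) by (rule plain_moduleI)
  interpret E: plain_module R E using mod(2) by (rule plain_moduleI)
  interpret G: plain_module R G using mod(3) by (rule plain_moduleI)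
  have jK: "submodule (j ` carrier K) R E" using j(3) by (simp add: essential_def)
  note jd = mhomD[OF j(1)] mhom_zero[OF mod(1,2) j(1)]
  note hd = mhomD[OF h(1)] mhom_zero[OF mod(1,3) h(1)]
  note i = inv_into_mhom[OF mod(1) j(1) K.submodule_carrier j(2)]
  obtain e where e: "e \<in> mhom R E G" "\<And>z. z \<in> j ` carrier K \<Longrightarrow> e z = h (inv_into (carrier K) j z)"
    by (rule rel_injectiveE[OF inj(1) mod(2) jK, of "\<lambda>z. h (inv_into (carrier K) j z)"])
       (use i hd in auto)
  have ej: "e (j x) = h x" if "x \<in> carrier K" for x using that e(2) j(2) by simp
  have hnz: "h x \<noteq> \<zero>\<^bsub>G\<^esub>" if "x \<in> carrier K" "j x \<noteq> \<zero>\<^bsub>E\<^esub>" for x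
    using that hd(5) jd(5) h(2) by (metis K.zero_closed inj_onD)
  have jnz: "j x \<noteq> \<zero>\<^bsub>E\<^esub>" if "x \<in> carrier K" "h x \<noteq> \<zero>\<^bsub>G\<^esub>" for x
    using that hd(5) jd(5) j(2) by (metis K.zero_closed inj_onD)
  note ed = mhomD[OF e(1)]
  have e_inj: "inj_on e (carrier E)"
    unfolding mhom_inj_iff[OF mod(2,3) e(1)]
  proof (intro ballI impI, rule ccontr)
    fix z assume z: "z \<in> carrier E" "e z = \<zero>\<^bsub>G\<^esub>" "z \<noteq> \<zero>\<^bsub>E\<^esub>"
    then obtain r where r: "r \<in> carrier R" "r \<odot>\<^bsub>E\<^esub> z \<in> j ` carrier K" "r \<odot>\<^bsub>E\<^esub> z \<noteq> \<zero>\<^bsub>E\<^esub>"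
      using j(3) unfolding E.essential_iff by blast
    then obtain x where x: "x \<in> carrier K" "r \<odot>\<^bsub>E\<^esub> z = j x" by blast
    have "h x = r \<odot>\<^bsub>G\<^esub> e z" using ej x r z ed(3) by metis
    then show False using hnz[OF x(1)] x r z by simp
  qed
  note i' = inv_into_mhom[OF mod(2) e(1) E.submodule_carrier e_inj]
  obtain p where p: "p \<in> mhom R G E" "\<And>z. z \<in> e ` carrier E \<Longrightarrow> p z = inv_into (carrier E) e z"
    by (rule rel_injectiveE[OF inj(2) mod(3)
          submodule_image[OF mod(2,3) e(1) E.submodule_carrier], of "inv_into (carrier E) e"])
       (use i' in auto)
  have pe: "p (e z) = z" if "z \<in> carrier E" for z using that p(2) e_inj by simp
  note pd = mhomD[OF p(1)]
  have p_inj: "inj_on p (carrier G)"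
    unfolding mhom_inj_iff[OF mod(3,2) p(1)]
  proof (intro ballI impI, rule ccontr)
    fix y assume y: "y \<in> carrier G" "p y = \<zero>\<^bsub>E\<^esub>" "y \<noteq> \<zero>\<^bsub>G\<^esub>"
    then obtain r where r: "r \<in> carrier R" "r \<odot>\<^bsub>G\<^esub> y \<in> h ` carrier K" "r \<odot>\<^bsub>G\<^esub> y \<noteq> \<zero>\<^bsub>G\<^esub>"
      using h(3) unfolding G.essential_iff by blast
    then obtain x where x: "x \<in> carrier K" "r \<odot>\<^bsub>G\<^esub> y = h x" by blast
    have "j x = r \<odot>\<^bsub>E\<^esub> p y" using ej x r y pd(3) pe jd(1) by metis
    then show False using jnz[OF x(1)] x r y by simp
  qed
  have "e ` carrier E = carrier G"
  proof
    show "e ` carrier E \<subseteq> carrier G" using ed(1) by auto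
    show "carrier G \<subseteq> e ` carrier E"
    proof
      fix y assume y: "y \<in> carrier G"
      then have "p (e (p y)) = p y" using pe pd(1) by simp
      then have "e (p y) = y" using p_inj y pd(1) ed(1) by (meson inj_onD)
      then show "y \<in> e ` carrier E" using pd(1)[OF y] by (metis imageI)
    qed
  qed
  then show ?thesis using e(1) e_inj unfolding miso_def bij_betw_def by blast
qed

section \<open>Lifting along surjections from submodules of direct sums\<close>

text \<open>A copy of \<open>N\<close> with elements renamed by \<open>\<phi>\<close>, provided that
  \<open>\<psi>\<close> undoes \<open>\<phi>\<close> on the carrier. It brings modules into the one
  element type over which \<open>projective_in_sigma\<close> quantifies.\<close>

definition transport :: "('a \<Rightarrow> 'b) \<Rightarrow> ('b \<Rightarrow> 'a) \<Rightarrow> ('r, 'a) module \<Rightarrow> ('r, 'b) module"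
  where "transport \<phi> \<psi> N =
    \<lparr>carrier = \<phi> ` carrier N, mult = undefined, one = undefined, zero = \<phi> \<zero>\<^bsub>N\<^esub>,
     add = (\<lambda>x y. \<phi> (\<psi> x \<oplus>\<^bsub>N\<^esub> \<psi> y)), smult = (\<lambda>r x. \<phi> (r \<odot>\<^bsub>N\<^esub> \<psi> x))\<rparr>"

lemma transport_simps [simp]:
  "carrier (transport \<phi> \<psi> N) = \<phi> ` carrier N"
  "\<zero>\<^bsub>transport \<phi> \<psi> N\<^esub> = \<phi> \<zero>\<^bsub>N\<^esub>"
  "x \<oplus>\<^bsub>transport \<phi> \<psi> N\<^esub> y = \<phi> (\<psi> x \<oplus>\<^bsub>N\<^esub> \<psi> y)"
  "r \<odot>\<^bsub>transport \<phi> \<psi> N\<^esub> x = \<phi> (r \<odot>\<^bsub>N\<^esub> \<psi> x)"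
  by (simp_all add: transport_def)

lemma transport_mhom:
  assumes N: "left_module R N" and inv: "\<And>x. x \<in> carrier N \<Longrightarrow> \<psi> (\<phi> x) = x"
  shows "left_module R (transport \<phi> \<psi> N)"
    and "restrict \<phi> (carrier N) \<in> mhom R N (transport \<phi> \<psi> N)"
    and "restrict \<psi> (carrier (transport \<phi> \<psi> N)) \<in> mhom R (transport \<phi> \<psi> N) N"
proof -
  interpret N: plain_module R N using N by (rule plain_moduleI)
  show T: "left_module R (transport \<phi> \<psi> N)"
    by (rule left_moduleI)
       (auto simp: inv N.R.ring_axioms N.M.a_assoc N.smult_l_distr N.smult_r_distr N.smult_assoc1
          intro!: arg_cong[of _ _ \<phi>] intro: N.M.a_comm)
  show "restrict \<phi> (carrier N) \<in> mhom R N (transport \<phi> \<psi> N)"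
    by (rule mhom_restrictI[OF N]) (auto simp: inv)
  show "restrict \<psi> (carrier (transport \<phi> \<psi> N)) \<in> mhom R (transport \<phi> \<psi> N) N"
    by (rule mhom_restrictI[OF T]) (auto simp: inv)
qed

lemma subgenerated_embedding:
  fixes N :: "('r, 'b) module" and e :: "'i \<Rightarrow> 'b \<times> nat"
  assumes M: "left_module R M" and N: "left_module R N"
    and j: "j \<in> mhom R N (direct_sum I (\<lambda>_. M))" "inj_on j (carrier N)"
    and J: "J \<subseteq> I" "\<And>x i. x \<in> carrier N \<Longrightarrow> i \<in> I - J \<Longrightarrow> j x i = \<zero>\<^bsub>M\<^esub>"
    and e: "inj_on e J"
  shows "subgenerated R M N"
proof -
  interpret M: plain_module R M using M by (rule plain_moduleI)
  interpret N: plain_module R N using N by (rule plain_moduleI)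
  define S where "S = direct_sum (e ` J) (\<lambda>_. M)"
  have Sm: "left_module R S" "left_module R (direct_sum I (\<lambda>_. M))"
    unfolding S_def by (intro direct_sum_left_module M.R.ring_axioms M)+
  interpret S: plain_module R S using Sm(1) by (rule plain_moduleI)
  define \<rho> where "\<rho> y = (\<lambda>k\<in>e ` J. y (inv_into J e k))" for y :: "'i \<Rightarrow> 'c"
  have \<rho>_in: "inv_into J e k \<in> I" if "k \<in> e ` J" for k
    using that J(1) inv_into_into[of k e J] by blast
  have \<rho>: "restrict \<rho> (carrier (direct_sum I (\<lambda>_. M))) \<in> mhom R (direct_sum I (\<lambda>_. M)) S"
  proof (rule mhom_restrictI[OF Sm(2)])
    fix y assume y: "y \<in> carrier (direct_sum I (\<lambda>_. M))"
    have "finite {k \<in> e ` J. \<rho> y k \<noteq> \<zero>\<^bsub>M\<^esub>}"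
    proof (rule finite_subset)
      show "{k \<in> e ` J. \<rho> y k \<noteq> \<zero>\<^bsub>M\<^esub>} \<subseteq> e ` {i \<in> I. y i \<noteq> \<zero>\<^bsub>M\<^esub>}"
        using J(1) e by (auto simp: \<rho>_def)
      show "finite (e ` {i \<in> I. y i \<noteq> \<zero>\<^bsub>M\<^esub>})" using y by (simp add: direct_sum_carrier_iff)
    qed
    then show "\<rho> y \<in> carrier S"
      using y \<rho>_in by (auto simp: S_def direct_sum_carrier_iff \<rho>_def PiE_def Pi_def)
  qed (use \<rho>_in in \<open>auto simp: S_def \<rho>_def fun_eq_iff\<close>)
  define q where "q = (\<lambda>x\<in>carrier S. {\<zero>\<^bsub>S\<^esub>} +>\<^bsub>S\<^esub> x)"
  have q: "q \<in> mhom R S (quot_module S {\<zero>\<^bsub>S\<^esub>})"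
    unfolding q_def by (rule S.quot_map_mhom[OF S.submodule_zero])
  define j' where "j' = compose (carrier N) q
    (compose (carrier N) (restrict \<rho> (carrier (direct_sum I (\<lambda>_. M)))) j)"
  have j': "j' \<in> mhom R N (quot_module S {\<zero>\<^bsub>S\<^esub>})"
    unfolding j'_def by (rule mhom_compose[OF N mhom_compose[OF N j(1) \<rho>] q])
  moreover have "inj_on j' (carrier N)"
    unfolding mhom_inj_iff[OF N S.quot_left_module[OF S.submodule_zero] j']
  proof (intro ballI impI)
    fix x assume x: "x \<in> carrier N" "j' x = \<zero>\<^bsub>quot_module S {\<zero>\<^bsub>S\<^esub>}\<^esub>"
    note jx = mhomD(1)[OF j(1) x(1)]
    have \<rho>x: "\<rho> (j x) \<in> carrier S" using mhomD(1)[OF \<rho> jx] jx by simp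
    have "{\<zero>\<^bsub>S\<^esub>} +>\<^bsub>S\<^esub> \<rho> (j x) = {\<zero>\<^bsub>S\<^esub>}"
      using x jx \<rho>x by (simp add: j'_def compose_def q_def)
    then have \<rho>0: "\<rho> (j x) = \<zero>\<^bsub>S\<^esub>" using S.coset_eq_zero_iff[OF S.submodule_zero \<rho>x] by blast
    have "j x i = \<zero>\<^bsub>M\<^esub>" if i: "i \<in> I" for i
    proof (cases "i \<in> J")
      case True
      then have "j x i = \<rho> (j x) (e i)" using e by (simp add: \<rho>_def)
      then show ?thesis using \<rho>0 True by (simp add: S_def)
    qed (use J(2) x i in blast)
    then have "j x = \<zero>\<^bsub>direct_sum I (\<lambda>_. M)\<^esub>"
      using jx by (auto simp: direct_sum_carrier_iff PiE_def extensional_def fun_eq_iff)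
    then show "x = \<zero>\<^bsub>N\<^esub>"
      using mhom_inj_iff[OF N Sm(2) j(1)] j(2) x(1) by blast
  qed
  ultimately show ?thesis
    unfolding subgenerated_def using N S.submodule_zero S_def by blast
qed

lemma mhom_restrict_iff:
  assumes "K \<subseteq> carrier M"
  shows "f \<in> mhom R N (M\<lparr>carrier := K\<rparr>) \<longleftrightarrow> f \<in> mhom R N M \<and> f ` carrier N \<subseteq> K"
  using assms by (auto simp: mhom_def)

text \<open>The names of the elements of the submodule generated by chosen preimages \<^term>\<open>b x\<close> are lists of
  coefficients and generators, which brings the lifting problem into the type over which
  \<^const>\<open>projective_in_sigma\<close> quantifies.\<close>

lemma projective_lift:
  fixes M :: "('r, 'm) module" and I :: "'i set"
  assumes M: "left_module R M" and proj: "projective_in_sigma R M"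
    and B: "submodule B R (direct_sum I (\<lambda>_. M))"
    and \<beta>: "\<beta> \<in> mhom R ((direct_sum I (\<lambda>_. M))\<lparr>carrier := B\<rparr>) M"
    and h: "h \<in> mhom R M M" "h ` carrier M \<subseteq> \<beta> ` B"
  obtains u where "u \<in> mhom R M (direct_sum I (\<lambda>_. M))"
    "\<And>x. x \<in> carrier M \<Longrightarrow> u x \<in> B" "\<And>x. x \<in> carrier M \<Longrightarrow> \<beta> (u x) = h x"
proof -
  interpret M: plain_module R M using M by (rule plain_moduleI)
  define S where "S = direct_sum I (\<lambda>_. M)"
  interpret S: plain_module R S
    unfolding S_def by (intro plain_moduleI direct_sum_left_module M.R.ring_axioms M)
  note Bd = submoduleD[OF B[folded S_def]]
  have \<beta>d: "\<And>x. x \<in> B \<Longrightarrow> \<beta> x \<in> carrier M"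
    "\<And>x y. x \<in> B \<Longrightarrow> y \<in> B \<Longrightarrow> \<beta> (x \<oplus>\<^bsub>S\<^esub> y) = \<beta> x \<oplus>\<^bsub>M\<^esub> \<beta> y"
    "\<And>r x. r \<in> carrier R \<Longrightarrow> x \<in> B \<Longrightarrow> \<beta> (r \<odot>\<^bsub>S\<^esub> x) = r \<odot>\<^bsub>M\<^esub> \<beta> x"
    using mhomD[OF \<beta>] by (simp_all add: S_def)
  have \<beta>0: "\<beta> \<zero>\<^bsub>S\<^esub> = \<zero>\<^bsub>M\<^esub>"
    using \<beta>d(3)[of "\<zero>\<^bsub>R\<^esub>" "\<zero>\<^bsub>S\<^esub>"] \<beta>d(1)[of "\<zero>\<^bsub>S\<^esub>"] Bd(3) by simp
  have "\<forall>x\<in>carrier M. \<exists>y\<in>B. \<beta> y = h x" using h(2) by (metis image_iff image_subset_iff)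
  then obtain b where b: "\<And>x. x \<in> carrier M \<Longrightarrow> b x \<in> B" "\<And>x. x \<in> carrier M \<Longrightarrow> \<beta> (b x) = h x"
    by metis
  have bS: "b x \<in> carrier S" if "x \<in> carrier M" for x using b(1)[OF that] Bd(2) by blast
  note hd = mhomD[OF h(1)]
  have hM: "submodule (h ` carrier M) R M"
    by (rule submodule_image[OF M M h(1) M.submodule_carrier])
  \<comment> \<open>Formal linear combinations: a pair \<open>(r, x)\<close> stands for
    \<open>r\<close> times the chosen preimage \<open>b x\<close>, and \<open>lc\<close> evaluates a
    list. Concatenation adds values and scaling the coefficients scales them, so the values form a
    submodule.\<close>
  define L where "L = {ts. set ts \<subseteq> carrier R \<times> carrier M}"
  define lc where "lc ts = foldr (\<lambda>(r, x) y. r \<odot>\<^bsub>S\<^esub> b x \<oplus>\<^bsub>S\<^esub> y) ts \<zero>\<^bsub>S\<^esub>" for ts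
  have lc_simps: "lc [] = \<zero>\<^bsub>S\<^esub>" "lc ((r, x) # ts) = r \<odot>\<^bsub>S\<^esub> b x \<oplus>\<^bsub>S\<^esub> lc ts" for r x ts
    by (simp_all add: lc_def)
  \<comment> \<open>Values of \<open>lc\<close> live on the coordinates met by some
    \<open>b x\<close>. Unlike \<open>I\<close>, this index set is small enough to be named by lists
    and numbers.\<close>
  define J where "J = {i \<in> I. \<exists>x\<in>carrier M. b x i \<noteq> \<zero>\<^bsub>M\<^esub>}"
  have lc_B: "lc ts \<in> B \<and> \<beta> (lc ts) \<in> h ` carrier M \<and> (\<forall>i\<in>I - J. lc ts i = \<zero>\<^bsub>M\<^esub>)" if "ts \<in> L" for ts
    using that
  proof (induction ts)
    case Nil
    have "\<zero>\<^bsub>S\<^esub> i = \<zero>\<^bsub>M\<^esub>" if "i \<in> I - J" for i using that by (simp add: S_def)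
    then show ?case using Bd(3) \<beta>0 submoduleD(3)[OF hM] unfolding lc_simps by metis
  next
    case (Cons t ts)
    obtain r x where t: "t = (r, x)" by (cases t)
    have rx: "r \<in> carrier R" "x \<in> carrier M" "ts \<in> L" using Cons.prems by (auto simp: L_def t)
    have hx: "h x \<in> h ` carrier M" using rx by blast
    have IH: "lc ts \<in> B" "\<beta> (lc ts) \<in> h ` carrier M" "\<forall>i\<in>I - J. lc ts i = \<zero>\<^bsub>M\<^esub>"
      using Cons.IH[OF rx(3)] by auto
    have rb: "r \<odot>\<^bsub>S\<^esub> b x \<in> B" using rx b(1) Bd(5) by blast
    have "lc (t # ts) \<in> B" using rb IH Bd(4) by (simp only: t lc_simps)
    moreover have "\<beta> (lc (t # ts)) = r \<odot>\<^bsub>M\<^esub> h x \<oplus>\<^bsub>M\<^esub> \<beta> (lc ts)"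
      using rb IH \<beta>d(2,3) rx b unfolding t lc_simps by simp
    then have "\<beta> (lc (t # ts)) \<in> h ` carrier M"
      using submoduleD(4,5)[OF hM] hx rx(1) IH(2) by simp
    moreover have "lc (t # ts) i = \<zero>\<^bsub>M\<^esub>" if "i \<in> I - J" for i
      using that rx IH(3) unfolding t lc_simps by (auto simp: S_def J_def)
    ultimately show ?case by blast
  qed
  have lc_S: "lc ts \<in> carrier S" if "ts \<in> L" for ts using lc_B[OF that] Bd(2) by blast
  have lc_append: "lc (ts @ ts') = lc ts \<oplus>\<^bsub>S\<^esub> lc ts'" if "ts \<in> L" "ts' \<in> L" for ts ts'
    using that(1)
  proof (induction ts)
    case Nil
    then show ?case using lc_S[OF that(2)] by (simp only: append_Nil lc_simps S.M.l_zero)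
  next
    case (Cons t ts)
    obtain r x where t: "t = (r, x)" by (cases t)
    have rx: "r \<in> carrier R" "x \<in> carrier M" "ts \<in> L" using Cons.prems by (auto simp: L_def t)
    have "r \<odot>\<^bsub>S\<^esub> b x \<in> carrier S" using rx bS by blast
    then show ?case using Cons.IH[OF rx(3)] lc_S rx that(2)
      by (simp only: t append_Cons lc_simps S.M.a_assoc)
  qed
  have lc_smult: "lc (map (\<lambda>(s, x). (r \<otimes>\<^bsub>R\<^esub> s, x)) ts) = r \<odot>\<^bsub>S\<^esub> lc ts"
    if "r \<in> carrier R" "ts \<in> L" for r ts
    using that(2)
  proof (induction ts)
    case Nil
    then show ?case using S.smult_zero[OF that(1)] by (simp only: list.map lc_simps)
  next
    case (Cons t ts)
    obtain s x where t: "t = (s, x)" by (cases t)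
    have rx: "s \<in> carrier R" "x \<in> carrier M" "ts \<in> L" using Cons.prems by (auto simp: L_def t)
    show ?case using Cons.IH[OF rx(3)] lc_S[OF rx(3)] rx bS[OF rx(2)] that(1)
      by (simp only: t list.map split lc_simps S.smult_r_distr S.smult_assoc1 S.smult_closed)
  qed
  define B0 where "B0 = lc ` L"
  have B0: "submodule B0 R S"
  proof (rule S.submodule_intro)
    show "B0 \<subseteq> carrier S" using lc_S by (auto simp: B0_def)
    have "[] \<in> L" by (simp add: L_def)
    then show "\<zero>\<^bsub>S\<^esub> \<in> B0" unfolding B0_def using lc_simps(1) by (metis imageI)
    show "y \<oplus>\<^bsub>S\<^esub> z \<in> B0" if yz: "y \<in> B0" "z \<in> B0" for y z
    proof -
      obtain ts ts' where ts: "ts \<in> L" "ts' \<in> L" "y = lc ts" "z = lc ts'" using yz by (auto simp: B0_def)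
      then have "ts @ ts' \<in> L" by (simp add: L_def)
      then show ?thesis unfolding B0_def using ts lc_append by (metis imageI)
    qed
    show "r \<odot>\<^bsub>S\<^esub> y \<in> B0" if ry: "r \<in> carrier R" "y \<in> B0" for r y
    proof -
      obtain ts where ts: "ts \<in> L" "y = lc ts" using ry by (auto simp: B0_def)
      then have "map (\<lambda>(s, x). (r \<otimes>\<^bsub>R\<^esub> s, x)) ts \<in> L" using ry by (auto simp: L_def)
      then show ?thesis unfolding B0_def using ts lc_smult ry by (metis imageI)
    qed
  qed
  have B0D: "y \<in> B" "\<beta> y \<in> h ` carrier M" "\<And>i. i \<in> I - J \<Longrightarrow> y i = \<zero>\<^bsub>M\<^esub>" if "y \<in> B0" for y
    using that lc_B unfolding B0_def by auto
  have bB0: "b x \<in> B0" if "x \<in> carrier M" for x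
  proof -
    have "lc [(\<one>\<^bsub>R\<^esub>, x)] = b x" using bS[OF that] by (simp only: lc_simps S.smult_one S.M.r_zero)
    moreover have "[(\<one>\<^bsub>R\<^esub>, x)] \<in> L" using that by (simp add: L_def)
    ultimately show ?thesis unfolding B0_def by (metis imageI)
  qed
  \<comment> \<open>Many lists have the same value; one of them is fixed as its name. The operations
    on names are transported from the values, not computed on lists.\<close>
  define name where "name = inv_into L lc"
  have lc_name: "lc (name y) = y" if "y \<in> B0" for y
    using that unfolding name_def B0_def by (rule f_inv_into_f)
  have SB0: "left_module R (S\<lparr>carrier := B0\<rparr>)" by (rule S.submodule_left_module[OF B0])
  define BB where "BB = transport name lc (S\<lparr>carrier := B0\<rparr>)"
  have BB: "left_module R BB" "restrict name B0 \<in> mhom R (S\<lparr>carrier := B0\<rparr>) BB"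
    "restrict lc (carrier BB) \<in> mhom R BB (S\<lparr>carrier := B0\<rparr>)"
    using transport_mhom[OF SB0, of lc name] lc_name by (simp_all add: BB_def)
  have BBc: "carrier BB = name ` B0" by (simp add: BB_def)
  have lcBB: "lc t \<in> B0" if "t \<in> carrier BB" for t using that lc_name by (auto simp: BBc)
  \<comment> \<open>The image of \<open>h\<close> must live in the same list type. A singleton list
    with a dummy coefficient names an element of it, and \<open>snd \<circ> hd\<close> reads the
    element back.\<close>
  define wrap where "wrap x = [(\<zero>\<^bsub>R\<^esub>, x)]" for x :: 'm
  have Mh: "left_module R (M\<lparr>carrier := h ` carrier M\<rparr>)" by (rule M.submodule_left_module[OF hM])
  define CC where "CC = transport wrap (snd \<circ> hd) (M\<lparr>carrier := h ` carrier M\<rparr>)"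
  have CC: "left_module R CC" "restrict wrap (h ` carrier M) \<in> mhom R (M\<lparr>carrier := h ` carrier M\<rparr>) CC"
    "restrict (snd \<circ> hd) (carrier CC) \<in> mhom R CC (M\<lparr>carrier := h ` carrier M\<rparr>)"
    using transport_mhom[OF Mh, of "snd \<circ> hd" wrap] by (simp_all add: CC_def wrap_def)
  have CCc: "carrier CC = wrap ` h ` carrier M" by (simp add: CC_def)
  define \<gamma> where "\<gamma> = (\<lambda>t\<in>carrier BB. wrap (\<beta> (lc t)))"
  have \<gamma>: "\<gamma> \<in> mhom R BB CC"
    unfolding \<gamma>_def
  proof (rule mhom_restrictI[OF BB(1)])
    fix t t' r assume t: "t \<in> carrier BB"
    show "wrap (\<beta> (lc t)) \<in> carrier CC" unfolding CCc using B0D(2)[OF lcBB[OF t]] by (rule imageI)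
    show "wrap (\<beta> (lc (t \<oplus>\<^bsub>BB\<^esub> t'))) = wrap (\<beta> (lc t)) \<oplus>\<^bsub>CC\<^esub> wrap (\<beta> (lc t'))" if "t' \<in> carrier BB"
    proof -
      have "lc (t \<oplus>\<^bsub>BB\<^esub> t') = lc t \<oplus>\<^bsub>S\<^esub> lc t'"
        using submoduleD(4)[OF B0 lcBB[OF t] lcBB[OF that]] lc_name by (simp add: BB_def)
      then show ?thesis using \<beta>d(2) B0D(1) lcBB t that by (simp add: CC_def wrap_def)
    qed
    show "wrap (\<beta> (lc (r \<odot>\<^bsub>BB\<^esub> t))) = r \<odot>\<^bsub>CC\<^esub> wrap (\<beta> (lc t))" if "r \<in> carrier R"
    proof -
      have "lc (r \<odot>\<^bsub>BB\<^esub> t) = r \<odot>\<^bsub>S\<^esub> lc t"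
        using submoduleD(5)[OF B0 that lcBB[OF t]] lc_name by (simp add: BB_def)
      then show ?thesis using \<beta>d(3) B0D(1) lcBB t that by (simp add: CC_def wrap_def)
    qed
  qed
  \<comment> \<open>Projectivity is phrased by short exact sequences, so the kernel of
    \<open>\<gamma>\<close> has to be supplied as the left term.\<close>
  define ker where "ker = mker BB CC \<gamma>"
  have ker: "submodule ker R BB"
  proof -
    interpret C: plain_module R CC using CC(1) by (rule plain_moduleI)
    have "ker = {t \<in> carrier BB. \<gamma> t \<in> {\<zero>\<^bsub>CC\<^esub>}}" by (auto simp: ker_def mker_def)
    then show ?thesis using submodule_vimage[OF BB(1) CC(1) \<gamma> C.submodule_zero] by simp
  qed
  define AA where "AA = BB\<lparr>carrier := ker\<rparr>"
  have AA: "left_module R AA" unfolding AA_def using BB(1) ker by (rule left_module.submodule_left_module)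
  have AAc: "carrier AA \<subseteq> carrier BB" using submoduleD(1)[OF ker] by (simp add: AA_def)
  have incl: "(\<lambda>t\<in>carrier AA. t) \<in> mhom R AA BB"
    by (rule mhom_restrictI[OF AA]) (use AAc in \<open>auto simp: AA_def\<close>)
  have exact: "short_exact R AA BB CC (\<lambda>t\<in>carrier AA. t) \<gamma>"
    unfolding short_exact_def
  proof (intro conjI incl \<gamma>)
    show "inj_on (\<lambda>t\<in>carrier AA. t) (carrier AA)" by (simp add: inj_on_def)
    show "(\<lambda>t\<in>carrier AA. t) ` carrier AA = mker BB CC \<gamma>" by (auto simp: AA_def ker_def)
    show "\<gamma> ` carrier BB = carrier CC"
    proof
      show "\<gamma> ` carrier BB \<subseteq> carrier CC" using mhomD(1)[OF \<gamma>] by blast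
      show "carrier CC \<subseteq> \<gamma> ` carrier BB"
      proof
        fix c assume "c \<in> carrier CC"
        then obtain x where x: "x \<in> carrier M" "c = wrap (h x)" unfolding CCc by blast
        have "name (b x) \<in> carrier BB" unfolding BBc using bB0[OF x(1)] by blast
        moreover have "\<gamma> (name (b x)) = c"
          using calculation lc_name[OF bB0[OF x(1)]] b(2) x by (simp add: \<gamma>_def)
        ultimately show "c \<in> \<gamma> ` carrier BB" by blast
      qed
    qed
  qed
  \<comment> \<open>An index of \<open>J\<close> is coded by a generator \<open>X i\<close> whose
    preimage is nonzero there, together with a number that identifies the index within the finite
    support of this preimage.\<close>
  have "\<exists>X. X \<in> carrier M \<and> b X i \<noteq> \<zero>\<^bsub>M\<^esub>" if "i \<in> J" for i using that by (auto simp: J_def)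
  then obtain X where X: "\<And>i. i \<in> J \<Longrightarrow> X i \<in> carrier M" "\<And>i. i \<in> J \<Longrightarrow> b (X i) i \<noteq> \<zero>\<^bsub>M\<^esub>" by metis
  have "\<exists>E::'i \<Rightarrow> nat. inj_on E {i \<in> I. b x i \<noteq> \<zero>\<^bsub>M\<^esub>}" if "x \<in> carrier M" for x
  proof -
    have "finite {i \<in> I. b x i \<noteq> \<zero>\<^bsub>M\<^esub>}" using bS[OF that] by (simp add: S_def direct_sum_carrier_iff)
    from finite_imp_inj_to_nat_seg[OF this] show ?thesis by blast
  qed
  then obtain E :: "'m \<Rightarrow> 'i \<Rightarrow> nat" where
    E: "\<And>x. x \<in> carrier M \<Longrightarrow> inj_on (E x) {i \<in> I. b x i \<noteq> \<zero>\<^bsub>M\<^esub>}" by metis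
  have e: "inj_on (\<lambda>i. (wrap (X i), E (X i) i)) J"
  proof (rule inj_onI)
    fix i i' assume i: "i \<in> J" "i' \<in> J" "(wrap (X i), E (X i) i) = (wrap (X i'), E (X i') i')"
    then have eq: "X i' = X i" "E (X i) i = E (X i) i'" by (auto simp: wrap_def)
    have "i \<in> {k \<in> I. b (X i) k \<noteq> \<zero>\<^bsub>M\<^esub>}" "i' \<in> {k \<in> I. b (X i) k \<noteq> \<zero>\<^bsub>M\<^esub>}"
      using X(2)[OF i(1)] X(2)[OF i(2)] i eq by (auto simp: J_def)
    then show "i = i'" using E[OF X(1)[OF i(1)]] eq(2) by (meson inj_onD)
  qed
  have lc_emb: "restrict lc (carrier BB) \<in> mhom R BB (direct_sum I (\<lambda>_. M))"
    using BB(3) unfolding mhom_restrict_iff[OF submoduleD(1)[OF B0]] by (simp add: S_def)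
  have lc_inj: "inj_on lc (carrier BB)"
    unfolding BBc by (rule inj_onI) (auto simp: lc_name)
  have sB: "subgenerated R M BB"
    by (rule subgenerated_embedding[OF M BB(1) lc_emb _ _ _ e])
       (use lc_inj B0D(3) lcBB in \<open>auto simp: inj_on_def J_def\<close>)
  have sA: "subgenerated R M AA"
    by (rule subgenerated_embedding[OF M AA mhom_compose[OF AA incl lc_emb] _ _ _ e])
       (use lc_inj B0D(3) lcBB AAc in \<open>auto simp: inj_on_def J_def compose_def subset_iff\<close>)
  \<comment> \<open>A direct sum with one summand is enough, since \<open>CC\<close> is a copy of a
    submodule of \<open>M\<close>.\<close>
  have sC: "subgenerated R M CC"
  proof (rule subgenerated_embedding[OF M CC(1), of _ "{()}" "{()}" "\<lambda>_. ([], 0)"])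
    show "(\<lambda>t\<in>carrier CC. \<lambda>_\<in>{()}. snd (hd t)) \<in> mhom R CC (direct_sum {()} (\<lambda>_. M))"
      using hd(1) submoduleD(4,5)[OF hM]
      by (intro mhom_restrictI[OF CC(1)])
         (auto simp: CCc wrap_def direct_sum_carrier_iff CC_def fun_eq_iff)
    show "inj_on (\<lambda>t\<in>carrier CC. \<lambda>_\<in>{()}. snd (hd t)) (carrier CC)"
      by (auto simp: inj_on_def CCc wrap_def fun_eq_iff)
  qed auto
  \<comment> \<open>Exactness of the Hom functor at its right end gives \<open>v\<close> whose
    composite with \<open>\<gamma>\<close> is the renamed \<open>h\<close>; following
    \<open>v\<close> by \<open>lc\<close> yields the lift.\<close>
  have "compose (carrier M) \<gamma> ` mhom R M BB = mhom R M CC"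
    using proj sA sB sC exact unfolding projective_in_sigma_def by blast
  moreover have "(\<lambda>x\<in>carrier M. wrap (h x)) \<in> mhom R M CC"
    using hd by (intro mhom_restrictI[OF M]) (auto simp: CCc, auto simp: CC_def wrap_def)
  ultimately have "(\<lambda>x\<in>carrier M. wrap (h x)) \<in> compose (carrier M) \<gamma> ` mhom R M BB" by simp
  then obtain v where v: "v \<in> mhom R M BB" "compose (carrier M) \<gamma> v = (\<lambda>x\<in>carrier M. wrap (h x))"
    by (auto elim!: imageE dest: sym)
  have vx: "v x \<in> carrier BB" "\<beta> (lc (v x)) = h x" if x: "x \<in> carrier M" for x
  proof -
    show vB: "v x \<in> carrier BB" using mhomD(1)[OF v(1) x] .
    have "compose (carrier M) \<gamma> v x = wrap (h x)" using v(2) x by simp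
    then show "\<beta> (lc (v x)) = h x" using x vB by (simp add: compose_def \<gamma>_def wrap_def)
  qed
  show ?thesis
  proof (rule that[OF mhom_compose[OF M v(1) lc_emb]])
    show "compose (carrier M) (restrict lc (carrier BB)) v x \<in> B"
      "\<beta> (compose (carrier M) (restrict lc (carrier BB)) v x) = h x" if "x \<in> carrier M" for x
      using vx[OF that] that B0D(1)[OF lcBB] by (auto simp: compose_def)
  qed
qed

section \<open>Maps into sums of submodules\<close>

context plain_module
begin

lemma finsum_in_submodule:
  assumes "submodule T R M" "finite F" "\<And>i. i \<in> F \<Longrightarrow> f i \<in> T"
  shows "finsum M f F \<in> T"
  using assms(2,3)
proof (induction F)
  case (insert i F)
  then show ?case using submoduleD[OF assms(1)] by (simp add: Pi_def)
qed (use submoduleD[OF assms(1)] in simp)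

lemma finsum_smult:
  assumes "r \<in> carrier R" "finite F" "f \<in> F \<rightarrow> carrier M"
  shows "r \<odot>\<^bsub>M\<^esub> finsum M f F = finsum M (\<lambda>i. r \<odot>\<^bsub>M\<^esub> f i) F"
  using assms(2,3)
proof (induction F)
  case (insert i F)
  then show ?case using assms(1) by (simp add: Pi_def smult_r_distr)
qed (use assms(1) in simp)

text \<open>A map into the sum of the \<^term>\<open>g i ` L i\<close> factors through the direct sum of the
  \<^term>\<open>L i\<close>, hence is controlled by the maps into the individual \<^term>\<open>L i\<close>.\<close>

lemma projective_into_sum:
  fixes I :: "'i set" and g :: "'i \<Rightarrow> 'm \<Rightarrow> 'm"
  assumes proj: "projective_in_sigma R M"
    and L: "\<And>i. i \<in> I \<Longrightarrow> submodule (L i) R M"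
    and g: "\<And>i. i \<in> I \<Longrightarrow> g i \<in> mhom R M M"
    and T: "submodule T R M" and N: "N \<subseteq> carrier M"
    and h: "h \<in> mhom R M M" "h ` carrier M \<subseteq> submodule_sum R M ((\<lambda>i. g i ` L i) ` I)"
    and into: "\<And>i u x. i \<in> I \<Longrightarrow> u \<in> mhom R M M \<Longrightarrow> u ` carrier M \<subseteq> L i \<Longrightarrow> x \<in> N \<Longrightarrow> g i (u x) \<in> T"
  shows "h ` N \<subseteq> T"
proof -
  define S where "S = direct_sum I (\<lambda>_. M)"
  have M: "left_module R M" by (rule left_module_axioms)
  interpret S: plain_module R S
    unfolding S_def by (intro plain_moduleI direct_sum_left_module R.ring_axioms M)
  have Sc: "y i \<in> carrier M" "finite {i \<in> I. y i \<noteq> \<zero>\<^bsub>M\<^esub>}" if "y \<in> carrier S" "i \<in> I" for y i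
    using that by (auto simp: S_def direct_sum_carrier_iff)
  have Sf: "finite {i \<in> I. y i \<noteq> \<zero>\<^bsub>M\<^esub>}" if "y \<in> carrier S" for y
    using that by (auto simp: S_def direct_sum_carrier_iff)
  note Ld = submoduleD[OF L] and gd = mhomD[OF g] and g0 = mhom_zero[OF M M g]
  define B where "B = {y \<in> carrier S. \<forall>i\<in>I. y i \<in> L i}"
  have B: "submodule B R S"
    by (rule S.submodule_intro) (use Ld S.M.a_closed S.smult_closed in \<open>auto simp: B_def, auto simp: S_def\<close>)
  \<comment> \<open>The index set may be infinite (later it is the set of all endomorphisms), so the
    sum runs over the support. \<open>\<beta>_eq\<close> permits any larger finite set, which is
    needed to add elements with different supports.\<close>
  define \<beta> where "\<beta> y = finsum M (\<lambda>i. g i (y i)) {i \<in> I. y i \<noteq> \<zero>\<^bsub>M\<^esub>}" for y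
  have \<beta>_eq: "\<beta> y = finsum M (\<lambda>i. g i (y i)) F"
    if "y \<in> carrier S" "finite F" "F \<subseteq> I" "{i \<in> I. y i \<noteq> \<zero>\<^bsub>M\<^esub>} \<subseteq> F" for y F
    unfolding \<beta>_def
    by (rule M.add.finprod_mono_neutral_cong_left) (use that g0 gd(1) Sc(1) in auto)
  have \<beta>: "restrict \<beta> B \<in> mhom R (S\<lparr>carrier := B\<rparr>) M"
  proof -
    have "restrict \<beta> (carrier (S\<lparr>carrier := B\<rparr>)) \<in> mhom R (S\<lparr>carrier := B\<rparr>) M"
    proof (rule mhom_restrictI[OF S.submodule_left_module[OF B]])
      fix y assume "y \<in> carrier (S\<lparr>carrier := B\<rparr>)"
      then have y: "y \<in> carrier S" by (simp add: B_def)
      show "\<beta> y \<in> carrier M" unfolding \<beta>_def using Sc[OF y] gd(1) by (auto intro!: M.finsum_closed)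
      show "\<beta> (y \<oplus>\<^bsub>S\<lparr>carrier := B\<rparr>\<^esub> z) = \<beta> y \<oplus>\<^bsub>M\<^esub> \<beta> z" if "z \<in> carrier (S\<lparr>carrier := B\<rparr>)" for z
      proof -
        have z: "z \<in> carrier S" using that by (simp add: B_def)
        let ?F = "{i \<in> I. y i \<noteq> \<zero>\<^bsub>M\<^esub>} \<union> {i \<in> I. z i \<noteq> \<zero>\<^bsub>M\<^esub>}"
        have F: "finite ?F" using Sf[OF y] Sf[OF z] by simp
        have "\<beta> (y \<oplus>\<^bsub>S\<^esub> z) = finsum M (\<lambda>i. g i ((y \<oplus>\<^bsub>S\<^esub> z) i)) ?F"
          by (rule \<beta>_eq) (use y z F in \<open>auto simp: S_def[symmetric] simp del: direct_sum_simps\<close>,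
            auto simp: S_def)
        also have "\<dots> = finsum M (\<lambda>i. g i (y i) \<oplus>\<^bsub>M\<^esub> g i (z i)) ?F"
          by (rule M.finsum_cong') (use gd Sc(1)[OF y] Sc(1)[OF z] in \<open>auto simp: S_def\<close>)
        also have "\<dots> = finsum M (\<lambda>i. g i (y i)) ?F \<oplus>\<^bsub>M\<^esub> finsum M (\<lambda>i. g i (z i)) ?F"
          by (rule M.finsum_addf) (use gd(1) Sc(1)[OF y] Sc(1)[OF z] in auto)
        also have "\<dots> = \<beta> y \<oplus>\<^bsub>M\<^esub> \<beta> z"
          using \<beta>_eq[OF y F] \<beta>_eq[OF z F] by auto
        finally show ?thesis by simp
      qed
      show "\<beta> (r \<odot>\<^bsub>S\<lparr>carrier := B\<rparr>\<^esub> y) = r \<odot>\<^bsub>M\<^esub> \<beta> y" if r: "r \<in> carrier R" for r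
      proof -
        let ?F = "{i \<in> I. y i \<noteq> \<zero>\<^bsub>M\<^esub>}"
        have "\<beta> (r \<odot>\<^bsub>S\<^esub> y) = finsum M (\<lambda>i. g i ((r \<odot>\<^bsub>S\<^esub> y) i)) ?F"
          by (rule \<beta>_eq) (use y r Sf[OF y] S.smult_closed in \<open>auto simp: S_def\<close>)
        also have "\<dots> = finsum M (\<lambda>i. r \<odot>\<^bsub>M\<^esub> g i (y i)) ?F"
          by (rule M.finsum_cong') (use gd Sc(1)[OF y] r in \<open>auto simp: S_def\<close>)
        also have "\<dots> = r \<odot>\<^bsub>M\<^esub> \<beta> y"
          unfolding \<beta>_def by (rule finsum_smult[symmetric]) (use r Sf[OF y] gd(1) Sc(1)[OF y] in auto)
        finally show ?thesis by simp
      qed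
    qed
    then show ?thesis by simp
  qed
  have "submodule (restrict \<beta> B ` carrier (S\<lparr>carrier := B\<rparr>)) R M"
    by (rule submodule_image[OF S.submodule_left_module[OF B] M \<beta>])
       (intro left_module.submodule_carrier S.submodule_left_module[OF B])
  then have \<beta>B: "submodule (\<beta> ` B) R M" by simp
  have "g i x \<in> \<beta> ` B" if ix: "i \<in> I" "x \<in> L i" for i x
  proof -
    let ?s = "ds_single I (\<lambda>_. M) i x"
    have sS: "?s \<in> carrier S"
      using mhomD(1)[OF ds_single_mhom[of I R "\<lambda>_. M" i], of x] M ix Ld(2)[OF ix] by (simp add: S_def)
    moreover have "?s k \<in> L k" if "k \<in> I" for k using that ix Ld(3) by (simp add: ds_single_def)
    ultimately have "?s \<in> B" by (simp add: B_def)
    moreover have "\<beta> ?s = finsum M (\<lambda>k. g k (?s k)) {i}"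
      by (rule \<beta>_eq) (use sS ix in \<open>auto simp: ds_single_def split: if_splits\<close>)
    then have "\<beta> ?s = g i x" using ix gd(1) Ld(2) by (simp add: ds_single_def)
    ultimately show ?thesis by (metis imageI)
  qed
  then have "submodule_sum R M ((\<lambda>i. g i ` L i) ` I) \<subseteq> \<beta> ` B"
    by (intro submodule_sum_least[OF \<beta>B]) auto
  then have "h ` carrier M \<subseteq> restrict \<beta> B ` B" using h(2) by auto
  then obtain u where u: "u \<in> mhom R M S" "\<And>x. x \<in> carrier M \<Longrightarrow> u x \<in> B"
    "\<And>x. x \<in> carrier M \<Longrightarrow> restrict \<beta> B (u x) = h x"
    using projective_lift[OF M proj B[unfolded S_def] \<beta>[unfolded S_def] h(1)] unfolding S_def by metis
  show ?thesis
  proof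
    fix z assume "z \<in> h ` N"
    then obtain x where x: "x \<in> N" "z = h x" by blast
    have xM: "x \<in> carrier M" using x N by blast
    have "g i (u x i) \<in> T" if i: "i \<in> I" for i
    proof -
      \<comment> \<open>A coordinate of the lift is an endomorphism with image in
        \<open>L i\<close>, the case that \<open>into\<close> settles. Finite sums of such values
        stay in \<open>T\<close>.\<close>
      have "(\<lambda>x\<in>carrier M. u x i) \<in> mhom R M M"
        using mhomD[OF u(1)] i Sc(1) by (intro mhom_restrictI[OF M]) (auto simp: S_def)
      moreover have "(\<lambda>x\<in>carrier M. u x i) ` carrier M \<subseteq> L i" using u(2) i by (auto simp: B_def)
      ultimately show ?thesis using into[OF i, of "\<lambda>x\<in>carrier M. u x i" x] x xM by simp
    qed
    then have "\<beta> (u x) \<in> T"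
      unfolding \<beta>_def using Sf u(2)[OF xM] by (intro finsum_in_submodule[OF T]) (auto simp: B_def)
    then show "z \<in> T" using u(2,3)[OF xM] x by simp
  qed
qed

end

section \<open>Prime submodules\<close>

context plain_module
begin

lemma fully_invariantD:
  assumes "fully_invariant R M N"
  shows "submodule N R M" and "f \<in> mhom R M M \<Longrightarrow> x \<in> N \<Longrightarrow> f x \<in> N"
  using assms by (auto simp: fully_invariant_def)

lemma fully_invariant_zero: "fully_invariant R M {\<zero>\<^bsub>M\<^esub>}"
  using mhom_zero[OF left_module_axioms left_module_axioms] submodule_zero
  by (auto simp: fully_invariant_def)

lemma fully_invariant_Inter:
  assumes "\<And>N. N \<in> \<N> \<Longrightarrow> fully_invariant R M N"
  shows "fully_invariant R M (carrier M \<inter> \<Inter>\<N>)"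
  unfolding fully_invariant_def
proof (intro conjI ballI)
  have "submodule (\<Inter>(insert (carrier M) \<N>)) R M"
    using fully_invariantD(1)[OF assms] submodule_carrier by (intro submodule_Inter) auto
  then show "submodule (carrier M \<inter> \<Inter>\<N>) R M" by simp
  show "f ` (carrier M \<inter> \<Inter>\<N>) \<subseteq> carrier M \<inter> \<Inter>\<N>" if "f \<in> mhom R M M" for f
    using that fully_invariantD(2)[OF assms] mhomD(1)[OF that] by blast
qed

lemma fully_invariant_set_add:
  assumes "fully_invariant R M N" "fully_invariant R M K"
  shows "fully_invariant R M {x \<oplus>\<^bsub>M\<^esub> y |x y. x \<in> N \<and> y \<in> K}"
  unfolding fully_invariant_def
proof (intro conjI ballI subsetI)
  note N = fully_invariantD[OF assms(1)] and K = fully_invariantD[OF assms(2)]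
  show "submodule {x \<oplus>\<^bsub>M\<^esub> y |x y. x \<in> N \<and> y \<in> K} R M" using submodule_set_add N(1) K(1) .
  fix f z assume f: "f \<in> mhom R M M" and "z \<in> f ` {x \<oplus>\<^bsub>M\<^esub> y |x y. x \<in> N \<and> y \<in> K}"
  then obtain x y where xy: "x \<in> N" "y \<in> K" "z = f (x \<oplus>\<^bsub>M\<^esub> y)" by blast
  then have "z = f x \<oplus>\<^bsub>M\<^esub> f y"
    using mhomD(2)[OF f] submoduleD(2)[OF N(1)] submoduleD(2)[OF K(1)] by simp
  then show "z \<in> {x \<oplus>\<^bsub>M\<^esub> y |x y. x \<in> N \<and> y \<in> K}" using xy N(2)[OF f] K(2)[OF f] by blast
qed

text \<open>The fully invariant submodule generated by \<open>L\<close>. Writing it as a sum of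
  endomorphic images gives the shape that \<open>projective_into_sum\<close> handles.\<close>

definition fi_closure :: "'m set \<Rightarrow> 'm set"
  where "fi_closure L = submodule_sum R M ((\<lambda>g. g ` L) ` mhom R M M)"

lemma fi_closure:
  assumes "L \<subseteq> carrier M"
  shows "fully_invariant R M (fi_closure L)" and "L \<subseteq> fi_closure L"
proof -
  have M: "left_module R M" by (rule left_module_axioms)
  have img: "\<Union>((\<lambda>g. g ` L) ` mhom R M M) \<subseteq> carrier M"
  proof clarify
    fix g x assume "g \<in> mhom R M M" "x \<in> L"
    then show "g x \<in> carrier M" using mhomD(1)[of g R M M x] assms by blast
  qed
  have sub: "submodule (fi_closure L) R M"
    unfolding fi_closure_def using img by (rule submodule_submodule_sum)
  have gL: "g x \<in> fi_closure L" if "g \<in> mhom R M M" "x \<in> L" for g x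
    using submodule_sum_upper[of "g ` L" "(\<lambda>g. g ` L) ` mhom R M M"] that
    unfolding fi_closure_def by blast
  have "f ` fi_closure L \<subseteq> fi_closure L" if f: "f \<in> mhom R M M" for f
  proof -
    have "fi_closure L \<subseteq> {x \<in> carrier M. f x \<in> fi_closure L}"
      unfolding fi_closure_def
    proof (rule submodule_sum_least, fold fi_closure_def)
      show "submodule {x \<in> carrier M. f x \<in> fi_closure L} R M"
        by (rule submodule_vimage[OF M M f sub])
      fix H assume "H \<in> (\<lambda>g. g ` L) ` mhom R M M"
      then obtain g where g: "g \<in> mhom R M M" "H = g ` L" by blast
      have "f (g x) \<in> fi_closure L" if "x \<in> L" for x
      proof -
        have "compose (carrier M) f g x \<in> fi_closure L" by (rule gL[OF mhom_compose[OF M g(1) f] that])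
        then show ?thesis using that assms by (simp add: compose_def subset_iff)
      qed
      then show "H \<subseteq> {x \<in> carrier M. f x \<in> fi_closure L}" using g mhomD(1)[OF g(1)] assms by blast
    qed
    then show ?thesis by blast
  qed
  then show "fully_invariant R M (fi_closure L)" using sub by (simp add: fully_invariant_def)
  have "(\<lambda>x\<in>carrier M. x) \<in> mhom R M M" by (rule mhom_restrictI[OF M]) auto
  from gL[OF this] show "L \<subseteq> fi_closure L" using assms by (auto simp: subset_iff)
qed

lemma fi_closure_least:
  assumes "fully_invariant R M K" "L \<subseteq> K" shows "fi_closure L \<subseteq> K"
  unfolding fi_closure_def using assms fully_invariantD[OF assms(1)]
  by (intro submodule_sum_least) blast+

text \<open>Homomorphisms into the submodule \<open>K\<close> are the endomorphisms with image in
  \<open>K\<close>, and a sum lies in \<open>T\<close> once its summands do. Bounds on products are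
  obtained through this test.\<close>

lemma submodule_prod_subset_iff:
  assumes "submodule K R M" "submodule T R M"
  shows "submodule_prod R M N K \<subseteq> T \<longleftrightarrow>
    (\<forall>f\<in>mhom R M M. f ` carrier M \<subseteq> K \<longrightarrow> f ` N \<subseteq> T)"
proof -
  have "submodule_prod R M N K \<subseteq> T \<longleftrightarrow> (\<forall>f\<in>mhom R M (M\<lparr>carrier := K\<rparr>). f ` N \<subseteq> T)"
    unfolding submodule_prod_def
    using submodule_sum_upper[of _ "{f ` N |f. f \<in> mhom R M (M\<lparr>carrier := K\<rparr>)}"]
      submodule_sum_least[OF assms(2), of "{f ` N |f. f \<in> mhom R M (M\<lparr>carrier := K\<rparr>)}"]
    by blast
  then show ?thesis
    unfolding Ball_def mhom_restrict_iff[OF submoduleD(1)[OF assms(1)]] by (simp add: imp_conjL)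
qed

lemma prime_inD:
  assumes "prime_in R M P"
  shows "fully_invariant R M P" and "submodule P R M" and "P \<noteq> carrier M"
    and "fully_invariant R M N \<Longrightarrow> fully_invariant R M K \<Longrightarrow>
      (\<And>f x. f \<in> mhom R M M \<Longrightarrow> f ` carrier M \<subseteq> K \<Longrightarrow> x \<in> N \<Longrightarrow> f x \<in> P) \<Longrightarrow> N \<subseteq> P \<or> K \<subseteq> P"
proof -
  show 1: "fully_invariant R M P" and "P \<noteq> carrier M" using assms by (auto simp: prime_in_def)
  then show 2: "submodule P R M" using fully_invariantD(1) by blast
  assume N: "fully_invariant R M N" and K: "fully_invariant R M K"
    and *: "\<And>f x. f \<in> mhom R M M \<Longrightarrow> f ` carrier M \<subseteq> K \<Longrightarrow> x \<in> N \<Longrightarrow> f x \<in> P"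
  have "submodule_prod R M N K \<subseteq> P"
    unfolding submodule_prod_subset_iff[OF fully_invariantD(1)[OF K] 2] using * by blast
  then show "N \<subseteq> P \<or> K \<subseteq> P" using assms N K unfolding prime_in_def by blast
qed

lemma prime_inI:
  assumes P: "fully_invariant R M P" "P \<noteq> carrier M"
    and prime: "\<And>N K. fully_invariant R M N \<Longrightarrow> fully_invariant R M K \<Longrightarrow>
      (\<And>f x. f \<in> mhom R M M \<Longrightarrow> f ` carrier M \<subseteq> K \<Longrightarrow> x \<in> N \<Longrightarrow> f x \<in> P) \<Longrightarrow> \<not> N \<subseteq> P \<Longrightarrow> K \<subseteq> P"
  shows "prime_in R M P"
  unfolding prime_in_def
proof (intro conjI allI impI P)
  fix N K assume *: "fully_invariant R M N \<and> fully_invariant R M K \<and> submodule_prod R M N K \<subseteq> P"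
  then have "\<And>f x. f \<in> mhom R M M \<Longrightarrow> f ` carrier M \<subseteq> K \<Longrightarrow> x \<in> N \<Longrightarrow> f x \<in> P"
    using submodule_prod_subset_iff[OF fully_invariantD(1) fully_invariantD(1)[OF P(1)]] by blast
  then show "N \<subseteq> P \<or> K \<subseteq> P" using prime[of N K] * by blast
qed

text \<open>The product of two fully invariant submodules lies in both of them, hence in their
  intersection; so primeness splits off one member at a time.\<close>

lemma prime_in_Inter:
  assumes P: "prime_in R M P" and "finite \<N>" "\<And>N. N \<in> \<N> \<Longrightarrow> fully_invariant R M N"
    and "carrier M \<inter> \<Inter>\<N> \<subseteq> P"
  shows "\<exists>N\<in>\<N>. N \<subseteq> P"
  using assms(2-)
proof (induction \<N>)
  case empty
  then show ?case using prime_inD(3)[OF P] submoduleD(1)[OF prime_inD(2)[OF P]] by auto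
next
  case (insert N \<N>)
  let ?K = "carrier M \<inter> \<Inter>\<N>"
  have N: "fully_invariant R M N" and K: "fully_invariant R M ?K"
    using insert.prems(1) by (auto intro: fully_invariant_Inter)
  have "f x \<in> P" if "f \<in> mhom R M M" "f ` carrier M \<subseteq> ?K" "x \<in> N" for f x
  proof -
    have "x \<in> carrier M" using that(3) submoduleD(2)[OF fully_invariantD(1)[OF N]] by blast
    then have "f x \<in> N" "f x \<in> ?K" using fully_invariantD(2)[OF N that(1,3)] that(2) by blast+
    then show ?thesis using insert.prems(2) by blast
  qed
  then have "N \<subseteq> P \<or> ?K \<subseteq> P" by (rule prime_inD(4)[OF P N K])
  then show ?case using insert.IH insert.prems(1) by blast
qed

text \<open>Suppose that \<open>N\<close> escapes some \<open>Q1\<close> in the chain. For every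
  \<open>Q\<close>, the smaller of \<open>Q\<close> and \<open>Q1\<close> does not contain
  \<open>N\<close> either, so it contains \<open>K\<close>.\<close>

lemma prime_in_chain_Inter:
  assumes ne: "\<Q> \<noteq> {}" and pr: "\<And>Q. Q \<in> \<Q> \<Longrightarrow> prime_in R M Q"
    and chain: "\<And>Q Q'. Q \<in> \<Q> \<Longrightarrow> Q' \<in> \<Q> \<Longrightarrow> Q \<subseteq> Q' \<or> Q' \<subseteq> Q"
  shows "prime_in R M (\<Inter>\<Q>)"
proof (rule prime_inI)
  obtain Q0 where Q0: "Q0 \<in> \<Q>" using ne by blast
  have sub: "\<And>Q. Q \<in> \<Q> \<Longrightarrow> Q \<subseteq> carrier M" using submoduleD(1)[OF prime_inD(2)[OF pr]] .
  have "carrier M \<inter> \<Inter>\<Q> = \<Inter>\<Q>" using sub Q0 by blast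
  then show "fully_invariant R M (\<Inter>\<Q>)"
    using fully_invariant_Inter[of \<Q>] prime_inD(1)[OF pr] by simp
  show "\<Inter>\<Q> \<noteq> carrier M" using prime_inD(3)[OF pr[OF Q0]] sub[OF Q0] Q0 by blast
  fix N K assume NK: "fully_invariant R M N" "fully_invariant R M K"
    and *: "\<And>f x. f \<in> mhom R M M \<Longrightarrow> f ` carrier M \<subseteq> K \<Longrightarrow> x \<in> N \<Longrightarrow> f x \<in> \<Inter>\<Q>"
    and "\<not> N \<subseteq> \<Inter>\<Q>"
  then obtain Q1 where Q1: "Q1 \<in> \<Q>" "\<not> N \<subseteq> Q1" by blast
  have "K \<subseteq> Q" if Q: "Q \<in> \<Q>" for Q
  proof -
    obtain Q' where Q': "Q' \<in> \<Q>" "Q' \<subseteq> Q" "Q' \<subseteq> Q1" using chain[OF Q Q1(1)] Q Q1(1) by blast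
    have "N \<subseteq> Q' \<or> K \<subseteq> Q'" using * Q'(1) by (intro prime_inD(4)[OF pr[OF Q'(1)] NK]) blast
    then show ?thesis using Q' Q1(2) by blast
  qed
  then show "K \<subseteq> \<Inter>\<Q>" by blast
qed

lemma minimal_prime_below:
  assumes P: "prime_in R M P"
  obtains Q where "Q \<in> minimal_primes R M" "Q \<subseteq> P"
proof -
  \<comment> \<open>Zorn's lemma produces maximal elements; passing to complements makes them
    minimal primes.\<close>
  let ?\<A> = "uminus ` {Q. prime_in R M Q \<and> Q \<subseteq> P}"
  have "\<exists>X\<in>?\<A>. \<forall>Y\<in>?\<A>. X \<subseteq> Y \<longrightarrow> Y = X"
  proof (rule subset_Zorn_nonempty)
    show "?\<A> \<noteq> {}" using P by blast
    fix \<C> assume ne: "\<C> \<noteq> {}" and ch: "subset.chain ?\<A> \<C>"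
    let ?\<Q> = "uminus ` \<C>"
    have mem: "prime_in R M Q \<and> Q \<subseteq> P" if "Q \<in> ?\<Q>" for Q
      using that ch unfolding subset_chain_def by auto
    have "prime_in R M (\<Inter>?\<Q>)"
    proof (rule prime_in_chain_Inter)
      show "Q \<subseteq> Q' \<or> Q' \<subseteq> Q" if QQ: "Q \<in> ?\<Q>" "Q' \<in> ?\<Q>" for Q Q'
      proof -
        obtain X Y where "X \<in> \<C>" "Y \<in> \<C>" "Q = - X" "Q' = - Y" using QQ by blast
        moreover have "X \<subseteq> Y \<or> Y \<subseteq> X" using calculation(1,2) ch unfolding subset_chain_def by blast
        ultimately show ?thesis by blast
      qed
    qed (use ne mem in auto)
    moreover have "\<Inter>?\<Q> \<subseteq> P" using ne mem by blast
    moreover have "\<Union>\<C> = - \<Inter>?\<Q>" by auto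
    ultimately show "\<Union>\<C> \<in> ?\<A>" by blast
  qed
  then obtain Q where Q: "prime_in R M Q" "Q \<subseteq> P"
    "\<And>Q'. prime_in R M Q' \<Longrightarrow> Q' \<subseteq> P \<Longrightarrow> - Q \<subseteq> - Q' \<Longrightarrow> - Q' = - Q"
    by auto
  have "Q' = Q" if "prime_in R M Q'" "Q' \<subseteq> Q" for Q'
    using Q(3)[OF that(1)] that(2) Q(2) by auto
  then have "Q \<in> minimal_primes R M" using Q(1) by (auto simp: minimal_primes_def)
  then show thesis using that Q(2) by blast
qed

text \<open>The analogue of the m-sequence argument for semiprime rings: a fully invariant
  submodule maximal among those avoiding the sequence below is prime.\<close>

lemma semiprime_avoiding_prime:
  assumes proj: "projective_in_sigma R M" and semi: "semiprime_module R M"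
    and x: "x \<in> carrier M" "x \<noteq> \<zero>\<^bsub>M\<^esub>"
  obtains P where "prime_in R M P" "x \<notin> P"
proof -
  let ?c = "\<lambda>a. fi_closure {a}"
  have cl: "fully_invariant R M (?c a)" "a \<in> ?c a" "submodule (?c a) R M" if "a \<in> carrier M" for a
    using fi_closure[of "{a}"] that fully_invariantD(1) by auto
  have prod_sub: "submodule (submodule_prod R M (?c a) (?c a)) R M"
    "submodule_prod R M (?c a) (?c a) \<subseteq> ?c a" if a: "a \<in> carrier M" for a
  proof -
    show "submodule_prod R M (?c a) (?c a) \<subseteq> ?c a"
      unfolding submodule_prod_subset_iff[OF cl(3)[OF a] cl(3)[OF a]]
      using submoduleD(1)[OF cl(3)[OF a]] by blast
    show "submodule (submodule_prod R M (?c a) (?c a)) R M"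
      unfolding submodule_prod_def
      by (rule submodule_submodule_sum)
         (use submoduleD(2)[OF cl(3)[OF a]] mhomD(1) in fastforce)
  qed
  \<comment> \<open>Semiprimeness enters here: the fully invariant closure of a nonzero element has
    a nonzero product with itself.\<close>
  have step: "\<exists>a'. a' \<in> carrier M \<and> a' \<noteq> \<zero>\<^bsub>M\<^esub> \<and> a' \<in> submodule_prod R M (?c a) (?c a)"
    if a: "a \<in> carrier M" "a \<noteq> \<zero>\<^bsub>M\<^esub>" for a
  proof -
    have "submodule_prod R M (?c a) (?c a) \<noteq> {\<zero>\<^bsub>M\<^esub>}"
      using semi cl[OF a(1)] a(2) unfolding semiprime_module_def by blast
    then show ?thesis using submoduleD(1,3)[OF prod_sub(1)[OF a(1)]] by blast
  qed
  have "\<exists>s. \<forall>n. (s n \<in> carrier M \<and> s n \<noteq> \<zero>\<^bsub>M\<^esub> \<and> (n = 0 \<longrightarrow> s n = x)) \<and>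
      s (Suc n) \<in> submodule_prod R M (?c (s n)) (?c (s n))"
    by (rule dependent_nat_choice) (use x step in auto)
  then obtain s :: "nat \<Rightarrow> 'm" where s: "\<And>n. s n \<in> carrier M" "\<And>n. s n \<noteq> \<zero>\<^bsub>M\<^esub>" "s 0 = x"
    "\<And>n. s (Suc n) \<in> submodule_prod R M (?c (s n)) (?c (s n))"
    by metis
  \<comment> \<open>Each term lies in the closure of its predecessor, so a fully invariant submodule
    that is hit once contains the whole tail. Two submodules that are hit therefore share a
    term.\<close>
  have later: "s m \<in> K" if K: "fully_invariant R M K" and n: "s n \<in> K" and "n \<le> m" for K n m
    using \<open>n \<le> m\<close>
  proof (induction m rule: dec_induct)
    case (step m)
    then show ?case
      using s(4)[of m] prod_sub(2)[OF s(1)[of m]] fi_closure_least[OF K, of "{s m}"] by blast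
  qed (rule n)
  let ?\<A> = "{K. fully_invariant R M K \<and> (\<forall>n. s n \<notin> K)}"
  have "\<exists>P\<in>?\<A>. \<forall>K\<in>?\<A>. P \<subseteq> K \<longrightarrow> K = P"
  proof (rule subset_Zorn_nonempty)
    show "?\<A> \<noteq> {}" using fully_invariant_zero s(2) by blast
    fix \<C> assume ne: "\<C> \<noteq> {}" and ch: "subset.chain ?\<A> \<C>"
    have fi: "fully_invariant R M K" "\<forall>n. s n \<notin> K" if "K \<in> \<C>" for K
      using that ch unfolding subset_chain_def by auto
    note sub = submoduleD[OF fully_invariantD(1)[OF fi(1)]]
    have "submodule (\<Union>\<C>) R M"
    proof (rule submodule_intro)
      show "y \<oplus>\<^bsub>M\<^esub> z \<in> \<Union>\<C>" if yz: "y \<in> \<Union>\<C>" "z \<in> \<Union>\<C>" for y z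
      proof -
        obtain K where "K \<in> \<C>" "y \<in> K" "z \<in> K"
          using yz ch unfolding subset_chain_def by blast
        then show ?thesis using sub(4) by blast
      qed
    qed (use ne sub(1,3,5) in blast)+
    moreover have "f ` \<Union>\<C> \<subseteq> \<Union>\<C>" if "f \<in> mhom R M M" for f
      using fully_invariantD(2)[OF fi(1) that] by blast
    ultimately show "\<Union>\<C> \<in> ?\<A>" using fi(2) by (auto simp: fully_invariant_def)
  qed
  then obtain P where P: "fully_invariant R M P" "\<And>n. s n \<notin> P"
    and max: "\<And>K. fully_invariant R M K \<Longrightarrow> (\<And>n. s n \<notin> K) \<Longrightarrow> P \<subseteq> K \<Longrightarrow> K = P" by auto
  note Pd = submoduleD[OF fully_invariantD(1)[OF P(1)]]
  have "prime_in R M P"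
  proof (rule prime_inI[OF P(1)])
    show "P \<noteq> carrier M" using s(1) P(2) by blast
    fix N K assume N: "fully_invariant R M N" and K: "fully_invariant R M K"
      and into: "\<And>f x. f \<in> mhom R M M \<Longrightarrow> f ` carrier M \<subseteq> K \<Longrightarrow> x \<in> N \<Longrightarrow> f x \<in> P"
      and NP: "\<not> N \<subseteq> P"
    let ?plus = "\<lambda>H. {x \<oplus>\<^bsub>M\<^esub> y |x y. x \<in> H \<and> y \<in> P}"
    \<comment> \<open>By maximality of \<open>P\<close>, enlarging it by \<open>H\<close> must reach
      the sequence.\<close>
    have hits: "\<exists>n. s n \<in> ?plus H" if H: "fully_invariant R M H" "\<not> H \<subseteq> P" for H
    proof (rule ccontr)
      note Hd = submoduleD[OF fully_invariantD(1)[OF H(1)]]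
      assume no: "\<nexists>n. s n \<in> ?plus H"
      have "y \<in> ?plus H" if "y \<in> P" for y
        using that Hd(3) Pd(2)[OF that] by (intro CollectI exI[of _ "\<zero>\<^bsub>M\<^esub>"] exI[of _ y]) simp
      then have "P \<subseteq> ?plus H" by blast
      then have "?plus H = P" using max[OF fully_invariant_set_add[OF H(1) P(1)]] no by blast
      moreover have "y \<in> ?plus H" if "y \<in> H" for y
        using that Pd(3) Hd(2)[OF that] by (intro CollectI exI[of _ y] exI[of _ "\<zero>\<^bsub>M\<^esub>"]) simp
      ultimately show False using H(2) by blast
    qed
    show "K \<subseteq> P"
    proof (rule ccontr)
      assume KP: "\<not> K \<subseteq> P"
      obtain n k where nk: "s n \<in> ?plus N" "s k \<in> ?plus K" using hits[OF N NP] hits[OF K KP] by blast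
      define m where "m = max n k"
      have m: "s m \<in> ?plus N" "s m \<in> ?plus K"
        using later[OF fully_invariant_set_add[OF N P(1)] nk(1)]
          later[OF fully_invariant_set_add[OF K P(1)] nk(2)] by (auto simp: m_def)
      have cm: "?c (s m) \<subseteq> ?plus N" "?c (s m) \<subseteq> ?plus K"
        using m fi_closure_least[OF fully_invariant_set_add[OF N P(1)], of "{s m}"]
          fi_closure_least[OF fully_invariant_set_add[OF K P(1)], of "{s m}"] by auto
      note Nd = submoduleD[OF fully_invariantD(1)[OF N]]
      \<comment> \<open>A map into the sum of \<open>K\<close> and \<open>P\<close> is not itself a
        map into \<open>K\<close>. Projectivity, applied to a family of two with identity maps,
        reduces it to maps into \<open>K\<close>, which send \<open>N\<close> into \<open>P\<close>
        by assumption, and maps into \<open>P\<close>, which do so trivially.\<close>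
      let ?L = "\<lambda>b. if b then K else P" and ?g = "\<lambda>_::bool. \<lambda>x\<in>carrier M. x"
      have Ksum: "?plus K \<subseteq> submodule_sum R M ((\<lambda>b. ?g b ` ?L b) ` UNIV)"
      proof -
        let ?\<S> = "(\<lambda>b. ?g b ` ?L b) ` UNIV"
        have K': "submodule K R M" using fully_invariantD(1)[OF K] .
        have img: "?g b ` ?L b = ?L b" for b
          using submoduleD(2)[OF K'] Pd(2) by (force simp: image_iff)
        have sub: "submodule (submodule_sum R M ?\<S>) R M"
          by (rule submodule_submodule_sum) (use img submoduleD(1)[OF K'] Pd(1) in auto)
        have "?L b \<subseteq> submodule_sum R M ?\<S>" for b
          using submodule_sum_upper[of "?g b ` ?L b" ?\<S>] img[of b] by blast
        from this[of True] this[of False]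
        have "K \<subseteq> submodule_sum R M ?\<S>" "P \<subseteq> submodule_sum R M ?\<S>" by simp_all
        then show ?thesis using submoduleD(4)[OF sub] by blast
      qed
      have "f ` ?c (s m) \<subseteq> P" if f: "f \<in> mhom R M M" "f ` carrier M \<subseteq> ?c (s m)" for f
      proof -
        have "f ` N \<subseteq> P"
        proof (rule projective_into_sum[OF proj, where I = UNIV and L = ?L and g = ?g])
          show "f ` carrier M \<subseteq> submodule_sum R M ((\<lambda>b. ?g b ` ?L b) ` UNIV)"
            using f(2) cm(2) Ksum by blast
          show "?g b \<in> mhom R M M" for b by (rule mhom_restrictI[OF left_module_axioms]) auto
          show "?g b (u z) \<in> P" if "u \<in> mhom R M M" "u ` carrier M \<subseteq> ?L b" "z \<in> N" for b u z
            using that into[of u z] Nd(2)[OF that(3)] mhomD(1)[OF that(1)] by (cases b) auto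
        qed (use f(1) fully_invariantD(1)[OF K] fully_invariantD(1)[OF P(1)] Nd(1) in auto)
        moreover have "f y \<in> P" if "y \<in> P" for y using fully_invariantD(2)[OF P(1) f(1) that] .
        ultimately have "f z \<in> P" if "z \<in> ?plus N" for z
          using that mhomD(2)[OF f(1)] Nd(2) Pd(2,4) by (auto simp: image_subset_iff)
        then show ?thesis using cm(1) by blast
      qed
      \<comment> \<open>This product contains the next term of the sequence, which \<open>P\<close>
        avoids.\<close>
      then have "submodule_prod R M (?c (s m)) (?c (s m)) \<subseteq> P"
        unfolding submodule_prod_subset_iff[OF cl(3)[OF s(1)] fully_invariantD(1)[OF P(1)]] by blast
      then show False using s(4)[of m] P(2) by blast
    qed
  qed
  then show thesis using that P(2)[of 0] s(3) by simp
qed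

lemma minimal_primes_Inter:
  assumes "projective_in_sigma R M" "semiprime_module R M" "x \<in> carrier M"
    and "\<And>P. P \<in> minimal_primes R M \<Longrightarrow> x \<in> P"
  shows "x = \<zero>\<^bsub>M\<^esub>"
proof (rule ccontr)
  assume "x \<noteq> \<zero>\<^bsub>M\<^esub>"
  then obtain P where "prime_in R M P" "x \<notin> P" using semiprime_avoiding_prime assms by blast
  then show False using minimal_prime_below assms(4) by blast
qed

text \<open>If \<^term>\<open>N\<close> met the cyclic submodule generated by \<^term>\<open>m\<close> trivially, then every
  map from \<^term>\<open>M\<close> into the fully invariant closure of that submodule would kill \<^term>\<open>N\<close>.\<close>

lemma smult_in_prime_complement:
  assumes proj: "projective_in_sigma R M" and P: "prime_in R M P"
    and N: "fully_invariant R M N" "\<not> N \<subseteq> P" and m: "m \<in> carrier M" "m \<notin> P"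
  obtains r where "r \<in> carrier R" "r \<odot>\<^bsub>M\<^esub> m \<in> N" "r \<odot>\<^bsub>M\<^esub> m \<noteq> \<zero>\<^bsub>M\<^esub>"
proof -
  let ?L = "(\<lambda>r. r \<odot>\<^bsub>M\<^esub> m) ` carrier R"
  have L: "submodule ?L R M" using submodule_cyclic[OF m(1)] .
  note Ld = submoduleD[OF L] and Nd = submoduleD[OF fully_invariantD(1)[OF N(1)]]
  note cl = fi_closure[OF Ld(1)]
  have "\<not> N \<inter> ?L \<subseteq> {\<zero>\<^bsub>M\<^esub>}"
  proof
    assume NL: "N \<inter> ?L \<subseteq> {\<zero>\<^bsub>M\<^esub>}"
    have "f x \<in> P" if f: "f \<in> mhom R M M" "f ` carrier M \<subseteq> fi_closure ?L" and x: "x \<in> N" for f x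
    proof -
      have "f ` N \<subseteq> {\<zero>\<^bsub>M\<^esub>}"
      proof (rule projective_into_sum[OF proj, where I = "mhom R M M" and L = "\<lambda>_. ?L" and g = "\<lambda>g. g"])
        show "f ` carrier M \<subseteq> submodule_sum R M ((\<lambda>g. g ` ?L) ` mhom R M M)"
          using f(2) by (simp add: fi_closure_def)
        show "g (u z) \<in> {\<zero>\<^bsub>M\<^esub>}"
          if "g \<in> mhom R M M" "u \<in> mhom R M M" "u ` carrier M \<subseteq> ?L" "z \<in> N" for g u z
        proof -
          have "u z \<in> N \<inter> ?L" using that fully_invariantD(2)[OF N(1)] Nd(2) by blast
          then have "u z = \<zero>\<^bsub>M\<^esub>" using NL by blast
          then show ?thesis using mhom_zero[OF left_module_axioms left_module_axioms that(1)] by simp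
        qed
      qed (use L submodule_zero Nd(1) f(1) in auto)
      then show ?thesis using x submoduleD(3)[OF prime_inD(2)[OF P]] by auto
    qed
    then have "N \<subseteq> P \<or> fi_closure ?L \<subseteq> P" by (rule prime_inD(4)[OF P N(1) cl(1)])
    moreover have "m \<in> ?L" using m(1) by (metis R.one_closed imageI smult_one)
    ultimately show False using N(2) m(2) cl(2) by blast
  qed
  then show thesis using that by blast
qed

end

section \<open>Essential submodules and uniform dimension\<close>

lemma essential_trans:
  assumes Q: "left_module R Q" and Y: "essential R Q Y" and S: "essential R (Q\<lparr>carrier := Y\<rparr>) S"
  shows "essential R Q S"
proof -
  interpret Q: plain_module R Q using Q by (rule plain_moduleI)
  have Ys: "submodule Y R Q" using Y by (simp add: essential_def)
  interpret Y: plain_module R "Q\<lparr>carrier := Y\<rparr>"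
    using Q.submodule_left_module[OF Ys] by (rule plain_moduleI)
  have Ss: "submodule S R Q"
    using S submodule_restrict_iff[OF Q Ys] by (simp add: essential_def)
  moreover have "\<exists>r\<in>carrier R. r \<odot>\<^bsub>Q\<^esub> x \<in> S \<and> r \<odot>\<^bsub>Q\<^esub> x \<noteq> \<zero>\<^bsub>Q\<^esub>"
    if x: "x \<in> carrier Q" "x \<noteq> \<zero>\<^bsub>Q\<^esub>" for x
  proof -
    obtain r where r: "r \<in> carrier R" "r \<odot>\<^bsub>Q\<^esub> x \<in> Y" "r \<odot>\<^bsub>Q\<^esub> x \<noteq> \<zero>\<^bsub>Q\<^esub>"
      using Y x unfolding Q.essential_iff by blast
    then obtain s where s: "s \<in> carrier R" "s \<odot>\<^bsub>Q\<^esub> (r \<odot>\<^bsub>Q\<^esub> x) \<in> S" "s \<odot>\<^bsub>Q\<^esub> (r \<odot>\<^bsub>Q\<^esub> x) \<noteq> \<zero>\<^bsub>Q\<^esub>"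
      using S unfolding Y.essential_iff by auto
    then show ?thesis
      using r(1) x(1) by (intro bexI[of _ "s \<otimes>\<^bsub>R\<^esub> r"]) (simp_all add: Q.smult_assoc1)
  qed
  ultimately show ?thesis unfolding Q.essential_iff by blast
qed

text \<open>Scalars are accumulated one index at a time. If the current multiple has zero image
  under \<open>\<psi> k\<close>, nothing is needed. Otherwise a further scalar brings this image
  into \<open>D k\<close> without killing it, hence without killing the element, and the conditions
  already met persist because the \<open>D i\<close> are submodules.\<close>

lemma essential_multiplier:
  fixes A :: "'i \<Rightarrow> ('r, 'a) module"
  assumes V: "left_module R V" and "finite T"
    and A: "\<And>i. i \<in> T \<Longrightarrow> left_module R (A i)"
    and \<psi>: "\<And>i. i \<in> T \<Longrightarrow> \<psi> i \<in> mhom R V (A i)"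
    and D: "\<And>i. i \<in> T \<Longrightarrow> essential R (A i) (D i)"
    and y: "y \<in> carrier V" "y \<noteq> \<zero>\<^bsub>V\<^esub>"
  shows "\<exists>r\<in>carrier R. r \<odot>\<^bsub>V\<^esub> y \<noteq> \<zero>\<^bsub>V\<^esub> \<and> (\<forall>i\<in>T. \<psi> i (r \<odot>\<^bsub>V\<^esub> y) \<in> D i)"
  using assms(2-5)
proof (induction T)
  case empty
  interpret V: plain_module R V using V by (rule plain_moduleI)
  show ?case using y by (intro bexI[of _ "\<one>\<^bsub>R\<^esub>"]) auto
next
  case (insert k T)
  interpret V: plain_module R V using V by (rule plain_moduleI)
  have k: "left_module R (A k)" "\<psi> k \<in> mhom R V (A k)" "essential R (A k) (D k)"
    using insert.prems by auto
  interpret Ak: plain_module R "A k" using k(1) by (rule plain_moduleI)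
  have "\<exists>r\<in>carrier R. r \<odot>\<^bsub>V\<^esub> y \<noteq> \<zero>\<^bsub>V\<^esub> \<and> (\<forall>i\<in>T. \<psi> i (r \<odot>\<^bsub>V\<^esub> y) \<in> D i)"
    using insert.prems by (intro insert.IH) auto
  then obtain r where r: "r \<in> carrier R" "r \<odot>\<^bsub>V\<^esub> y \<noteq> \<zero>\<^bsub>V\<^esub>" "\<And>i. i \<in> T \<Longrightarrow> \<psi> i (r \<odot>\<^bsub>V\<^esub> y) \<in> D i"
    by blast
  let ?z = "r \<odot>\<^bsub>V\<^esub> y"
  have z: "?z \<in> carrier V" using r(1) y(1) by simp
  have Ds: "submodule (D i) R (A i)" if "i \<in> insert k T" for i
    using insert.prems(3)[OF that] by (simp add: essential_def)
  show ?case
  proof (cases "\<psi> k ?z = \<zero>\<^bsub>A k\<^esub>")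
    case True
    then show ?thesis using r submoduleD(3)[OF Ds[of k]] by auto
  next
    case False
    then obtain s where s: "s \<in> carrier R" "s \<odot>\<^bsub>A k\<^esub> \<psi> k ?z \<in> D k" "s \<odot>\<^bsub>A k\<^esub> \<psi> k ?z \<noteq> \<zero>\<^bsub>A k\<^esub>"
      using k(3) mhomD(1)[OF k(2) z] unfolding Ak.essential_iff by blast
    have eq: "(s \<otimes>\<^bsub>R\<^esub> r) \<odot>\<^bsub>V\<^esub> y = s \<odot>\<^bsub>V\<^esub> ?z" using s(1) r(1) y(1) by (simp add: V.smult_assoc1)
    have \<psi>z: "\<psi> i (s \<odot>\<^bsub>V\<^esub> ?z) = s \<odot>\<^bsub>A i\<^esub> \<psi> i ?z" if "i \<in> insert k T" for i
      using mhomD(3)[OF insert.prems(2)[OF that] s(1) z] .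
    have "s \<odot>\<^bsub>V\<^esub> ?z \<noteq> \<zero>\<^bsub>V\<^esub>"
      using \<psi>z[of k] s(3) mhom_zero[OF V k(1,2)] by auto
    moreover have "\<psi> i (s \<odot>\<^bsub>V\<^esub> ?z) \<in> D i" if "i \<in> insert k T" for i
      using that \<psi>z[OF that] s(1,2) r(3) submoduleD(5)[OF Ds[OF that] s(1)] by auto
    ultimately show ?thesis using s(1) r(1) eq by (intro bexI[of _ "s \<otimes>\<^bsub>R\<^esub> r"]) auto
  qed
qed

text \<open>Some nonzero multiple of a nonzero element has all its components in the images of the
  \<open>W i\<close> at once. Elements of \<open>W i\<close> vanish in the other components, so
  subtracting them clears the components singly; joint injectivity leaves zero, and the multiple
  lies in \<open>S\<close>.\<close>

lemma essential_of_components: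
  fixes A :: "'i \<Rightarrow> ('r, 'a) module"
  assumes V: "left_module R V" and fin: "finite T"
    and A: "\<And>i. i \<in> T \<Longrightarrow> left_module R (A i)"
    and \<psi>: "\<And>i. i \<in> T \<Longrightarrow> \<psi> i \<in> mhom R V (A i)"
    and inj: "\<And>y. y \<in> carrier V \<Longrightarrow> (\<And>i. i \<in> T \<Longrightarrow> \<psi> i y = \<zero>\<^bsub>A i\<^esub>) \<Longrightarrow> y = \<zero>\<^bsub>V\<^esub>"
    and W: "\<And>i. i \<in> T \<Longrightarrow> W i \<subseteq> S"
    and diag: "\<And>i k w. i \<in> T \<Longrightarrow> k \<in> T \<Longrightarrow> k \<noteq> i \<Longrightarrow> w \<in> W i \<Longrightarrow> \<psi> k w = \<zero>\<^bsub>A k\<^esub>"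
    and ess: "\<And>i. i \<in> T \<Longrightarrow> essential R (A i) (\<psi> i ` W i)"
    and S: "submodule S R V"
  shows "essential R V S"
proof -
  interpret V: plain_module R V using V by (rule plain_moduleI)
  note Sd = submoduleD[OF S]
  \<comment> \<open>\<open>G\<close> collects the components that are still to be cleared.\<close>
  have claim: "y \<in> S"
    if "finite G" "G \<subseteq> T" "y \<in> carrier V" "\<And>i. i \<in> G \<Longrightarrow> \<psi> i y \<in> \<psi> i ` W i"
      "\<And>i. i \<in> T - G \<Longrightarrow> \<psi> i y = \<zero>\<^bsub>A i\<^esub>" for G y
    using that
  proof (induction G arbitrary: y)
    case empty
    then have "y = \<zero>\<^bsub>V\<^esub>" by (intro inj) auto
    then show ?case using Sd(3) by simp
  next
    case (insert k G)
    have k: "k \<in> T" using insert.prems(1) by simp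
    obtain w where w: "w \<in> W k" "\<psi> k y = \<psi> k w" using insert.prems(3)[of k] by auto
    have wS: "w \<in> S" and wV: "w \<in> carrier V" using w(1) W[OF k] Sd(2) by auto
    let ?z = "y \<oplus>\<^bsub>V\<^esub> \<ominus>\<^bsub>V\<^esub> w"
    have z: "?z \<in> carrier V" using insert.prems(2) wV by simp
    have \<psi>z: "\<psi> i ?z = \<psi> i y \<oplus>\<^bsub>A i\<^esub> \<ominus>\<^bsub>A i\<^esub> (\<psi> i w)" if "i \<in> T" for i
      using mhomD(2)[OF \<psi>[OF that]] mhom_minus[OF V A[OF that] \<psi>[OF that] wV] insert.prems(2) wV by simp
    have \<psi>zi: "\<psi> i ?z = \<psi> i y" if "i \<in> T" "i \<noteq> k" for i
    proof -
      interpret Ai: plain_module R "A i" using A[OF that(1)] by (rule plain_moduleI)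
      have "\<ominus>\<^bsub>A i\<^esub> \<zero>\<^bsub>A i\<^esub> = \<zero>\<^bsub>A i\<^esub>" by (metis Ai.M.l_zero Ai.M.a_inv_closed Ai.M.r_neg Ai.M.zero_closed)
      then show ?thesis
        using \<psi>z[OF that(1)] diag[OF k that w(1)] mhomD(1)[OF \<psi>[OF that(1)] insert.prems(2)] by simp
    qed
    have \<psi>zk: "\<psi> k ?z = \<zero>\<^bsub>A k\<^esub>"
    proof -
      interpret Ak: plain_module R "A k" using A[OF k] by (rule plain_moduleI)
      show ?thesis using \<psi>z[OF k] w(2) mhomD(1)[OF \<psi>[OF k] wV] by (simp add: Ak.r_neg)
    qed
    have "?z \<in> S"
    proof (rule insert.IH)
      show "G \<subseteq> T" using insert.prems(1) by simp
      show "?z \<in> carrier V" by (rule z)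
      show "\<psi> i ?z \<in> \<psi> i ` W i" if "i \<in> G" for i
      proof -
        have "\<psi> i ?z = \<psi> i y" using that insert.prems(1) insert.hyps(2) by (intro \<psi>zi) auto
        then show ?thesis using insert.prems(3)[of i] that by simp
      qed
      show "\<psi> i ?z = \<zero>\<^bsub>A i\<^esub>" if "i \<in> T - G" for i
        using that insert.prems(4) \<psi>zi[of i] \<psi>zk by (cases "i = k") auto
    qed
    then have "?z \<oplus>\<^bsub>V\<^esub> w \<in> S" using wS Sd(4) by blast
    moreover have "?z \<oplus>\<^bsub>V\<^esub> w = y" using insert.prems(2) wV by (simp add: V.a_assoc V.l_neg)
    ultimately show ?case by simp
  qed
  have "\<exists>r\<in>carrier R. r \<odot>\<^bsub>V\<^esub> y \<in> S \<and> r \<odot>\<^bsub>V\<^esub> y \<noteq> \<zero>\<^bsub>V\<^esub>" if y: "y \<in> carrier V" "y \<noteq> \<zero>\<^bsub>V\<^esub>" for y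
  proof -
    have "\<exists>r\<in>carrier R. r \<odot>\<^bsub>V\<^esub> y \<noteq> \<zero>\<^bsub>V\<^esub> \<and> (\<forall>i\<in>T. \<psi> i (r \<odot>\<^bsub>V\<^esub> y) \<in> \<psi> i ` W i)"
      using essential_multiplier[OF V fin, of A \<psi> "\<lambda>i. \<psi> i ` W i" y] A \<psi> ess y by simp
    then obtain r where r: "r \<in> carrier R" "r \<odot>\<^bsub>V\<^esub> y \<noteq> \<zero>\<^bsub>V\<^esub>" "\<And>i. i \<in> T \<Longrightarrow> \<psi> i (r \<odot>\<^bsub>V\<^esub> y) \<in> \<psi> i ` W i"
      by blast
    have "r \<odot>\<^bsub>V\<^esub> y \<in> S" by (rule claim[OF fin]) (use r y in auto)
    then show ?thesis using r by blast
  qed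
  then show ?thesis using S unfolding V.essential_iff by blast
qed

text \<open>For a minimal jointly injective subfamily of the \<^term>\<open>\<pi> i\<close>, the intersection of all kernels but
  one embeds in a uniform module; these intersections are the required uniform submodules.\<close>

lemma finite_uniform_dim_components:
  fixes U :: "'i \<Rightarrow> ('r, 'u) module"
  assumes Q: "left_module R Q" and Y: "essential R Q Y" and fin: "finite I"
    and U: "\<And>i. i \<in> I \<Longrightarrow> left_module R (U i)" "\<And>i. i \<in> I \<Longrightarrow> uniform_module R (U i)"
    and \<pi>: "\<And>i. i \<in> I \<Longrightarrow> \<pi> i \<in> mhom R (Q\<lparr>carrier := Y\<rparr>) (U i)"
    and inj: "\<And>y. y \<in> Y \<Longrightarrow> (\<And>i. i \<in> I \<Longrightarrow> \<pi> i y = \<zero>\<^bsub>U i\<^esub>) \<Longrightarrow> y = \<zero>\<^bsub>Q\<^esub>"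
  shows "finite_uniform_dim R Q"
proof -
  interpret Q: plain_module R Q using Q by (rule plain_moduleI)
  have Ys: "submodule Y R Q" using Y by (simp add: essential_def)
  have Ym: "left_module R (Q\<lparr>carrier := Y\<rparr>)" by (rule Q.submodule_left_module[OF Ys])
  interpret Y: plain_module R "Q\<lparr>carrier := Y\<rparr>" using Ym by (rule plain_moduleI)
  note Yd = submoduleD[OF Ys]
  \<comment> \<open>Joint injectivity on \<open>Y\<close> of the maps with index in
    \<open>T\<close>. A subfamily of least size takes the place of a dimension count.\<close>
  let ?ji = "\<lambda>T. T \<subseteq> I \<and> (\<forall>y\<in>Y. (\<forall>i\<in>T. \<pi> i y = \<zero>\<^bsub>U i\<^esub>) \<longrightarrow> y = \<zero>\<^bsub>Q\<^esub>)"
  have "?ji I" using inj by blast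
  then obtain T where T: "?ji T" and min: "\<And>T'. ?ji T' \<Longrightarrow> card T \<le> card T'"
    using ex_has_least_nat[of ?ji I card] by blast
  have finT: "finite T" using T fin finite_subset by blast
  have TI: "i \<in> I" if "i \<in> T" for i using T that by blast
  have injT: "y = \<zero>\<^bsub>Q\<^esub>" if "y \<in> Y" "\<And>i. i \<in> T \<Longrightarrow> \<pi> i y = \<zero>\<^bsub>U i\<^esub>" for y using T that by blast
  have \<pi>d: "\<pi> i y \<in> carrier (U i)" "\<pi> i (y \<oplus>\<^bsub>Q\<^esub> z) = \<pi> i y \<oplus>\<^bsub>U i\<^esub> \<pi> i z"
    "r \<in> carrier R \<Longrightarrow> \<pi> i (r \<odot>\<^bsub>Q\<^esub> y) = r \<odot>\<^bsub>U i\<^esub> \<pi> i y"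
    "\<pi> i \<zero>\<^bsub>Q\<^esub> = \<zero>\<^bsub>U i\<^esub>" "\<pi> i (\<ominus>\<^bsub>Q\<^esub> y) = \<ominus>\<^bsub>U i\<^esub> (\<pi> i y)"
    if "i \<in> T" "y \<in> Y" "z \<in> Y" for i y z r
  proof -
    note p = \<pi>[OF TI[OF that(1)]] and u = U(1)[OF TI[OF that(1)]]
    show "\<pi> i y \<in> carrier (U i)" "\<pi> i (y \<oplus>\<^bsub>Q\<^esub> z) = \<pi> i y \<oplus>\<^bsub>U i\<^esub> \<pi> i z"
      "r \<in> carrier R \<Longrightarrow> \<pi> i (r \<odot>\<^bsub>Q\<^esub> y) = r \<odot>\<^bsub>U i\<^esub> \<pi> i y"
      using mhomD[OF p] that by simp_all
    show "\<pi> i \<zero>\<^bsub>Q\<^esub> = \<zero>\<^bsub>U i\<^esub>" using mhom_zero[OF Ym u p] by simp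
    interpret Ui: plain_module R "U i" using u by (rule plain_moduleI)
    show "\<pi> i (\<ominus>\<^bsub>Q\<^esub> y) = \<ominus>\<^bsub>U i\<^esub> (\<pi> i y)"
      using mhomD[OF p] that Yd(2) by (simp add: Q.minus_eq_smult Ui.minus_eq_smult)
  qed
  define W where "W i = {y \<in> Y. \<forall>k\<in>T - {i}. \<pi> k y = \<zero>\<^bsub>U k\<^esub>}" for i
  have Wsub: "submodule (W i) R Q" for i
  proof (rule Q.submodule_intro)
    show "\<zero>\<^bsub>Q\<^esub> \<in> W i" using Yd(3) \<pi>d(4) by (auto simp: W_def)
    show "x \<oplus>\<^bsub>Q\<^esub> y \<in> W i" if "x \<in> W i" "y \<in> W i" for x y
    proof -
      have "\<pi> k (x \<oplus>\<^bsub>Q\<^esub> y) = \<zero>\<^bsub>U k\<^esub>" if k: "k \<in> T - {i}" for k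
      proof -
        interpret Uk: plain_module R "U k" using U(1) TI k by (intro plain_moduleI) blast
        show ?thesis using \<pi>d(2)[of k x y] k \<open>x \<in> W i\<close> \<open>y \<in> W i\<close> by (simp add: W_def)
      qed
      then show ?thesis using that Yd(4) by (simp add: W_def)
    qed
    show "r \<odot>\<^bsub>Q\<^esub> x \<in> W i" if "r \<in> carrier R" "x \<in> W i" for r x
    proof -
      have "\<pi> k (r \<odot>\<^bsub>Q\<^esub> x) = \<zero>\<^bsub>U k\<^esub>" if k: "k \<in> T - {i}" for k
      proof -
        interpret Uk: plain_module R "U k" using U(1) TI k by (intro plain_moduleI) blast
        show ?thesis using \<pi>d(3)[of k x x r] k \<open>x \<in> W i\<close> \<open>r \<in> carrier R\<close> by (simp add: W_def)
      qed
      then show ?thesis using that Yd(5) by (simp add: W_def)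
    qed
  qed (use Yd(1) in \<open>auto simp: W_def\<close>)
  have WY: "W i \<subseteq> Y" for i by (auto simp: W_def)
  have Winj: "\<pi> i x \<noteq> \<zero>\<^bsub>U i\<^esub>" if "i \<in> T" "x \<in> W i" "x \<noteq> \<zero>\<^bsub>Q\<^esub>" for i x
    using injT[of x] that by (auto simp: W_def)
  \<comment> \<open>If \<open>W i\<close> were zero, the family without \<open>i\<close> would still
    be jointly injective, against the choice of \<open>T\<close>.\<close>
  have Wnz: "\<exists>w\<in>W i. w \<noteq> \<zero>\<^bsub>Q\<^esub>" if "i \<in> T" for i
  proof (rule ccontr)
    assume "\<not> ?thesis"
    then have "?ji (T - {i})" using T by (auto simp: W_def)
    then have "card T \<le> card (T - {i})" by (rule min)
    then show False using finT that by (metis card_Diff1_less leD)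
  qed
  have ess: "essential R (U i) (\<pi> i ` N)"
    if "i \<in> T" and N: "submodule N R Q" "N \<subseteq> W i" "N \<noteq> {\<zero>\<^bsub>Q\<^esub>}" for i N
  proof -
    have "submodule N R (Q\<lparr>carrier := Y\<rparr>)" using N WY submodule_restrict_iff[OF Q Ys] by blast
    then have "submodule (\<pi> i ` N) R (U i)"
      using submodule_image[OF Ym U(1) \<pi>] TI that(1) by blast
    moreover obtain w where "w \<in> N" "w \<noteq> \<zero>\<^bsub>Q\<^esub>" using N(3) submoduleD(3)[OF N(1)] by blast
    then have "\<pi> i ` N \<noteq> {\<zero>\<^bsub>U i\<^esub>}" using Winj[OF that(1)] N(2) by blast
    ultimately show ?thesis using U(2)[OF TI[OF that(1)]] by (simp add: uniform_module_def)
  qed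
  have Wne: "W i \<noteq> {\<zero>\<^bsub>Q\<^esub>}" if "i \<in> T" for i using Wnz[OF that] by auto
  \<comment> \<open>\<open>\<pi> i\<close> is injective on \<open>W i\<close>, so uniformity
    descends from \<open>U i\<close>: a multiple of \<open>\<pi> i x\<close> equal to some
    \<open>\<pi> i z\<close> comes from a multiple of \<open>x\<close> equal to \<open>z\<close>,
    since \<open>\<pi> i\<close> kills the difference.\<close>
  have Wuni: "uniform_module R (Q\<lparr>carrier := W i\<rparr>)" if i: "i \<in> T" for i
    unfolding uniform_module_def
  proof (intro conjI allI impI)
    show "carrier (Q\<lparr>carrier := W i\<rparr>) \<noteq> {\<zero>\<^bsub>Q\<lparr>carrier := W i\<rparr>\<^esub>}" using Wne[OF i] by simp
    fix N assume "submodule N R (Q\<lparr>carrier := W i\<rparr>) \<and> N \<noteq> {\<zero>\<^bsub>Q\<lparr>carrier := W i\<rparr>\<^esub>}"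
    then have Nr: "submodule N R (Q\<lparr>carrier := W i\<rparr>)" and
      N: "submodule N R Q" "N \<subseteq> W i" "N \<noteq> {\<zero>\<^bsub>Q\<^esub>}" using submodule_restrict_iff[OF Q Wsub] by auto
    interpret Ui: plain_module R "U i" using U(1)[OF TI[OF i]] by (rule plain_moduleI)
    interpret Wi: plain_module R "Q\<lparr>carrier := W i\<rparr>"
      using Q.submodule_left_module[OF Wsub] by (rule plain_moduleI)
    have "\<exists>r\<in>carrier R. r \<odot>\<^bsub>Q\<^esub> x \<in> N \<and> r \<odot>\<^bsub>Q\<^esub> x \<noteq> \<zero>\<^bsub>Q\<^esub>" if x: "x \<in> W i" "x \<noteq> \<zero>\<^bsub>Q\<^esub>" for x
    proof -
      have xY: "x \<in> Y" using x WY by blast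
      obtain r where r: "r \<in> carrier R" "r \<odot>\<^bsub>U i\<^esub> \<pi> i x \<in> \<pi> i ` N" "r \<odot>\<^bsub>U i\<^esub> \<pi> i x \<noteq> \<zero>\<^bsub>U i\<^esub>"
        using ess[OF i N] Winj[OF i x] \<pi>d(1)[OF i xY xY] unfolding Ui.essential_iff by blast
      then obtain z where z: "z \<in> N" "r \<odot>\<^bsub>U i\<^esub> \<pi> i x = \<pi> i z" by blast
      have zY: "z \<in> Y" and zW: "z \<in> W i" using z N WY by blast+
      have rx: "r \<odot>\<^bsub>Q\<^esub> x \<in> W i" using submoduleD(5)[OF Wsub r(1) x(1)] .
      let ?d = "r \<odot>\<^bsub>Q\<^esub> x \<oplus>\<^bsub>Q\<^esub> \<ominus>\<^bsub>Q\<^esub> z"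
      have d: "?d \<in> W i"
        using submoduleD(4)[OF Wsub rx Q.submodule_minus[OF Wsub zW]] .
      have mz: "\<ominus>\<^bsub>Q\<^esub> z \<in> Y" using Q.submodule_minus[OF Ys zY] .
      have "\<pi> i ?d = r \<odot>\<^bsub>U i\<^esub> \<pi> i x \<oplus>\<^bsub>U i\<^esub> \<ominus>\<^bsub>U i\<^esub> (\<pi> i z)"
        using \<pi>d(2)[OF i _ mz] \<pi>d(3)[OF i xY xY r(1)] \<pi>d(5)[OF i zY zY] rx WY by (metis subsetD)
      then have "\<pi> i ?d = \<zero>\<^bsub>U i\<^esub>" using z(2) \<pi>d(1)[OF i zY zY] by (simp add: Ui.r_neg)
      then have "?d = \<zero>\<^bsub>Q\<^esub>" using Winj[OF i d] by blast
      then have "r \<odot>\<^bsub>Q\<^esub> x = z"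
        using submoduleD(2)[OF Wsub rx] submoduleD(2)[OF Wsub zW]
        by (metis Q.M.minus_equality Q.M.minus_minus Q.M.a_inv_closed)
      moreover have "r \<odot>\<^bsub>Q\<^esub> x \<noteq> \<zero>\<^bsub>Q\<^esub>"
        using r(3) \<pi>d(3)[OF i xY xY r(1)] \<pi>d(4)[OF i xY xY] by metis
      ultimately show ?thesis using r(1) z(1) by blast
    qed
    then show "essential R (Q\<lparr>carrier := W i\<rparr>) N"
      using Nr unfolding Wi.essential_iff by simp
  qed
  have sum_carrier: "\<Union>(W ` G) \<subseteq> carrier Q" for G using submoduleD(1)[OF Wsub] by blast
  have indep: "W i \<inter> submodule_sum R Q (W ` (T - {i})) = {\<zero>\<^bsub>Q\<^esub>}" if i: "i \<in> T" for i
  proof -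
    have Ui: "left_module R (U i)" using U(1)[OF TI[OF i]] .
    interpret Ui: plain_module R "U i" using Ui by (rule plain_moduleI)
    have "submodule {y \<in> carrier (Q\<lparr>carrier := Y\<rparr>). \<pi> i y \<in> {\<zero>\<^bsub>U i\<^esub>}} R (Q\<lparr>carrier := Y\<rparr>)"
      by (rule submodule_vimage[OF Ym Ui \<pi>[OF TI[OF i]] Ui.submodule_zero])
    then have "submodule {y \<in> Y. \<pi> i y = \<zero>\<^bsub>U i\<^esub>} R Q" using submodule_restrict_iff[OF Q Ys] by simp
    then have "submodule_sum R Q (W ` (T - {i})) \<subseteq> {y \<in> Y. \<pi> i y = \<zero>\<^bsub>U i\<^esub>}"
      by (rule Q.submodule_sum_least) (use i in \<open>auto simp: W_def\<close>)
    then have "W i \<inter> submodule_sum R Q (W ` (T - {i})) \<subseteq> {\<zero>\<^bsub>Q\<^esub>}" using Winj[OF i] by blast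
    moreover have "\<zero>\<^bsub>Q\<^esub> \<in> submodule_sum R Q (W ` (T - {i}))"
      using submoduleD(3)[OF Q.submodule_submodule_sum[OF sum_carrier]] .
    ultimately show ?thesis using submoduleD(3)[OF Wsub] by blast
  qed
  let ?S = "submodule_sum R Q (W ` T)"
  have SY: "submodule ?S R (Q\<lparr>carrier := Y\<rparr>)"
    unfolding submodule_restrict_iff[OF Q Ys]
    using Q.submodule_submodule_sum[OF sum_carrier] Q.submodule_sum_least[OF Ys] WY by blast
  \<comment> \<open>A nonzero submodule of a uniform module is essential, so each \<open>W i\<close>
    has essential image in \<open>U i\<close> and the component criterion applies inside
    \<open>Y\<close>.\<close>
  have "essential R (Q\<lparr>carrier := Y\<rparr>) ?S"
  proof (rule essential_of_components[OF Ym finT, where A = U and \<psi> = \<pi> and W = W])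
    show "essential R (U i) (\<pi> i ` W i)" if "i \<in> T" for i
      using ess[OF that Wsub _ Wne[OF that]] by blast
    show "W i \<subseteq> ?S" if "i \<in> T" for i using Q.submodule_sum_upper[of "W i" "W ` T"] that by simp
    show "\<pi> k w = \<zero>\<^bsub>U k\<^esub>" if "i \<in> T" "k \<in> T" "k \<noteq> i" "w \<in> W i" for i k w
      using that by (auto simp: W_def)
  qed (use U(1) \<pi> TI injT SY in auto)
  then have essS: "essential R Q ?S" by (rule essential_trans[OF Q Y])
  \<comment> \<open>\<open>has_uniform_dim\<close> numbers its summands from zero, so the members of
    \<open>T\<close> are enumerated accordingly.\<close>
  obtain e where e: "bij_betw e {..<card T} T"
    using ex_bij_betw_nat_finite[OF finT] atLeast0LessThan by metis
  have eT: "e i \<in> T" if "i < card T" for i using e that bij_betwE by blast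
  have imT: "(\<lambda>i. W (e i)) ` {..<card T} = W ` T"
    using e by (auto simp: bij_betw_def image_image[symmetric])
  have imD: "(\<lambda>i. W (e i)) ` ({..<card T} - {i}) = W ` (T - {e i})" if "i < card T" for i
  proof -
    have "e ` ({..<card T} - {i}) = T - {e i}"
      using e that by (auto simp: bij_betw_def inj_on_def)
    then show ?thesis by (metis image_image)
  qed
  have "has_uniform_dim R Q (card T)"
    unfolding has_uniform_dim_def
  proof (intro exI[of _ "\<lambda>i. W (e i)"] conjI allI impI)
    show "essential R Q (submodule_sum R Q ((\<lambda>i. W (e i)) ` {..<card T}))"
      using essS by (simp only: imT)
    show "W (e i) \<inter> submodule_sum R Q ((\<lambda>i. W (e i)) ` ({..<card T} - {i})) = {\<zero>\<^bsub>Q\<^esub>}"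
      if "i < card T" for i using indep[OF eT[OF that]] by (simp only: imD[OF that])
  qed (use Wsub Wuni eT in auto)
  then show ?thesis unfolding finite_uniform_dim_def by blast
qed

section \<open>Coordinates on an independent sum of submodules\<close>

context plain_module
begin

text \<open>\<open>submodule_sum\<close> is an intersection and does not show the form of its
  elements; comparison with the submodule of elementwise sums recovers a splitting.\<close>

lemma submodule_sum_insert:
  assumes "\<And>i. i \<in> insert k G \<Longrightarrow> submodule (U i) R M"
  shows "submodule_sum R M (U ` insert k G) \<subseteq>
    {x \<oplus>\<^bsub>M\<^esub> y |x y. x \<in> U k \<and> y \<in> submodule_sum R M (U ` G)}"
proof -
  have Uk: "submodule (U k) R M" using assms by simp
  have S: "submodule (submodule_sum R M (U ` G)) R M"
    by (rule submodule_submodule_sum) (use submoduleD(1)[OF assms] in blast)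
  show ?thesis
  proof (rule submodule_sum_least[OF submodule_set_add[OF Uk S]])
    fix H assume "H \<in> U ` insert k G"
    then consider "H = U k" | "H \<subseteq> submodule_sum R M (U ` G)"
      using submodule_sum_upper[of H "U ` G"] by blast
    then show "H \<subseteq> {x \<oplus>\<^bsub>M\<^esub> y |x y. x \<in> U k \<and> y \<in> submodule_sum R M (U ` G)}"
    proof cases
      case 1
      show ?thesis
      proof
        fix x assume "x \<in> H"
        then have "x \<in> U k" "x = x \<oplus>\<^bsub>M\<^esub> \<zero>\<^bsub>M\<^esub>" using 1 submoduleD(2)[OF Uk] by auto
        then show "x \<in> {x \<oplus>\<^bsub>M\<^esub> y |x y. x \<in> U k \<and> y \<in> submodule_sum R M (U ` G)}"
          using submoduleD(3)[OF S] by blast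
      qed
    next
      case 2
      show ?thesis
      proof
        fix y assume "y \<in> H"
        then have "y \<in> submodule_sum R M (U ` G)" "y = \<zero>\<^bsub>M\<^esub> \<oplus>\<^bsub>M\<^esub> y"
          using 2 submoduleD(2)[OF S] by auto
        then show "y \<in> {x \<oplus>\<^bsub>M\<^esub> y |x y. x \<in> U k \<and> y \<in> submodule_sum R M (U ` G)}"
          using submoduleD(3)[OF Uk] by blast
      qed
    qed
  qed
qed

text \<open>Independence makes the splitting into a part from \<open>U i\<close> and a part from the
  other summands unique, so the first part depends linearly on the element. An element whose first
  parts all vanish lies in every sum that omits one index, and this forces it to be zero.\<close>

lemma independent_coordinates:
  fixes U :: "'i \<Rightarrow> 'm set"
  assumes U: "\<And>i. i \<in> I \<Longrightarrow> submodule (U i) R M"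
    and indep: "\<And>i. i \<in> I \<Longrightarrow> U i \<inter> submodule_sum R M (U ` (I - {i})) = {\<zero>\<^bsub>M\<^esub>}"
    and fin: "finite I"
  obtains \<pi> where
    "\<And>i. i \<in> I \<Longrightarrow> \<pi> i \<in> mhom R (M\<lparr>carrier := submodule_sum R M (U ` I)\<rparr>) (M\<lparr>carrier := U i\<rparr>)"
    "\<And>y. y \<in> submodule_sum R M (U ` I) \<Longrightarrow> (\<And>i. i \<in> I \<Longrightarrow> \<pi> i y = \<zero>\<^bsub>M\<^esub>) \<Longrightarrow> y = \<zero>\<^bsub>M\<^esub>"
proof -
  let ?V = "submodule_sum R M (U ` I)" and ?C = "\<lambda>i. submodule_sum R M (U ` (I - {i}))"
  have sub: "submodule (submodule_sum R M (U ` G)) R M" if "G \<subseteq> I" for G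
    by (rule submodule_submodule_sum) (use submoduleD(1)[OF U] that in blast)
  have Cs: "submodule (?C i) R M" for i by (rule sub) blast
  have Vs: "submodule ?V R M" by (rule sub) blast
  have unique: "u = u' \<and> v = v'"
    if "i \<in> I" "u \<in> U i" "u' \<in> U i" "v \<in> ?C i" "v' \<in> ?C i" "u \<oplus>\<^bsub>M\<^esub> v = u' \<oplus>\<^bsub>M\<^esub> v'" for i u u' v v'
  proof -
    have c: "u \<in> carrier M" "u' \<in> carrier M" "v \<in> carrier M" "v' \<in> carrier M"
      using that submoduleD(2)[OF U[OF that(1)]] submoduleD(2)[OF Cs] by auto
    have "u \<oplus>\<^bsub>M\<^esub> \<ominus>\<^bsub>M\<^esub> u' = (u \<oplus>\<^bsub>M\<^esub> v) \<oplus>\<^bsub>M\<^esub> (\<ominus>\<^bsub>M\<^esub> u' \<oplus>\<^bsub>M\<^esub> \<ominus>\<^bsub>M\<^esub> v)"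
      using c by (simp add: M.a_ac M.r_neg)
    also have "\<dots> = (u' \<oplus>\<^bsub>M\<^esub> v') \<oplus>\<^bsub>M\<^esub> (\<ominus>\<^bsub>M\<^esub> u' \<oplus>\<^bsub>M\<^esub> \<ominus>\<^bsub>M\<^esub> v)" using that(6) by simp
    also have "\<dots> = (u' \<oplus>\<^bsub>M\<^esub> \<ominus>\<^bsub>M\<^esub> u') \<oplus>\<^bsub>M\<^esub> (v' \<oplus>\<^bsub>M\<^esub> \<ominus>\<^bsub>M\<^esub> v)" using c by (simp add: M.a_ac)
    also have "\<dots> = v' \<oplus>\<^bsub>M\<^esub> \<ominus>\<^bsub>M\<^esub> v" using c by (simp add: M.r_neg)
    finally have eq: "u \<oplus>\<^bsub>M\<^esub> \<ominus>\<^bsub>M\<^esub> u' = v' \<oplus>\<^bsub>M\<^esub> \<ominus>\<^bsub>M\<^esub> v" .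
    have "u \<oplus>\<^bsub>M\<^esub> \<ominus>\<^bsub>M\<^esub> u' \<in> U i"
      using submoduleD(4)[OF U[OF that(1)] that(2) submodule_minus[OF U[OF that(1)] that(3)]] .
    moreover have "v' \<oplus>\<^bsub>M\<^esub> \<ominus>\<^bsub>M\<^esub> v \<in> ?C i"
      using submoduleD(4)[OF Cs that(5) submodule_minus[OF Cs that(4)]] .
    ultimately have "u \<oplus>\<^bsub>M\<^esub> \<ominus>\<^bsub>M\<^esub> u' = \<zero>\<^bsub>M\<^esub>" "v' \<oplus>\<^bsub>M\<^esub> \<ominus>\<^bsub>M\<^esub> v = \<zero>\<^bsub>M\<^esub>"
      using eq indep[OF that(1)] by auto
    then show ?thesis using c by (metis M.minus_equality M.minus_minus M.a_inv_closed)
  qed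
  have dec: "\<exists>u v. u \<in> U i \<and> v \<in> ?C i \<and> y = u \<oplus>\<^bsub>M\<^esub> v" if "i \<in> I" "y \<in> ?V" for i y
  proof -
    have "insert i (I - {i}) = I" using that(1) by blast
    then have "?V \<subseteq> {x \<oplus>\<^bsub>M\<^esub> y |x y. x \<in> U i \<and> y \<in> ?C i}"
      using submodule_sum_insert[of i "I - {i}" U] U by metis
    then show ?thesis using that(2) by blast
  qed
  then obtain a b where ab: "\<And>i y. i \<in> I \<Longrightarrow> y \<in> ?V \<Longrightarrow> a i y \<in> U i"
    "\<And>i y. i \<in> I \<Longrightarrow> y \<in> ?V \<Longrightarrow> b i y \<in> ?C i" "\<And>i y. i \<in> I \<Longrightarrow> y \<in> ?V \<Longrightarrow> y = a i y \<oplus>\<^bsub>M\<^esub> b i y"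
    by metis
  note Vm = submodule_left_module[OF Vs]
  have abc: "a i y \<in> carrier M" "b i y \<in> carrier M" if "i \<in> I" "y \<in> ?V" for i y
    using ab(1,2)[OF that] submoduleD(2)[OF U[OF that(1)]] submoduleD(2)[OF Cs] by auto
  have hom: "restrict (a i) (carrier (M\<lparr>carrier := ?V\<rparr>)) \<in> mhom R (M\<lparr>carrier := ?V\<rparr>) (M\<lparr>carrier := U i\<rparr>)"
    if i: "i \<in> I" for i
  proof (rule mhom_restrictI[OF Vm])
    fix x y r assume "x \<in> carrier (M\<lparr>carrier := ?V\<rparr>)"
    then have x: "x \<in> ?V" by simp
    show "a i x \<in> carrier (M\<lparr>carrier := U i\<rparr>)" using ab(1)[OF i x] by simp
    show "a i (x \<oplus>\<^bsub>M\<lparr>carrier := ?V\<rparr>\<^esub> y) = a i x \<oplus>\<^bsub>M\<lparr>carrier := U i\<rparr>\<^esub> a i y"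
      if "y \<in> carrier (M\<lparr>carrier := ?V\<rparr>)"
    proof -
      have y: "y \<in> ?V" using that by simp
      have xy: "x \<oplus>\<^bsub>M\<^esub> y \<in> ?V" using submoduleD(4)[OF Vs x y] .
      have "a i (x \<oplus>\<^bsub>M\<^esub> y) \<oplus>\<^bsub>M\<^esub> b i (x \<oplus>\<^bsub>M\<^esub> y) = x \<oplus>\<^bsub>M\<^esub> y" using ab(3)[OF i xy] by simp
      also have "\<dots> = (a i x \<oplus>\<^bsub>M\<^esub> b i x) \<oplus>\<^bsub>M\<^esub> (a i y \<oplus>\<^bsub>M\<^esub> b i y)"
        using ab(3)[OF i x] ab(3)[OF i y] by simp
      also have "\<dots> = (a i x \<oplus>\<^bsub>M\<^esub> a i y) \<oplus>\<^bsub>M\<^esub> (b i x \<oplus>\<^bsub>M\<^esub> b i y)"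
        using abc[OF i x] abc[OF i y] by (simp add: M.a_ac)
      finally have "a i (x \<oplus>\<^bsub>M\<^esub> y) = a i x \<oplus>\<^bsub>M\<^esub> a i y"
        using unique[OF i ab(1)[OF i xy] submoduleD(4)[OF U[OF i] ab(1)[OF i x] ab(1)[OF i y]]
            ab(2)[OF i xy] submoduleD(4)[OF Cs ab(2)[OF i x] ab(2)[OF i y]]] by blast
      then show ?thesis by simp
    qed
    show "a i (r \<odot>\<^bsub>M\<lparr>carrier := ?V\<rparr>\<^esub> x) = r \<odot>\<^bsub>M\<lparr>carrier := U i\<rparr>\<^esub> a i x" if r: "r \<in> carrier R"
    proof -
      have rx: "r \<odot>\<^bsub>M\<^esub> x \<in> ?V" using submoduleD(5)[OF Vs r x] .
      have "a i (r \<odot>\<^bsub>M\<^esub> x) \<oplus>\<^bsub>M\<^esub> b i (r \<odot>\<^bsub>M\<^esub> x) = r \<odot>\<^bsub>M\<^esub> x" using ab(3)[OF i rx] by simp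
      also have "\<dots> = r \<odot>\<^bsub>M\<^esub> (a i x \<oplus>\<^bsub>M\<^esub> b i x)" using ab(3)[OF i x] by simp
      also have "\<dots> = r \<odot>\<^bsub>M\<^esub> a i x \<oplus>\<^bsub>M\<^esub> r \<odot>\<^bsub>M\<^esub> b i x"
        using abc[OF i x] r by (simp add: smult_r_distr)
      finally have "a i (r \<odot>\<^bsub>M\<^esub> x) = r \<odot>\<^bsub>M\<^esub> a i x"
        using unique[OF i ab(1)[OF i rx] submoduleD(5)[OF U[OF i] r ab(1)[OF i x]]
            ab(2)[OF i rx] submoduleD(5)[OF Cs r ab(2)[OF i x]]] by blast
      then show ?thesis by simp
    qed
  qed
  \<comment> \<open>As \<open>y\<close> lies in \<open>?C k\<close>, it also splits with zero part
    in \<open>U k\<close>; uniqueness then removes \<open>k\<close> from \<open>G\<close>.\<close>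
  have zero: "y = \<zero>\<^bsub>M\<^esub>" if "finite G" "G \<subseteq> I" "y \<in> submodule_sum R M (U ` G)" "\<And>i. i \<in> G \<Longrightarrow> y \<in> ?C i" for G y
    using that
  proof (induction G arbitrary: y)
    case empty
    have "submodule_sum R M (U ` {}) \<subseteq> {\<zero>\<^bsub>M\<^esub>}" by (rule submodule_sum_least[OF submodule_zero]) simp
    then show ?case using empty.prems(2) by blast
  next
    case (insert k G)
    have k: "k \<in> I" using insert.prems(1) by simp
    obtain u v where uv: "u \<in> U k" "v \<in> submodule_sum R M (U ` G)" "y = u \<oplus>\<^bsub>M\<^esub> v"
      using submodule_sum_insert[of k G U] U insert.prems(1,2) by blast
    have "submodule_sum R M (U ` G) \<subseteq> ?C k"
    proof (rule submodule_sum_least[OF Cs])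
      fix H assume "H \<in> U ` G"
      then have "H \<in> U ` (I - {k})" using insert.hyps(2) insert.prems(1) by blast
      then show "H \<subseteq> ?C k" by (rule submodule_sum_upper)
    qed
    then have v: "v \<in> ?C k" using uv(2) by blast
    have c: "u \<in> carrier M" "v \<in> carrier M"
      using submoduleD(2)[OF U[OF k] uv(1)] submoduleD(2)[OF Cs v] .
    have y: "y \<in> ?C k" using insert.prems(3) by simp
    have "\<zero>\<^bsub>M\<^esub> \<oplus>\<^bsub>M\<^esub> y = u \<oplus>\<^bsub>M\<^esub> v" using uv(3) c by simp
    then have "\<zero>\<^bsub>M\<^esub> = u" "y = v"
      using unique[OF k submoduleD(3)[OF U[OF k]] uv(1) y v] by blast+
    then show ?case using insert.IH[of y] insert.prems uv(2) by simp
  qed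
  show thesis
  proof (rule that[of "\<lambda>i. restrict (a i) (carrier (M\<lparr>carrier := ?V\<rparr>))"])
    fix y assume y: "y \<in> ?V"
      and y0: "\<And>i. i \<in> I \<Longrightarrow> restrict (a i) (carrier (M\<lparr>carrier := ?V\<rparr>)) y = \<zero>\<^bsub>M\<^esub>"
    have "y \<in> ?C i" if i: "i \<in> I" for i
    proof -
      have "a i y = \<zero>\<^bsub>M\<^esub>" using y0[OF i] y by simp
      then have "y = b i y" using ab(3)[OF i y] abc(2)[OF i y] by simp
      then show ?thesis using ab(2)[OF i y] by simp
    qed
    then show "y = \<zero>\<^bsub>M\<^esub>" using zero[OF fin _ y] by blast
  qed (rule hom)
qed

end

section \<open>Decomposition over the minimal primes\<close>

context plain_module
begin

text \<open>An essential sum of uniform submodules of \<open>M\<close> meets \<open>N\<close> in a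
  submodule that embeds in \<open>M/P\<close>, because \<open>N\<close> meets \<open>P\<close>
  trivially. The image is essential, and the coordinates of the sum provide jointly injective maps
  from it to uniform modules.\<close>

lemma quotient_finite_uniform_dim:
  assumes proj: "projective_in_sigma R M" and P: "prime_in R M P"
    and N: "fully_invariant R M N" "\<not> N \<subseteq> P" "N \<inter> P = {\<zero>\<^bsub>M\<^esub>}"
    and dim: "finite_uniform_dim R M"
  shows "finite_uniform_dim R (quot_module M P)"
proof -
  obtain k :: nat and U :: "nat \<Rightarrow> 'm set" where U: "\<And>i. i < k \<Longrightarrow> submodule (U i) R M"
    "\<And>i. i < k \<Longrightarrow> uniform_module R (M\<lparr>carrier := U i\<rparr>)"
    and indep: "\<And>i. i < k \<Longrightarrow> U i \<inter> submodule_sum R M (U ` ({..<k} - {i})) = {\<zero>\<^bsub>M\<^esub>}"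
    and ess: "essential R M (submodule_sum R M (U ` {..<k}))"
    using dim unfolding finite_uniform_dim_def has_uniform_dim_def by blast
  define V where "V = submodule_sum R M (U ` {..<k})"
  have V: "submodule V R M" using ess by (simp add: V_def essential_def)
  obtain \<pi> where \<pi>: "\<And>i. i < k \<Longrightarrow> \<pi> i \<in> mhom R (M\<lparr>carrier := V\<rparr>) (M\<lparr>carrier := U i\<rparr>)"
    "\<And>y. y \<in> V \<Longrightarrow> (\<And>i. i < k \<Longrightarrow> \<pi> i y = \<zero>\<^bsub>M\<^esub>) \<Longrightarrow> y = \<zero>\<^bsub>M\<^esub>"
    using independent_coordinates[of "{..<k}" U] U indep unfolding V_def by auto
  define D where "D = N \<inter> V"
  have Ns: "submodule N R M" using fully_invariantD(1)[OF N(1)] .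
  have D: "submodule D R M" unfolding D_def by (rule submodule_Int[OF Ns V])
  have Ps: "submodule P R M" using prime_inD(2)[OF P] .
  have Q: "left_module R (quot_module M P)" by (rule quot_left_module[OF Ps])
  interpret Q: plain_module R "quot_module M P" using Q by (rule plain_moduleI)
  define q where "q = (\<lambda>x\<in>carrier M. P +>\<^bsub>M\<^esub> x)"
  have q: "q \<in> mhom R M (quot_module M P)" unfolding q_def by (rule quot_map_mhom[OF Ps])
  have q0: "q x = \<zero>\<^bsub>quot_module M P\<^esub> \<longleftrightarrow> x \<in> P" if "x \<in> carrier M" for x
    using coset_eq_zero_iff[OF Ps that] that by (simp add: q_def)
  have DM: "x \<in> carrier M" if "x \<in> D" for x using submoduleD(2)[OF D that] .
  have q_inj: "inj_on q D"
  proof (rule inj_onI)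
    fix x y assume xy: "x \<in> D" "y \<in> D" "q x = q y"
    have "x \<oplus>\<^bsub>M\<^esub> \<ominus>\<^bsub>M\<^esub> y \<in> P" using xy DM by (simp add: q_def coset_eq_iff[OF Ps])
    moreover have "x \<oplus>\<^bsub>M\<^esub> \<ominus>\<^bsub>M\<^esub> y \<in> N"
      using submoduleD(4)[OF D xy(1) submodule_minus[OF D xy(2)]] by (simp add: D_def)
    ultimately have "x \<oplus>\<^bsub>M\<^esub> \<ominus>\<^bsub>M\<^esub> y = \<zero>\<^bsub>M\<^esub>" using N(3) by blast
    then show "x = y" using DM[OF xy(1)] DM[OF xy(2)] by (metis M.minus_equality M.minus_minus M.a_inv_closed)
  qed
  have Y: "submodule (q ` D) R (quot_module M P)" by (rule submodule_image[OF left_module_axioms Q q D])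
  have essY: "essential R (quot_module M P) (q ` D)"
    unfolding Q.essential_iff
  proof (intro conjI Y ballI impI)
    fix X assume X: "X \<in> carrier (quot_module M P)" "X \<noteq> \<zero>\<^bsub>quot_module M P\<^esub>"
    obtain m where m: "m \<in> carrier M" "X = q m" using X(1) unfolding quot_carrier[OF Ps] by (auto simp: q_def)
    have "m \<notin> P" using X(2) q0 m by blast
    \<comment> \<open>The scalar \<open>r\<close> moves \<open>m\<close> into \<open>N\<close>, then
      \<open>s\<close> moves the result into \<open>V\<close>. The nonzero outcome lies in
      \<open>N\<close>, hence outside \<open>P\<close>, and survives in the quotient.\<close>
    then obtain r where r: "r \<in> carrier R" "r \<odot>\<^bsub>M\<^esub> m \<in> N" "r \<odot>\<^bsub>M\<^esub> m \<noteq> \<zero>\<^bsub>M\<^esub>"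
      using smult_in_prime_complement[OF proj P N(1,2) m(1)] by blast
    then obtain s where s: "s \<in> carrier R" "s \<odot>\<^bsub>M\<^esub> (r \<odot>\<^bsub>M\<^esub> m) \<in> V" "s \<odot>\<^bsub>M\<^esub> (r \<odot>\<^bsub>M\<^esub> m) \<noteq> \<zero>\<^bsub>M\<^esub>"
      using ess m(1) unfolding essential_iff V_def by (meson smult_closed)
    let ?c = "(s \<otimes>\<^bsub>R\<^esub> r) \<odot>\<^bsub>M\<^esub> m"
    have c: "?c = s \<odot>\<^bsub>M\<^esub> (r \<odot>\<^bsub>M\<^esub> m)" using s r m by (simp add: smult_assoc1)
    have "?c \<in> D" using c s(2) submoduleD(5)[OF Ns s(1) r(2)] by (simp add: D_def)
    moreover have "?c \<notin> P" using c s(3) N(3) calculation unfolding D_def by auto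
    moreover have "(s \<otimes>\<^bsub>R\<^esub> r) \<odot>\<^bsub>quot_module M P\<^esub> X = q ?c"
      using mhomD(3)[OF q _ m(1)] s(1) r(1) m(2) by simp
    ultimately show "\<exists>r\<in>carrier R. r \<odot>\<^bsub>quot_module M P\<^esub> X \<in> q ` D \<and> r \<odot>\<^bsub>quot_module M P\<^esub> X \<noteq> \<zero>\<^bsub>quot_module M P\<^esub>"
      using s(1) r(1) q0[of ?c] DM by (intro bexI[of _ "s \<otimes>\<^bsub>R\<^esub> r"]) auto
  qed
  note i = inv_into_mhom[OF left_module_axioms q D q_inj]
  have iD: "inv_into D q y \<in> D" if "y \<in> q ` D" for y using that by (rule inv_into_into)
  show ?thesis
  proof (rule finite_uniform_dim_components[OF Q essY, where I = "{..<k}"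
        and U = "\<lambda>i. M\<lparr>carrier := U i\<rparr>" and \<pi> = "\<lambda>i. restrict (\<lambda>y. \<pi> i (inv_into D q y)) (q ` D)"])
    fix l assume l: "l \<in> {..<k}"
    show "left_module R (M\<lparr>carrier := U l\<rparr>)" "uniform_module R (M\<lparr>carrier := U l\<rparr>)"
      using U l submodule_left_module by auto
    note pd = mhomD[OF \<pi>(1)[of l]]
    have "restrict (\<lambda>y. \<pi> l (inv_into D q y)) (carrier ((quot_module M P)\<lparr>carrier := q ` D\<rparr>))
      \<in> mhom R ((quot_module M P)\<lparr>carrier := q ` D\<rparr>) (M\<lparr>carrier := U l\<rparr>)"
    proof (rule mhom_restrictI[OF Q.submodule_left_module[OF Y]])
    qed (use pd l i iD in \<open>auto simp: D_def simp del: quot_module_simps\<close>)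
    then show "restrict (\<lambda>y. \<pi> l (inv_into D q y)) (q ` D)
      \<in> mhom R ((quot_module M P)\<lparr>carrier := q ` D\<rparr>) (M\<lparr>carrier := U l\<rparr>)"
      by simp
  next
    fix y assume y: "y \<in> q ` D"
      and y0: "\<And>l. l \<in> {..<k} \<Longrightarrow> restrict (\<lambda>y. \<pi> l (inv_into D q y)) (q ` D) y = \<zero>\<^bsub>M\<lparr>carrier := U l\<rparr>\<^esub>"
    have "inv_into D q y = \<zero>\<^bsub>M\<^esub>"
    proof (rule \<pi>(2))
      show "inv_into D q y \<in> V" using iD[OF y] by (simp add: D_def)
      show "\<pi> l (inv_into D q y) = \<zero>\<^bsub>M\<^esub>" if "l < k" for l using y0[of l] y that by simp
    qed
    then have "y = q \<zero>\<^bsub>M\<^esub>" using f_inv_into_f[OF y] by simp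
    then show "y = \<zero>\<^bsub>quot_module M P\<^esub>" using mhom_zero[OF left_module_axioms Q q] by simp
  qed simp
qed

text \<open>The hypotheses on \<^term>\<open>N\<close> hold for the intersection of the other minimal primes.\<close>

lemma injective_hull_direct_sum:
  fixes E :: "('r, 'e) module" and F :: "'i \<Rightarrow> ('r, 'f) module"
  assumes proj: "projective_in_sigma R M" and fin: "finite I"
    and P: "\<And>i. i \<in> I \<Longrightarrow> prime_in R M (P i)"
    and N: "\<And>i. i \<in> I \<Longrightarrow> fully_invariant R M (N i)" "\<And>i. i \<in> I \<Longrightarrow> \<not> N i \<subseteq> P i"
      "\<And>i. i \<in> I \<Longrightarrow> N i \<inter> P i = {\<zero>\<^bsub>M\<^esub>}" "\<And>i k. i \<in> I \<Longrightarrow> k \<in> I \<Longrightarrow> k \<noteq> i \<Longrightarrow> N i \<subseteq> P k"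
    and inter: "\<And>x. x \<in> carrier M \<Longrightarrow> (\<And>i. i \<in> I \<Longrightarrow> x \<in> P i) \<Longrightarrow> x = \<zero>\<^bsub>M\<^esub>"
    and E: "injective_hull R M M E"
    and F: "\<And>i. i \<in> I \<Longrightarrow> injective_hull R M (quot_module M (P i)) (F i)"
  shows "miso R E (direct_sum I F)"
proof -
  have M: "left_module R M" by (rule left_module_axioms)
  obtain j where j: "j \<in> mhom R M E" "inj_on j (carrier M)" "essential R E (j ` carrier M)"
    and Es: "subgenerated R M E" and Ei: "rel_injective R M E"
    using E unfolding injective_hull_def by blast
  have Em: "left_module R E" using Es by (simp add: subgenerated_def)
  have Fs: "subgenerated R M (F i)" and Fi: "rel_injective R M (F i)" if "i \<in> I" for i
    using F[OF that] by (auto simp: injective_hull_def)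
  have Fm: "left_module R (F i)" if "i \<in> I" for i using Fs[OF that] by (simp add: subgenerated_def)
  have "\<exists>f. f \<in> mhom R (quot_module M (P i)) (F i) \<and> inj_on f (carrier (quot_module M (P i))) \<and>
      essential R (F i) (f ` carrier (quot_module M (P i)))" if "i \<in> I" for i
    using F[OF that] unfolding injective_hull_def by blast
  then obtain f where f: "\<And>i. i \<in> I \<Longrightarrow> f i \<in> mhom R (quot_module M (P i)) (F i)"
    "\<And>i. i \<in> I \<Longrightarrow> inj_on (f i) (carrier (quot_module M (P i)))"
    "\<And>i. i \<in> I \<Longrightarrow> essential R (F i) (f i ` carrier (quot_module M (P i)))"
    by metis
  define G where "G = direct_sum I F"
  have Gm: "left_module R G" unfolding G_def by (rule direct_sum_left_module[OF R.ring_axioms Fm])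
  interpret G: plain_module R G using Gm by (rule plain_moduleI)
  have Ps: "submodule (P i) R M" if "i \<in> I" for i using prime_inD(2)[OF P[OF that]] .
  \<comment> \<open>Projection to \<open>M/P i\<close> followed by the embedding in the hull; its
    kernel is \<open>P i\<close>, so together these maps embed \<open>M\<close> in
    \<open>G\<close>.\<close>
  define h where "h i = compose (carrier M) (f i) (\<lambda>x\<in>carrier M. P i +>\<^bsub>M\<^esub> x)" for i
  have h: "h i \<in> mhom R M (F i)" if "i \<in> I" for i
    unfolding h_def by (rule mhom_compose[OF M quot_map_mhom[OF Ps[OF that]] f(1)[OF that]])
  have h_eq: "h i x = f i (P i +>\<^bsub>M\<^esub> x)" if "x \<in> carrier M" for i x
    using that by (simp add: h_def compose_def)
  have h0: "h i x = \<zero>\<^bsub>F i\<^esub> \<longleftrightarrow> x \<in> P i" if i: "i \<in> I" and x: "x \<in> carrier M" for i x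
  proof -
    have Qm: "left_module R (quot_module M (P i))" by (rule quot_left_module[OF Ps[OF i]])
    have Px: "P i +>\<^bsub>M\<^esub> x \<in> carrier (quot_module M (P i))"
      using x unfolding quot_carrier[OF Ps[OF i]] by blast
    have "f i (P i +>\<^bsub>M\<^esub> x) = \<zero>\<^bsub>F i\<^esub> \<longleftrightarrow> P i +>\<^bsub>M\<^esub> x = \<zero>\<^bsub>quot_module M (P i)\<^esub>"
      using mhom_inj_iff[OF Qm Fm[OF i] f(1)[OF i]] f(2)[OF i] Px mhom_zero[OF Qm Fm[OF i] f(1)[OF i]]
      by auto
    then show ?thesis using h_eq[OF x] coset_eq_zero_iff[OF Ps[OF i] x] by simp
  qed
  define \<phi> where "\<phi> = (\<lambda>x\<in>carrier M. \<lambda>i\<in>I. h i x)"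
  have \<phi>: "\<phi> \<in> mhom R M G"
    unfolding \<phi>_def G_def using fin mhomD[OF h]
    by (intro mhom_restrictI[OF M]) (auto simp: direct_sum_carrier_iff fun_eq_iff)
  have \<phi>_inj: "inj_on \<phi> (carrier M)"
    unfolding mhom_inj_iff[OF M Gm \<phi>]
  proof (intro ballI impI)
    fix x assume x: "x \<in> carrier M" "\<phi> x = \<zero>\<^bsub>G\<^esub>"
    have "h i x = \<zero>\<^bsub>F i\<^esub>" if "i \<in> I" for i
      using fun_cong[OF x(2), of i] x(1) that by (simp add: \<phi>_def G_def)
    then show "x = \<zero>\<^bsub>M\<^esub>" using inter[OF x(1)] h0 x(1) by blast
  qed
  have \<phi>S: "submodule (\<phi> ` carrier M) R G"
    by (rule submodule_image[OF M Gm \<phi> submodule_carrier])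
  have NM: "x \<in> carrier M" if "i \<in> I" "x \<in> N i" for i x
    using submoduleD(2)[OF fully_invariantD(1)[OF N(1)[OF that(1)]] that(2)] .
  define pr where "pr i = (\<lambda>y\<in>carrier G. y i)" for i
  have pr: "pr i \<in> mhom R G (F i)" if "i \<in> I" for i
    unfolding pr_def using that by (intro mhom_restrictI[OF Gm]) (auto simp: G_def direct_sum_carrier_iff)
  have pr\<phi>: "pr i (\<phi> x) = h i x" if "i \<in> I" "x \<in> carrier M" for i x
    using that mhomD(1)[OF \<phi> that(2)] by (simp add: pr_def) (simp add: \<phi>_def)
  have ess\<phi>: "essential R G (\<phi> ` carrier M)"
  \<comment> \<open>The images of the \<open>N i\<close> vanish in the other components because
    \<open>N i\<close> lies in every other \<open>P k\<close>.\<close>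
  proof (rule essential_of_components[OF Gm fin, where A = F and \<psi> = pr and W = "\<lambda>i. \<phi> ` N i"])
    show "\<phi> ` N i \<subseteq> \<phi> ` carrier M" if "i \<in> I" for i using NM[OF that] by blast
    show "y = \<zero>\<^bsub>G\<^esub>" if "y \<in> carrier G" "\<And>i. i \<in> I \<Longrightarrow> pr i y = \<zero>\<^bsub>F i\<^esub>" for y
      unfolding G_def
      by (rule direct_sum_eqI[OF that(1)[unfolded G_def]])
         (use that G.M.zero_closed in \<open>auto simp: G_def pr_def\<close>)
    show "pr k w = \<zero>\<^bsub>F k\<^esub>" if ik: "i \<in> I" "k \<in> I" "k \<noteq> i" and w: "w \<in> \<phi> ` N i" for i k w
    proof -
      obtain x where x: "x \<in> N i" "w = \<phi> x" using w by blast
      then show ?thesis using pr\<phi>[OF ik(2)] h0[OF ik(2)] NM[OF ik(1)] N(4)[OF ik] by auto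
    qed
    show "essential R (F i) (pr i ` \<phi> ` N i)" if i: "i \<in> I" for i
    proof -
      interpret Fi: plain_module R "F i" using Fm[OF i] by (rule plain_moduleI)
      have img: "pr i ` \<phi> ` N i = h i ` N i"
        unfolding image_image using pr\<phi>[OF i NM[OF i]] by simp
      have "submodule (h i ` N i) R (F i)"
        by (rule submodule_image[OF M Fm[OF i] h[OF i] fully_invariantD(1)[OF N(1)[OF i]]])
      moreover have "\<exists>r\<in>carrier R. r \<odot>\<^bsub>F i\<^esub> x \<in> h i ` N i \<and> r \<odot>\<^bsub>F i\<^esub> x \<noteq> \<zero>\<^bsub>F i\<^esub>"
        if x: "x \<in> carrier (F i)" "x \<noteq> \<zero>\<^bsub>F i\<^esub>" for x
      proof -
        \<comment> \<open>Essentiality in the hull gives \<open>r\<close>, moving \<open>x\<close>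
          into the image of \<open>M/P i\<close>. Then \<open>s\<close> moves a representative
          \<open>m\<close> into \<open>N i\<close>, where nonzero elements are outside
          \<open>P i\<close> and keep a nonzero image.\<close>
        obtain r where r: "r \<in> carrier R" "r \<odot>\<^bsub>F i\<^esub> x \<in> f i ` carrier (quot_module M (P i))"
          "r \<odot>\<^bsub>F i\<^esub> x \<noteq> \<zero>\<^bsub>F i\<^esub>"
          using f(3)[OF i] x unfolding Fi.essential_iff by blast
        then obtain X where X: "X \<in> carrier (quot_module M (P i))" "r \<odot>\<^bsub>F i\<^esub> x = f i X" by blast
        then obtain m where m: "m \<in> carrier M" "r \<odot>\<^bsub>F i\<^esub> x = h i m"
          using h_eq unfolding quot_carrier[OF Ps[OF i]] by auto
        have "m \<notin> P i" using r(3) m h0[OF i] by auto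
        then obtain s where s: "s \<in> carrier R" "s \<odot>\<^bsub>M\<^esub> m \<in> N i" "s \<odot>\<^bsub>M\<^esub> m \<noteq> \<zero>\<^bsub>M\<^esub>"
          using smult_in_prime_complement[OF proj P[OF i] N(1,2)[OF i] m(1)] by blast
        have eq: "(s \<otimes>\<^bsub>R\<^esub> r) \<odot>\<^bsub>F i\<^esub> x = h i (s \<odot>\<^bsub>M\<^esub> m)"
          using s(1) r(1) x(1) m mhomD(3)[OF h[OF i] s(1) m(1)] by (simp add: Fi.smult_assoc1)
        have "s \<odot>\<^bsub>M\<^esub> m \<notin> P i" using s(2,3) N(3)[OF i] by blast
        then have "h i (s \<odot>\<^bsub>M\<^esub> m) \<noteq> \<zero>\<^bsub>F i\<^esub>" using h0[OF i] s(1) m(1) by simp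
        then show ?thesis using eq s(1,2) r(1) by (intro bexI[of _ "s \<otimes>\<^bsub>R\<^esub> r"]) auto
      qed
      ultimately show ?thesis unfolding img Fi.essential_iff by blast
    qed
  qed (use Fm pr \<phi>S in auto)
  have "rel_injective R M G"
    unfolding G_def by (rule rel_injective_direct_sum[OF M fin Fm Fi])
  then have EG: "rel_injective R E G" by (rule rel_injective_subgenerated[OF M Gm _ Es])
  \<comment> \<open>\<open>G\<close> is not first placed in \<open>\<sigma>[M]\<close>: it is
    generated by the \<open>F i\<close>, which are objects of \<open>\<sigma>[M]\<close>, so
    \<open>E\<close> is injective relative to each of them.\<close>
  have "rel_injective R G E"
  proof (rule rel_injective_generated[OF Gm Em, where X = F and I = I
        and \<iota> = "\<lambda>i. restrict (ds_single I F i) (carrier (F i))"])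
    show "rel_injective R (F i) E" if "i \<in> I" for i
      by (rule rel_injective_subgenerated[OF M Em Ei Fs[OF that]])
    show "restrict (ds_single I F i) (carrier (F i)) \<in> mhom R (F i) G" if "i \<in> I" for i
      unfolding G_def by (rule ds_single_mhom[OF Fm that])
    show "carrier G \<subseteq> T" if T: "submodule T R G"
      "\<And>i. i \<in> I \<Longrightarrow> restrict (ds_single I F i) (carrier (F i)) ` carrier (F i) \<subseteq> T" for T
      unfolding G_def
      by (rule direct_sum_generated[OF R.ring_axioms Fm T(1)[unfolded G_def]]) (use T(2) in auto)
  qed (use Fm in auto)
  then show ?thesis
    using injective_hull_unique[OF M Em Gm EG _ j \<phi> \<phi>_inj ess\<phi>] by (simp add: G_def)
qed

end

text \<open>Hulls are determined only up to isomorphism, so the first part ranges over arbitrary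
  choices of them, with independent element types for \<open>E\<close> and for the
  \<open>F i\<close>.\<close>

theorem corollary2p7:
  fixes R :: "('r, 'x) ring_scheme"
    and M :: "('r, 'm) module"
    and P :: "nat \<Rightarrow> 'm set"
    and n :: nat
  assumes "left_module R M"
    and "projective_in_sigma R M"
    and "semiprime_module R M"
    and "acc_left_annihilators R M"
    and "bij_betw P {1..n} (minimal_primes R M)"
  shows "(\<forall>(E :: ('r, 'e) module) (F :: nat \<Rightarrow> ('r, 'f) module).
            injective_hull R M M E \<and>
            (\<forall>i\<in>{1..n}. injective_hull R M (quot_module M (P i)) (F i)) \<longrightarrow>
            miso R E (direct_sum {1..n} F))
       \<and> (goldie_module R M \<longrightarrow> (\<forall>i\<in>{1..n}. finite_uniform_dim R (quot_module M (P i))))"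
proof -
  interpret M: plain_module R M using assms(1) by (rule plain_moduleI)
  have minP: "P i \<in> minimal_primes R M" if "i \<in> {1..n}" for i
    using bij_betwE[OF assms(5)] that by blast
  have P: "prime_in R M (P i)" if "i \<in> {1..n}" for i
    using minP[OF that] by (simp add: minimal_primes_def)
  note fiP = M.prime_inD(1)[OF P]
  have inter: "x = \<zero>\<^bsub>M\<^esub>" if "x \<in> carrier M" "\<And>i. i \<in> {1..n} \<Longrightarrow> x \<in> P i" for x
  proof (rule M.minimal_primes_Inter[OF assms(2,3) that(1)])
    fix Q assume "Q \<in> minimal_primes R M"
    then obtain i where "i \<in> {1..n}" "Q = P i" using assms(5) unfolding bij_betw_def by blast
    then show "x \<in> Q" using that(2) by blast
  qed
  \<comment> \<open>The factor \<open>carrier M\<close> matters for \<open>n = 1\<close>: the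
    intersection over no primes is then all of \<open>M\<close>.\<close>
  define N where "N i = carrier M \<inter> \<Inter>(P ` ({1..n} - {i}))" for i
  have N1: "fully_invariant R M (N i)" for i
    unfolding N_def by (rule M.fully_invariant_Inter) (use fiP in blast)
  \<comment> \<open>Otherwise primeness would put some other \<open>P k\<close> inside
    \<open>P i\<close>; minimality makes them equal, contrary to the injectivity of the
    numbering.\<close>
  have N2: "\<not> N i \<subseteq> P i" if i: "i \<in> {1..n}" for i
  proof
    assume "N i \<subseteq> P i"
    then have "\<exists>Q\<in>P ` ({1..n} - {i}). Q \<subseteq> P i"
      unfolding N_def by (intro M.prime_in_Inter[OF P[OF i]]) (use fiP in auto)
    then obtain k where k: "k \<in> {1..n}" "k \<noteq> i" "P k \<subseteq> P i" by blast
    then have "P k = P i" using minP[OF i] P[OF k(1)] by (auto simp: minimal_primes_def)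
    then show False using k i assms(5) by (auto simp: bij_betw_def dest: inj_onD)
  qed
  have N3: "N i \<inter> P i = {\<zero>\<^bsub>M\<^esub>}" if i: "i \<in> {1..n}" for i
  proof -
    have "x = \<zero>\<^bsub>M\<^esub>" if "x \<in> N i" "x \<in> P i" for x
      using that by (intro inter) (auto simp: N_def)
    then show ?thesis
      using submoduleD(3)[OF M.fully_invariantD(1)[OF N1]] submoduleD(3)[OF M.prime_inD(2)[OF P[OF i]]]
      by blast
  qed
  have N4: "N i \<subseteq> P k" if "k \<in> {1..n}" "k \<noteq> i" for i k using that by (auto simp: N_def)
  show ?thesis
  proof (intro conjI allI impI ballI)
    fix E :: "('r, 'e) module" and F :: "nat \<Rightarrow> ('r, 'f) module"
    assume "injective_hull R M M E \<and>
      (\<forall>i\<in>{1..n}. injective_hull R M (quot_module M (P i)) (F i))"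
    then show "miso R E (direct_sum {1..n} F)"
      using P N1 N2 N3 N4 inter
      by (intro M.injective_hull_direct_sum[OF assms(2), where N = N and P = P]) auto
  next
    fix i assume "goldie_module R M" and i: "i \<in> {1..n}"
    then show "finite_uniform_dim R (quot_module M (P i))"
      using M.quotient_finite_uniform_dim[OF assms(2) P[OF i] N1 N2[OF i] N3[OF i]]
      by (simp add: goldie_module_def)
  qed
qed

end
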